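(* For all reals $x,y\subseteq\omega$: $x\oplus y$ is $ITRM$-random iff $x$ is $ITRM$-random and $y$ is $ITRM$-random relative to $x$. In particular, if $x$ and $y$ are both $ITRM$-random, then $x$ is $ITRM$-random relative to $y$ iff $y$ is $ITRM$-random relative to $x$.
   Context: An infinite time register machine ($ITRM$) has finitely many registers, each holding a natural number, and runs a program of the same kind as a classical unlimited register machine (with an additional instruction querying membership of a number in an oracle), but in transfinite ordinal time: successor steps are as for register machines; at limit times the active program line is the limit inferior of earlier program lines and each register holds the limit inferior of its earlier contents, reset to $0$ if that limit inferior is infinite. $a\oplus b=\{2i\mid i\in a\}\cup\{2j+1\mid j\in b\}$. $X\subseteq\mathfrak{P}(\omega)$ is $ITRM$-decidable iff some program $P$, with any oracle $x$, halts with output $1$ if $x\in X$ and $0$ otherwise; $X$ is $ITRM$-decidable in the oracle $y$ iff some program $P$, with oracle $x\oplus y$, halts with output $1$ if $x\in X$ and $0$ otherwise, for every $x$. $x$ is $ITRM$-random iff no $ITRM$-decidable meager set contains $x$; $x$ is $ITRM$-random relative to $y$ iff no meager set $X\ni x$ is $ITRM$-decidable in the oracle $y$. *)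

theory Defs
  imports "HOL-Analysis.Analysis"
begin

section \<open>Infinite time register machines\<close>

text \<open>
  In \<open>Jump m n q\<close> the jump to line \<open>q\<close> is taken if registers \<open>m\<close> and \<open>n\<close> agree;
  \<open>Query n\<close> replaces the content of register \<open>n\<close> by \<open>1\<close> or \<open>0\<close> according to whether it
  belongs to the oracle.  A program refers to finitely many registers only; in the state
  (active line, register contents) all the others stay \<open>0\<close> for ever.
\<close>

datatype instr = Zero nat | Succ nat | Transfer nat nat | Jump nat nat nat | Query nat

type_synonym program = "instr list"
type_synonym state = "nat \<times> (nat \<Rightarrow> nat)"

fun exec :: "nat set \<Rightarrow> instr \<Rightarrow> state \<Rightarrow> state" where
  "exec x (Zero n) (l, R) = (Suc l, R(n := 0))"
| "exec x (Succ n) (l, R) = (Suc l, R(n := Suc (R n)))"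
| "exec x (Transfer m n) (l, R) = (Suc l, R(n := R m))"
| "exec x (Jump m n q) (l, R) = (if R m = R n then q else Suc l, R)"
| "exec x (Query n) (l, R) = (Suc l, R(n := (if R n \<in> x then 1 else 0)))"

definition halted :: "program \<Rightarrow> state \<Rightarrow> bool" where
  "halted P c \<longleftrightarrow> length P \<le> fst c"

definition step :: "program \<Rightarrow> nat set \<Rightarrow> state \<Rightarrow> state" where
  "step P x c = (if halted P c then c else exec x (P ! fst c) c)"

text \<open>
  Ordinal time is represented by a well-order \<open>r\<close>, whose elements below \<open>t\<close> are the times
  before \<open>t\<close>.
\<close>

definition liminf_below :: "'t rel \<Rightarrow> ('t \<Rightarrow> nat) \<Rightarrow> 't \<Rightarrow> enat" where
  "liminf_below r f t =
     (SUP s\<in>underS r t. INF u\<in>{u \<in> underS r t. (s, u) \<in> r}. enat (f u))"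

definition limit_value :: "'t rel \<Rightarrow> ('t \<Rightarrow> nat) \<Rightarrow> 't \<Rightarrow> nat" where
  "limit_value r f t =
     (if liminf_below r f t = \<infinity> then 0 else the_enat (liminf_below r f t))"

text \<open>
  For the active line the limit inferior is always finite, since only finitely many lines
  can occur; so the reset clause of \<^const>\<open>limit_value\<close> concerns the registers alone.
\<close>

definition limit_state :: "'t rel \<Rightarrow> ('t \<Rightarrow> state) \<Rightarrow> 't \<Rightarrow> state" where
  "limit_state r C t =
     (limit_value r (\<lambda>s. fst (C s)) t, \<lambda>n. limit_value r (\<lambda>s. snd (C s) n) t)"

definition immediate_pred :: "'t rel \<Rightarrow> 't \<Rightarrow> 't \<Rightarrow> bool" where
  "immediate_pred r s t \<longleftrightarrow> s \<in> underS r t \<and> (\<forall>u\<in>underS r t. (u, s) \<in> r)"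

definition computation :: "program \<Rightarrow> nat set \<Rightarrow> 't rel \<Rightarrow> ('t \<Rightarrow> state) \<Rightarrow> bool" where
  "computation P x r C \<longleftrightarrow> Well_order r \<and>
     (\<forall>t\<in>Field r.
        (underS r t = {} \<longrightarrow> C t = (0, \<lambda>_. 0)) \<and>
        (\<forall>s. immediate_pred r s t \<longrightarrow> C t = step P x (C s)) \<and>
        (underS r t \<noteq> {} \<and> (\<nexists>s. immediate_pred r s t) \<longrightarrow> C t = limit_state r C t))"

text \<open>
  The output is the content of register \<open>0\<close>.  Well-orders on the natural numbers represent
  the countable ordinals only.  This is no restriction: lemma \<open>computation_halts_with\<close> below
  shows that a computation along a well-order on any type, of whatever length, that halts
  with output \<open>k\<close> gives rise to one along a well-order on the natural numbers.
\<close>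

definition halts_with :: "program \<Rightarrow> nat set \<Rightarrow> nat \<Rightarrow> bool" where
  "halts_with P x k \<longleftrightarrow>
     (\<exists>(r :: nat rel) C. computation P x r C \<and>
        (\<exists>t\<in>Field r. halted P (C t) \<and> snd (C t) 0 = k))"

subsection \<open>Independence of the type carrying the well-order\<close>

lemma liminf_below_ge_iff:
  assumes "underS r t \<noteq> {}"
  shows "enat m \<le> liminf_below r f t \<longleftrightarrow>
     (\<exists>s\<in>underS r t. \<forall>u\<in>underS r t. (s, u) \<in> r \<longrightarrow> m \<le> f u)"
proof (cases m)
  case 0
  then show ?thesis using assms by (auto simp: zero_enat_def[symmetric])
next
  case (Suc k)
  have le: "enat (Suc k) \<le> a \<longleftrightarrow> enat k < a" for a
    by (cases a) auto
  have "enat k < liminf_below r f t \<longleftrightarrow>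
      (\<exists>s\<in>underS r t. enat k < (INF u\<in>{u \<in> underS r t. (s, u) \<in> r}. enat (f u)))"
    unfolding liminf_below_def by (rule less_SUP_iff)
  also have "\<dots> \<longleftrightarrow> (\<exists>s\<in>underS r t. \<forall>u\<in>underS r t. (s, u) \<in> r \<longrightarrow> Suc k \<le> f u)"
    unfolding le[symmetric] le_INF_iff by auto
  finally show ?thesis by (simp add: Suc le)
qed

lemma enat_eq_if_same_lower_bounds:
  assumes "\<And>m. enat m \<le> a \<longleftrightarrow> enat m \<le> b"
  shows "a = b"
proof (rule ccontr)
  assume "a \<noteq> b"
  then consider "a < b" | "b < a" by fastforce
  then show False
  proof cases
    case 1
    then obtain k where "a = enat k" by (cases a) auto
    with 1 assms[of "Suc k"] show False by (cases b) auto
  next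
    case 2
    then obtain k where "b = enat k" by (cases b) auto
    with 2 assms[of "Suc k"] show False by (cases a) auto
  qed
qed

lemma countable_closed_superset:
  fixes F :: "nat \<Rightarrow> 'a \<Rightarrow> 'a \<Rightarrow> 'a"
  assumes "countable A"
  shows "\<exists>B. A \<subseteq> B \<and> countable B \<and> (\<forall>k. \<forall>s\<in>B. \<forall>t\<in>B. F k s t \<in> B)"
proof -
  define G where "G X = X \<union> (\<Union>k. (\<lambda>(s, t). F k s t) ` (X \<times> X))" for X
  define Y where "Y n = (G ^^ n) A" for n
  have Y_Suc: "Y (Suc n) = G (Y n)" for n by (simp add: Y_def)
  have cnt: "countable (Y n)" for n
    by (induction n) (auto simp: Y_Suc G_def Y_def assms)
  have mono: "incseq Y"
    by (rule incseq_SucI) (auto simp: Y_Suc G_def)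
  show ?thesis
  proof (intro exI[of _ "\<Union>n. Y n"] conjI allI ballI)
    show "A \<subseteq> (\<Union>n. Y n)" by (auto simp: Y_def intro!: exI[of _ 0])
    show "countable (\<Union>n. Y n)" using cnt by blast
  next
    fix k s t
    assume "s \<in> (\<Union>n. Y n)" "t \<in> (\<Union>n. Y n)"
    then obtain i j where ij: "s \<in> Y i" "t \<in> Y j" by blast
    have "s \<in> Y (max i j)" "t \<in> Y (max i j)"
      using ij monoD[OF mono, of i "max i j"] monoD[OF mono, of j "max i j"] by auto
    then have "F k s t \<in> Y (Suc (max i j))"
      unfolding Y_Suc G_def by force
    then show "F k s t \<in> (\<Union>n. Y n)" by blast
  qed
qed

lemma computation_halts_with:
  fixes r :: "'t rel"
  assumes comp: "computation P x r C" and t0: "t0 \<in> Field r" "halted P (C t0)"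
  shows "halts_with P x (snd (C t0) 0)"
proof -
  have wo: "Well_order r" using comp by (simp add: computation_def)
  have "wo_rel r" using wo by (simp add: wo_rel_def)
  then have r_antisym: "a = b" if "(a, b) \<in> r" "(b, a) \<in> r" for a b
    using that by (meson wo_rel.ANTISYM antisymD)
  have underS_Field: "s \<in> Field r" if "s \<in> underS r t" for s t
    using that by (auto simp: underS_def Field_def)
  define val :: "nat \<Rightarrow> state \<Rightarrow> nat" where
    "val i c = (case i of 0 \<Rightarrow> fst c | Suc n \<Rightarrow> snd c n)" for i c
  define low where "low i m s t \<longleftrightarrow>
    s \<in> underS r t \<and> (\<forall>u\<in>underS r t. (s, u) \<in> r \<longrightarrow> m \<le> val i (C u))" for i m s t
  define high where "high i m s u t \<longleftrightarrow>
    u \<in> underS r t \<and> (s, u) \<in> r \<and> val i (C u) < m" for i m s u t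
  define pick where "pick Q t = (if \<exists>s. Q s then SOME s. Q s else t)" for Q and t :: 't
  have pick: "Q (pick Q t)" if "Q s" for Q s t
    unfolding pick_def using that by (auto intro: someI)
  have pick_Field: "pick Q t \<in> Field r"
    if "\<And>s. Q s \<Longrightarrow> s \<in> Field r" "t \<in> Field r" for Q t
    using that pick[of Q _ t] by (cases "\<exists>s. Q s") (auto simp: pick_def)
  define F where "F k s t = (case prod_decode k of (j, im) \<Rightarrow>
     (case prod_decode im of (i, m) \<Rightarrow>
       (if j = 0 then pick (\<lambda>u. u \<in> underS r t) t
        else if j = 1 then pick (\<lambda>u. immediate_pred r u t) t
        else if j = 2 then pick (\<lambda>u. u \<in> underS r t \<and> (u, s) \<notin> r) t
        else if j = 3 then pick (\<lambda>u. low i m u t) t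
        else pick (\<lambda>u. high i m s u t) t)))" for k s t
  have "countable {t0}" by simp
  then obtain B where B: "{t0} \<subseteq> B" "countable B"
      and closedB: "\<forall>k. \<forall>s\<in>B. \<forall>t\<in>B. F k s t \<in> B"
    using countable_closed_superset[of "{t0}" F] by metis
  define A where "A = B \<inter> Field r"
  have t0A: "t0 \<in> A" and cntA: "countable A" and AF: "A \<subseteq> Field r"
    using B t0 by (auto simp: A_def)
  have F_Field: "F k s t \<in> Field r" if "t \<in> Field r" for k s t
    unfolding F_def
    by (auto split: prod.split intro!: pick_Field that
        simp: low_def high_def immediate_pred_def dest: underS_Field)
  have closed: "F k s t \<in> A" if "s \<in> A" "t \<in> A" for k s t
    using that closedB F_Field by (auto simp: A_def)
  have A_under: "\<exists>u\<in>A. u \<in> underS r t" if "t \<in> A" "s \<in> underS r t" for s t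
    using closed[OF that(1) that(1), of "prod_encode (0, 0)"] pick[of "\<lambda>u. u \<in> underS r t", OF that(2)]
    by (auto simp: F_def split: prod.splits)
  have A_pred: "s \<in> A" if "t \<in> A" "immediate_pred r s t" for s t
  proof -
    have "immediate_pred r (pick (\<lambda>u. immediate_pred r u t) t) t"
      using that(2) by (rule pick)
    then have "pick (\<lambda>u. immediate_pred r u t) t = s"
      using that(2) r_antisym unfolding immediate_pred_def by blast
    then show ?thesis
      using closed[OF that(1) that(1), of "prod_encode (1, 0)"]
      by (auto simp: F_def split: prod.splits)
  qed
  have A_between: "\<exists>u\<in>A. u \<in> underS r t \<and> (u, s) \<notin> r"
    if "t \<in> A" "s \<in> A" "v \<in> underS r t" "(v, s) \<notin> r" for s t v
    using closed[OF that(2) that(1), of "prod_encode (2, 0)"]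
      pick[of "\<lambda>u. u \<in> underS r t \<and> (u, s) \<notin> r" v] that(3,4)
    by (auto simp: F_def split: prod.splits)
  have A_low: "\<exists>u\<in>A. low i m u t" if "t \<in> A" "low i m s t" for i m s t
    using closed[OF that(1) that(1), of "prod_encode (3, prod_encode (i, m))"]
      pick[of "\<lambda>u. low i m u t", OF that(2)]
    by (auto simp: F_def split: prod.splits)
  have A_high: "\<exists>u\<in>A. high i m s u t" if "t \<in> A" "s \<in> A" "high i m s v t" for i m s t v
    using closed[OF that(2) that(1), of "prod_encode (4, prod_encode (i, m))"]
      pick[of "\<lambda>u. high i m s u t", OF that(3)]
    by (auto simp: F_def split: prod.splits)

  define e where "e = to_nat_on A"
  define d where "d = from_nat_into A"
  have inj: "inj_on e A" using cntA by (auto simp: e_def)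
  have de: "d (e a) = a" if "a \<in> A" for a using that cntA by (simp add: d_def e_def)
  define r' where "r' = dir_image (Restr r A) e"
  have FR: "Field (Restr r A) = A"
    using wo AF by (intro Refl_Field_Restr2) (auto simp: order_on_defs)
  have wo': "Well_order r'"
    unfolding r'_def using Well_order_Restr[OF wo, of A] inj by (intro Well_order_dir_image) (simp_all only: FR)
  have F': "Field r' = e ` A" by (simp add: r'_def dir_image_Field FR)
  have r'_iff: "(e a, e b) \<in> r' \<longleftrightarrow> (a, b) \<in> r" if "a \<in> A" "b \<in> A" for a b
    using that inj by (auto simp: r'_def dir_image_def inj_on_def)
  have r'_sub: "r' \<subseteq> e ` A \<times> e ` A" by (auto simp: r'_def dir_image_def)
  have under': "underS r' (e t) = e ` (A \<inter> underS r t)" if "t \<in> A" for t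
  proof (intro subset_antisym subsetI)
    fix b assume b: "b \<in> underS r' (e t)"
    then obtain a where a: "a \<in> A" "b = e a" using r'_sub by (auto simp: underS_def)
    with b that show "b \<in> e ` (A \<inter> underS r t)" by (auto simp: underS_def r'_iff)
  qed (use that inj in \<open>auto simp: underS_def r'_iff inj_on_def\<close>)
  define C' where "C' = (\<lambda>n. C (d n))"
  have C'e: "C' (e t) = C t" if "t \<in> A" for t using that by (simp add: C'_def de)
  have pred': "immediate_pred r s t" if "t \<in> A" "s \<in> A" "immediate_pred r' (e s) (e t)" for s t
  proof -
    have s: "s \<in> underS r t"
      using that inj by (auto simp: immediate_pred_def under' inj_on_def)
    have "(u, s) \<in> r" if "u \<in> underS r t" for u
    proof (rule ccontr)
      assume "(u, s) \<notin> r"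
      with A_between \<open>t \<in> A\<close> \<open>s \<in> A\<close> that
      obtain v where v: "v \<in> A" "v \<in> underS r t" "(v, s) \<notin> r" by blast
      with \<open>immediate_pred r' (e s) (e t)\<close> \<open>t \<in> A\<close> have "(e v, e s) \<in> r'"
        by (auto simp: immediate_pred_def under')
      with v \<open>s \<in> A\<close> show False by (simp add: r'_iff)
    qed
    with s show ?thesis by (simp add: immediate_pred_def)
  qed
  have pred'': "immediate_pred r' (e s) (e t)" if "t \<in> A" "immediate_pred r s t" for s t
    using that A_pred[OF that] by (auto simp: immediate_pred_def under' r'_iff)
  have lim: "liminf_below r' (\<lambda>s. val i (C' s)) (e t) = liminf_below r (\<lambda>s. val i (C s)) t"
    if t: "t \<in> A" "underS r t \<noteq> {}" for i t
  proof (rule enat_eq_if_same_lower_bounds)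
    fix m
    have ne': "underS r' (e t) \<noteq> {}" using A_under t by (auto simp: under')
    have "enat m \<le> liminf_below r' (\<lambda>s. val i (C' s)) (e t) \<longleftrightarrow>
       (\<exists>s\<in>A \<inter> underS r t. \<forall>u\<in>A \<inter> underS r t. (s, u) \<in> r \<longrightarrow> m \<le> val i (C u))"
      unfolding liminf_below_ge_iff[OF ne'] under'[OF t(1)] by (auto simp: r'_iff C'e)
    also have "\<dots> \<longleftrightarrow> (\<exists>s. low i m s t)"
    proof
      assume "\<exists>s\<in>A \<inter> underS r t. \<forall>u\<in>A \<inter> underS r t. (s, u) \<in> r \<longrightarrow> m \<le> val i (C u)"
      then obtain s where s: "s \<in> A" "s \<in> underS r t"
        "\<And>u. u \<in> A \<Longrightarrow> u \<in> underS r t \<Longrightarrow> (s, u) \<in> r \<Longrightarrow> m \<le> val i (C u)" by blast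
      have "low i m s t"
      proof (rule ccontr)
        assume "\<not> low i m s t"
        then obtain v where "high i m s v t"
          using s(2) by (auto simp: low_def high_def not_le)
        then obtain u where "u \<in> A" "high i m s u t" using A_high t(1) s(1) by blast
        with s(3)[of u] show False by (auto simp: high_def)
      qed
      then show "\<exists>s. low i m s t" ..
    next
      assume "\<exists>s. low i m s t"
      then obtain s where "s \<in> A" "low i m s t" using A_low t(1) by blast
      then show "\<exists>s\<in>A \<inter> underS r t. \<forall>u\<in>A \<inter> underS r t. (s, u) \<in> r \<longrightarrow> m \<le> val i (C u)"
        by (auto simp: low_def)
    qed
    also have "\<dots> \<longleftrightarrow> enat m \<le> liminf_below r (\<lambda>s. val i (C s)) t"
      unfolding liminf_below_ge_iff[OF t(2)] by (auto simp: low_def)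
    finally show "enat m \<le> liminf_below r' (\<lambda>s. val i (C' s)) (e t) \<longleftrightarrow>
      enat m \<le> liminf_below r (\<lambda>s. val i (C s)) t" .
  qed
  have limS: "limit_state r' C' (e t) = limit_state r C t" if "t \<in> A" "underS r t \<noteq> {}" for t
  proof -
    have "limit_value r' (\<lambda>s. val i (C' s)) (e t) = limit_value r (\<lambda>s. val i (C s)) t" for i
      by (simp add: limit_value_def lim[OF that])
    from this[of 0] this[of "Suc n" for n] show ?thesis
      by (simp add: limit_state_def val_def)
  qed
  have "computation P x r' C'"
    unfolding computation_def F'
  proof (intro conjI ballI wo'[unfolded F'])
    fix t' assume "t' \<in> e ` A"
    then obtain t where t: "t \<in> A" "t' = e t" by blast
    then have tF: "t \<in> Field r" using AF by blast
    have C: "underS r t = {} \<longrightarrow> C t = (0, \<lambda>_. 0)"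
      "\<And>s. immediate_pred r s t \<Longrightarrow> C t = step P x (C s)"
      "underS r t \<noteq> {} \<Longrightarrow> \<nexists>s. immediate_pred r s t \<Longrightarrow> C t = limit_state r C t"
      using comp tF unfolding computation_def by blast+
    show "underS r' t' = {} \<longrightarrow> C' t' = (0, \<lambda>_. 0)"
      using C(1) A_under[OF t(1)] t by (auto simp: C'e under')
    show "\<forall>s. immediate_pred r' s t' \<longrightarrow> C' t' = step P x (C' s)"
    proof (intro allI impI)
      fix s' assume s': "immediate_pred r' s' t'"
      then obtain s where s: "s \<in> A" "s' = e s"
        using t by (auto simp: immediate_pred_def under')
      with s' t pred' have "immediate_pred r s t" by blast
      with C(2) s t show "C' t' = step P x (C' s')" by (simp add: C'e)
    qed
    show "underS r' t' \<noteq> {} \<and> (\<nexists>s. immediate_pred r' s t') \<longrightarrow> C' t' = limit_state r' C' t'"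
    proof (intro impI)
      assume *: "underS r' t' \<noteq> {} \<and> (\<nexists>s. immediate_pred r' s t')"
      then have "underS r t \<noteq> {}" "\<nexists>s. immediate_pred r s t"
        using t pred'' by (auto simp: under')
      with C(3) limS t show "C' t' = limit_state r' C' t'" by (simp add: C'e)
    qed
  qed
  moreover have "e t0 \<in> Field r'" "C' (e t0) = C t0" using t0A by (auto simp: F' C'e)
  ultimately show ?thesis
    unfolding halts_with_def using t0(2) by metis
qed

section \<open>Decidability, meager sets and randomness\<close>

definition join :: "nat set \<Rightarrow> nat set \<Rightarrow> nat set" (infixl "\<oplus>" 65) where
  "a \<oplus> b = {2 * i | i. i \<in> a} \<union> {2 * j + 1 | j. j \<in> b}"

definition ITRM_decidable :: "nat set set \<Rightarrow> bool" where
  "ITRM_decidable X \<longleftrightarrow>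
     (\<exists>P. \<forall>x. (x \<in> X \<longrightarrow> halts_with P x 1) \<and> (x \<notin> X \<longrightarrow> halts_with P x 0))"

definition ITRM_decidable_in :: "nat set set \<Rightarrow> nat set \<Rightarrow> bool" where
  "ITRM_decidable_in X y \<longleftrightarrow>
     (\<exists>P. \<forall>x. (x \<in> X \<longrightarrow> halts_with P (x \<oplus> y) 1) \<and> (x \<notin> X \<longrightarrow> halts_with P (x \<oplus> y) 0))"

definition nowhere_dense :: "'a::topological_space set \<Rightarrow> bool" where
  "nowhere_dense S \<longleftrightarrow> interior (closure S) = {}"

definition meager :: "'a::topological_space set \<Rightarrow> bool" where
  "meager S \<longleftrightarrow> (\<exists>N :: nat \<Rightarrow> 'a set. (\<forall>n. nowhere_dense (N n)) \<and> S = (\<Union>n. N n))"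

text \<open>
  Sets of reals carry the topology of Cantor space: a real is identified with its
  characteristic function, and \<^typ>\<open>nat \<Rightarrow> bool\<close> has the product topology.
\<close>

definition meager_reals :: "nat set set \<Rightarrow> bool" where
  "meager_reals X \<longleftrightarrow> meager ((\<lambda>x n. n \<in> x) ` X)"

definition ITRM_random :: "nat set \<Rightarrow> bool" where
  "ITRM_random x \<longleftrightarrow> \<not> (\<exists>X. ITRM_decidable X \<and> meager_reals X \<and> x \<in> X)"

definition ITRM_random_rel :: "nat set \<Rightarrow> nat set \<Rightarrow> bool" where
  "ITRM_random_rel x y \<longleftrightarrow> \<not> (\<exists>X. ITRM_decidable_in X y \<and> meager_reals X \<and> x \<in> X)"

end

theory Submission
  imports Defs "HOL-Library.Nat_Bijection"
begin

text \<open>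
  Conditions are finite partial characteristic functions of reals.  For every program \<open>P\<close> there
  are a set \<open>U\<close> of conditions and dense sets \<open>D n\<close> of conditions, all computable by an ITRM
  without oracle, such that every real \<open>g\<close> meeting all \<open>D n\<close> satisfies: \<open>P\<close> halts with output \<open>1\<close>
  in the oracle \<open>g\<close> iff \<open>g\<close> satisfies a condition in \<open>U\<close>.  Failing to meet all \<open>D n\<close> is decidable
  and meager.  Hence a real meeting all \<open>D n\<close> lies in no meager set decided by \<open>P\<close>, a random real
  meets all \<open>D n\<close>, and if \<open>x\<close> is random, then \<open>x \<oplus> b\<close> meets all \<open>D n\<close> for all \<open>b\<close> outside a meager
  set.  All implications of the theorem follow from these three facts.

  For the existence of \<open>U\<close> and \<open>D\<close>, call a relation tame if it is described in this way on all
  reals meeting computable dense sets.  Tameness is preserved by quantifiers over numbers and by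
  the search for an infinite branch of a tree, since an ITRM decides the existence of such a
  branch: in a depth-first search, the register holding the current node overflows exactly along
  an infinite branch.  Halting is expressed by these operations as follows.  Let the machine run
  until the first limit at which a register overflows; that all other limits are passed is an
  inductive definition.  Regard these stretches as single moves of a new machine and iterate.
  A component that overflows at some limit of such moves is not among those that were reset to
  \<open>0\<close> cofinally often before, so each level adds a component that is \<open>0\<close> after every move, unless
  the run is caught in a loop.  After finitely many levels the outcome is therefore known.
\<close>

section \<open>Countable ordinals\<close>

text \<open>Since randomness is defined by meager sets, it is Cohen genericity for the decidable
  sets, and the theorem is the analogue of van Lambalgen's theorem. That almost all sections are
  generic is an effective Kuratowski-Ulam theorem; it needs dense sets computable without oracle,
  because randomness of \<open>x\<close> only speaks about decidable meager sets.

  The obstacle is halting. A run has transfinite length and depends on the oracle, whereas forcing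
  is set up for relations on numbers. Hence runs become inductive definitions, and these become
  well-foundedness of trees. Forcing well-foundedness is again an inductive definition; for a
  generic real to descend along it, the ranks must decrease, so ranks have to be compared
  computably.

  Limits without overflow fit a positive inductive definition. An overflow does not: that a
  component finally exceeds every bound is a statement about all later segments, in which
  reachability occurs negatively. Therefore an inductive definition can only run up to the first
  overflow, whose state is then defined from it by number quantifiers and becomes a move of the next
  level.\<close>

typedef om1 = "Field (cardSuc natLeq) :: nat set set"
proof -
  have "infinite (Field (cardSuc natLeq))"
    using cardSuc_finite[OF natLeq_Card_order] by (simp add: Field_natLeq)
  then show ?thesis by (metis finite.emptyI ex_in_conv)
qed

instantiation om1 :: ord
begin

definition less_eq_om1 :: "om1 \<Rightarrow> om1 \<Rightarrow> bool" where
  "a \<le> b \<longleftrightarrow> (Rep_om1 a, Rep_om1 b) \<in> cardSuc natLeq"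

definition less_om1 :: "om1 \<Rightarrow> om1 \<Rightarrow> bool" where
  "a < b \<longleftrightarrow> a \<le> b \<and> a \<noteq> (b :: om1)"

instance ..

end

instance om1 :: wellorder
proof
  have wo: "Well_order (cardSuc natLeq)"
    by (simp add: cardSuc_Well_order natLeq_Card_order)
  then have lin: "Linear_order (cardSuc natLeq)" by (simp add: well_order_on_def)
  then have refl: "Refl (cardSuc natLeq)" and tr: "trans (cardSuc natLeq)"
      and anti: "antisym (cardSuc natLeq)"
    by (auto simp: order_on_defs)
  show le_refl: "a \<le> a" for a :: om1
    using refl Rep_om1[of a] by (auto simp: less_eq_om1_def refl_on_def)
  show le_anti: "a \<le> b \<Longrightarrow> b \<le> a \<Longrightarrow> a = b" for a b :: om1
    using anti unfolding less_eq_om1_def by (simp add: antisym_def flip: Rep_om1_inject)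
  show "a < b \<longleftrightarrow> a \<le> b \<and> \<not> b \<le> a" for a b :: om1
    using le_refl le_anti by (auto simp: less_om1_def)
  show "a \<le> b \<Longrightarrow> b \<le> c \<Longrightarrow> a \<le> c" for a b c :: om1
    using tr by (auto simp: less_eq_om1_def trans_def)
  show "a \<le> b \<or> b \<le> a" for a b :: om1
    using lin Rep_om1[of a] Rep_om1[of b] le_refl
    by (cases "a = b") (auto simp: less_eq_om1_def order_on_defs total_on_def Rep_om1_inject)
  show "Q a" if step: "\<And>t. (\<And>s. s < t \<Longrightarrow> Q s) \<Longrightarrow> Q t" for Q and a :: om1
  proof -
    have "wf (inv_image (cardSuc natLeq - Id) Rep_om1)"
      using wo by (intro wf_inv_image) (simp add: well_order_on_def)
    moreover have "(s, t) \<in> inv_image (cardSuc natLeq - Id) Rep_om1 \<longleftrightarrow> s < t" for s t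
      by (auto simp: less_om1_def less_eq_om1_def Rep_om1_inject)
    ultimately show ?thesis using step by (induction a rule: wf_induct_rule) blast
  qed
qed

lemma countable_iff_le_natLeq: "countable A \<longleftrightarrow> (card_of A, natLeq) \<in> ordLeq"
proof -
  have "countable A \<longleftrightarrow> (card_of A, card_of (UNIV :: nat set)) \<in> ordLeq"
    by (simp add: countable_def flip: card_of_ordLeq)
  also have "\<dots> \<longleftrightarrow> (card_of A, natLeq) \<in> ordLeq"
    using card_of_nat ordLeq_ordIso_trans ordIso_symmetric by blast
  finally show ?thesis .
qed

lemma countable_atMost_om1: "countable {..a :: om1}"
proof -
  let ?r = "cardSuc natLeq"
  have co: "Card_order ?r" by (simp add: cardSuc_Card_order natLeq_Card_order)
  have "Rep_om1 a \<in> Field ?r" using Rep_om1 .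
  then have "(card_of (underS ?r (Rep_om1 a)), ?r) \<in> ordLess" by (rule card_of_underS[OF co])
  then have "(card_of (underS ?r (Rep_om1 a)), natLeq) \<in> ordLeq"
    using cardSuc_ordLeq_ordLess[OF natLeq_Card_order card_of_Card_order] by blast
  then have c: "countable (underS ?r (Rep_om1 a))"
    by (simp add: countable_iff_le_natLeq)
  have "{..a} \<subseteq> insert a (Abs_om1 ` underS ?r (Rep_om1 a))"
  proof
    fix b assume "b \<in> {..a}"
    then show "b \<in> insert a (Abs_om1 ` underS ?r (Rep_om1 a))"
      by (cases "b = a")
        (auto simp: underS_def less_eq_om1_def Rep_om1_inverse Rep_om1_inject
          intro!: image_eqI[of _ _ "Rep_om1 b"])
  qed
  with c show ?thesis by (meson countable_image countable_insert countable_subset)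
qed

text \<open>This property is why times and stages are taken from \<open>om1\<close>: countably many
  demands on a run can all be met at one later time, which forces a first overflow to come at a
  countable stage, and countably many premises of a rule have a common later stage.\<close>

lemma countable_bounded_om1:
  assumes "countable (S :: om1 set)"
  obtains b where "\<And>s. s \<in> S \<Longrightarrow> s < b"
proof -
  have "\<not> countable (UNIV :: om1 set)"
  proof
    assume "countable (UNIV :: om1 set)"
    then have "countable (Rep_om1 ` UNIV)" by blast
    then have "countable (Field (cardSuc natLeq))"
      by (metis type_definition.Rep_range type_definition_om1)
    then have "(card_of (Field (cardSuc natLeq)), natLeq) \<in> ordLeq" by (simp add: countable_iff_le_natLeq)
    moreover have "(card_of (Field (cardSuc natLeq)), cardSuc natLeq) \<in> ordIso"
      by (simp add: cardSuc_Card_order natLeq_Card_order card_of_Field_ordIso)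
    moreover have "(natLeq, cardSuc natLeq) \<in> ordLess" by (simp add: cardSuc_greater natLeq_Card_order)
    ultimately show False
      using not_ordLess_ordLeq ordIso_ordLeq_trans ordIso_symmetric by blast
  qed
  moreover have "countable (\<Union>s\<in>S. {..s})" using assms countable_atMost_om1 by blast
  ultimately have "(\<Union>s\<in>S. {..s}) \<noteq> UNIV" by auto
  then obtain b where "b \<notin> (\<Union>s\<in>S. {..s})" by blast
  then show ?thesis using that by (meson UN_iff atMost_iff not_le)
qed


definition om0 :: om1 where "om0 = (LEAST t. True)"
definition osuc :: "om1 \<Rightarrow> om1" where "osuc s = (LEAST t. s < t)"

lemma om0_le [simp]: "om0 \<le> t"
  by (simp add: om0_def Least_le)

lemma less_osuc [simp]: "s < osuc s"
proof -
  obtain b where "s < b" using countable_bounded_om1[of "{s}"] by auto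
  then show ?thesis unfolding osuc_def by (rule LeastI)
qed

lemma osuc_le_iff: "osuc s \<le> t \<longleftrightarrow> s < t"
  using less_osuc[of s] by (metis Least_le osuc_def order.strict_trans2)

lemma less_osuc_iff: "t < osuc s \<longleftrightarrow> t \<le> s"
  by (meson linorder_not_le osuc_le_iff)

lemma osuc_inject [simp]: "osuc s = osuc t \<longleftrightarrow> s = t"
  by (metis less_osuc_iff order.antisym order.refl)

lemma osuc_neq_om0 [simp]: "osuc s \<noteq> om0"
  by (metis less_osuc om0_le not_le)

lemma om1_cases:
  obtains "t = om0" | s where "t = osuc s" | "om0 < t" "\<And>s. s < t \<Longrightarrow> osuc s < t"
  by (metis osuc_le_iff om0_le order_le_less)

lemma om1_sequence_sup:
  fixes s :: "nat \<Rightarrow> om1"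
  obtains b where "\<And>i. s i \<le> b" "\<And>a. a < b \<Longrightarrow> \<exists>i. a < s i"
proof -
  obtain c where c: "\<And>i. s i < c" using countable_bounded_om1[of "range s"] by (metis countableI_type countable_image rangeI)
  define b where "b = (LEAST b. \<forall>i. s i \<le> b)"
  have "\<forall>i. s i \<le> b" unfolding b_def by (rule LeastI[of _ c]) (use c in \<open>auto intro: less_imp_le\<close>)
  moreover have "\<exists>i. a < s i" if "a < b" for a
    using that not_less_Least[of a "\<lambda>b. \<forall>i. s i \<le> b"] by (auto simp: b_def not_le)
  ultimately show ?thesis using that by blast
qed

section \<open>Runs and run segments of generalized machines\<close>

type_synonym vec = "nat \<Rightarrow> nat"

text \<open>\<open>S\<close> will be the set of eventual lower bounds of a component, an initial
  segment containing 0. Its maximum is the limit inferior, and an infinite \<open>S\<close> is the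
  overflow that resets to 0.\<close>

definition lv :: "nat set \<Rightarrow> nat" where
  "lv S = (if finite S then Max S else 0)"

lemma lv_atMost [simp]: "lv {M. M \<le> k} = k"
  by (auto simp: lv_def intro!: Max_eqI)

lemma lv_infinite: "infinite S \<Longrightarrow> lv S = 0"
  by (simp add: lv_def)

definition limvec :: "(nat \<Rightarrow> vec) \<Rightarrow> vec" where
  "limvec m = (\<lambda>j. lv {M. \<exists>i. \<forall>k\<ge>i. M \<le> m k j})"

definition ismin :: "('i \<Rightarrow> vec) \<Rightarrow> 'i set \<Rightarrow> vec \<Rightarrow> bool" where
  "ismin f A m \<longleftrightarrow> (\<forall>j. (\<forall>a\<in>A. m j \<le> f a j) \<and> (\<exists>a\<in>A. m j = f a j))"

lemma ismin_ex: "A \<noteq> {} \<Longrightarrow> \<exists>m. ismin f A m"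
proof -
  assume "A \<noteq> {}"
  then have "\<exists>k. (\<forall>a\<in>A. k \<le> f a j) \<and> (\<exists>a\<in>A. k = f a j)" for j
    by (intro exI[of _ "LEAST k. k \<in> (\<lambda>a. f a j) ` A"])
      (use LeastI_ex[of "\<lambda>k. k \<in> (\<lambda>a. f a j) ` A"] in \<open>auto intro: Least_le\<close>)
  then show ?thesis unfolding ismin_def by metis
qed

lemma ismin_unique: "ismin f A m \<Longrightarrow> ismin f A m' \<Longrightarrow> m = m'"
  unfolding ismin_def by (metis ext le_antisym)

lemma ismin_singleton [simp]: "ismin f {a} m \<longleftrightarrow> m = f a"
  by (auto simp: ismin_def)

lemma ismin_Un: "ismin f A m \<Longrightarrow> ismin f B m' \<Longrightarrow> ismin f (A \<union> B) (\<lambda>j. min (m j) (m' j))"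
  unfolding ismin_def by (simp add: ball_Un bex_Un min_def) (meson order_trans nat_le_linear)

lemma ismin_UN:
  "(\<And>i. i \<in> I \<Longrightarrow> ismin f (A i) (m i)) \<Longrightarrow> ismin m I m' \<Longrightarrow> ismin f (\<Union>i\<in>I. A i) m'"
  unfolding ismin_def by (metis UN_E UN_I le_trans)

text \<open>
  A generalized machine moves from \<open>v\<close> to \<open>bs v\<close> while the componentwise minima on the way
  are \<open>bm v\<close>; a segment records the minima of a whole stretch of the run.
\<close>

inductive gseg :: "(vec \<Rightarrow> vec) \<Rightarrow> (vec \<Rightarrow> vec) \<Rightarrow> vec \<Rightarrow> vec \<Rightarrow> vec \<Rightarrow> bool" for bm bs where
  step: "gseg bm bs v (bm v) (bs v)"
| trans: "gseg bm bs v m w \<Longrightarrow> gseg bm bs w m' u \<Longrightarrow> gseg bm bs v (\<lambda>j. min (m j) (m' j)) u"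
| lim: "(\<And>i. gseg bm bs (s i) (m i) (s (Suc i))) \<Longrightarrow> ismin m UNIV m' \<Longrightarrow>
    gseg bm bs (s 0) m' (limvec m)"

section \<open>Runs along the countable ordinals\<close>

definition run :: "(vec \<Rightarrow> vec) \<Rightarrow> (vec \<Rightarrow> vec) \<Rightarrow> vec \<Rightarrow> om1 \<Rightarrow> vec" where
  "run bm bs v = wfrec {(s, t). s < t} (\<lambda>f t.
     if t = om0 then v
     else if \<exists>s. t = osuc s then bs (f (SOME s. t = osuc s))
     else (\<lambda>j. lv {M. \<exists>s<t. \<forall>u. s \<le> u \<and> u < t \<longrightarrow> M \<le> bm (f u) j}))"

lemma run_unfold:
  "run bm bs v t =
     (if t = om0 then v
      else if \<exists>s. t = osuc s then bs (run bm bs v (SOME s. t = osuc s))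
      else (\<lambda>j. lv {M. \<exists>s<t. \<forall>u. s \<le> u \<and> u < t \<longrightarrow> M \<le> bm (run bm bs v u) j}))"
proof -
  have "(SOME s. t = osuc s) < t" if "\<exists>s. t = osuc s"
    using someI_ex[OF that] by (metis less_osuc)
  then show ?thesis
    unfolding run_def by (subst wfrec[OF wf]) (auto simp: cut_def intro!: ext arg_cong[of _ _ lv])
qed

lemma run_om0 [simp]: "run bm bs v om0 = v"
  by (subst run_unfold) simp

lemma run_osuc [simp]: "run bm bs v (osuc s) = bs (run bm bs v s)"
  by (subst run_unfold) simp

lemma run_limit:
  assumes "om0 < t" "\<And>s. s < t \<Longrightarrow> osuc s < t"
  shows "run bm bs v t = (\<lambda>j. lv {M. \<exists>s<t. \<forall>u. s \<le> u \<and> u < t \<longrightarrow> M \<le> bm (run bm bs v u) j})"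
  using assms by (subst run_unfold) (metis less_osuc order_less_irrefl)

lemma strict_chain_Union:
  fixes t :: "nat \<Rightarrow> om1"
  assumes inc: "\<And>i. t i < t (Suc i)" and sup: "\<And>i. t i \<le> b" "\<And>a. a < b \<Longrightarrow> \<exists>i. a < t i"
  shows "{t 0..<b} = (\<Union>i. {t i..<t (Suc i)})"
proof -
  have mono: "t i \<le> t j" if "i \<le> j" for i j
    using that inc by (simp add: lift_Suc_mono_le less_imp_le)
  show ?thesis
  proof (intro subset_antisym subsetI)
    fix a assume a: "a \<in> {t 0..<b}"
    define n where "n = (LEAST i. a < t i)"
    have n: "a < t n" unfolding n_def using sup(2) a by (metis LeastI_ex atLeastLessThan_iff)
    have "n \<noteq> 0" using n a by (metis atLeastLessThan_iff leD)
    then obtain i where i: "n = Suc i" by (cases n) auto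
    then have "\<not> a < t i" using not_less_Least[of i "\<lambda>i. a < t i"] by (simp add: n_def)
    then show "a \<in> (\<Union>i. {t i..<t (Suc i)})" using n i by (auto simp: not_less)
  next
    fix a assume "a \<in> (\<Union>i. {t i..<t (Suc i)})"
    then obtain i where "t i \<le> a" "a < t (Suc i)" by auto
    then show "a \<in> {t 0..<b}"
      using mono[of 0 i] sup(1)[of "Suc i"] by auto
  qed
qed

text \<open>A limit inferior along a run equals that of the minima over consecutive blocks, since a
  lower bound for all late blocks is one for all late times. So limit states can be computed from
  the minima that segments record.\<close>

lemma run_at_sup:
  fixes t :: "nat \<Rightarrow> om1"
  assumes inc: "\<And>i. t i < t (Suc i)" and sup: "\<And>i. t i \<le> b" "\<And>a. a < b \<Longrightarrow> \<exists>i. a < t i"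
    and m: "\<And>i. ismin (\<lambda>u. bm (run bm bs v u)) {t i..<t (Suc i)} (m i)"
  shows "run bm bs v b = limvec m"
proof -
  have mono: "t i \<le> t j" if "i \<le> j" for i j
    using that inc by (simp add: lift_Suc_mono_le less_imp_le)
  have lt: "t i < b" for i using inc[of i] sup(1)[of "Suc i"] by order
  have "osuc a < b" if "a < b" for a
    using sup(2)[OF that] lt by (metis osuc_le_iff order.strict_trans1)
  moreover have "om0 < b" using lt[of 0] by (metis om0_le order.strict_trans1)
  ultimately have run: "run bm bs v b =
      (\<lambda>j. lv {M. \<exists>s<b. \<forall>u. s \<le> u \<and> u < b \<longrightarrow> M \<le> bm (run bm bs v u) j})"
    by (simp add: run_limit)
  have "(\<exists>s<b. \<forall>u. s \<le> u \<and> u < b \<longrightarrow> M \<le> bm (run bm bs v u) j) \<longleftrightarrow>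
      (\<exists>i. \<forall>k\<ge>i. M \<le> m k j)" (is "?L \<longleftrightarrow> ?R") for M j
  proof
    assume ?L
    then obtain s where s: "s < b" "\<And>u. s \<le> u \<Longrightarrow> u < b \<Longrightarrow> M \<le> bm (run bm bs v u) j" by blast
    obtain i where i: "s < t i" using sup(2) s(1) by blast
    have "M \<le> m k j" if "k \<ge> i" for k
    proof -
      obtain u where "u \<in> {t k..<t (Suc k)}" "m k j = bm (run bm bs v u) j"
        using m[of k] unfolding ismin_def by blast
      moreover have "s \<le> t k" using i mono[OF that] by order
      ultimately show ?thesis using s(2)[of u] lt[of "Suc k"] by auto
    qed
    then show ?R by blast
  next
    assume ?R
    then obtain i where i: "\<And>k. k \<ge> i \<Longrightarrow> M \<le> m k j" by blast
    have "M \<le> bm (run bm bs v u) j" if u: "t i \<le> u" "u < b" for u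
    proof -
      have "{t i..<b} = (\<Union>k. {t (i + k)..<t (i + Suc k)})"
        using strict_chain_Union[of "\<lambda>k. t (i + k)" b] inc sup mono
        by simp (metis le_add2 order.strict_trans2)
      then obtain k where "u \<in> {t (i + k)..<t (Suc (i + k))}"
        using u by (auto dest!: equalityD1 dest: subsetD[of _ _ u])
      then have "m (i + k) j \<le> bm (run bm bs v u) j" using m[of "i + k"] by (auto simp: ismin_def)
      then show ?thesis using i[of "i + k"] by simp
    qed
    then show ?L using lt[of i] by blast
  qed
  then show ?thesis by (simp add: run limvec_def)
qed

lemma gseg_sound:
  assumes "gseg bm bs v m w" "run bm bs u a = v"
  shows "\<exists>b>a. run bm bs u b = w \<and> ismin (\<lambda>c. bm (run bm bs u c)) {a..<b} m"
  using assms
proof (induction arbitrary: a rule: gseg.induct)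
  case (step v)
  have "{a..<osuc a} = {a}" by (auto simp: less_osuc_iff)
  with step show ?case by (intro exI[of _ "osuc a"]) simp
next
  case (trans v m w m' z)
  from trans.IH(1)[OF trans.prems] obtain b where
    b: "a < b" "run bm bs u b = w" "ismin (\<lambda>c. bm (run bm bs u c)) {a..<b} m" by blast
  from trans.IH(2)[OF b(2)] obtain d where
    d: "b < d" "run bm bs u d = z" "ismin (\<lambda>c. bm (run bm bs u c)) {b..<d} m'" by blast
  have "{a..<d} = {a..<b} \<union> {b..<d}" using b(1) d(1) by auto
  then show ?case using ismin_Un[OF b(3) d(3)] b d by (metis order.strict_trans)
next
  case (lim s m m')
  obtain t where t: "t 0 = a" "\<And>i. run bm bs u (t i) = s i"
      "\<And>i. t i < t (Suc i) \<and> ismin (\<lambda>c. bm (run bm bs u c)) {t i..<t (Suc i)} (m i)"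
  proof -
    have "\<exists>t. (\<forall>i. run bm bs u (t i) = s i \<and> (i = 0 \<longrightarrow> t i = a)) \<and>
        (\<forall>i. t i < t (Suc i) \<and> ismin (\<lambda>c. bm (run bm bs u c)) {t i..<t (Suc i)} (m i))"
      using dependent_nat_choice[of "\<lambda>i z. run bm bs u z = s i \<and> (i = 0 \<longrightarrow> z = a)"
          "\<lambda>i z z'. z < z' \<and> ismin (\<lambda>c. bm (run bm bs u c)) {z..<z'} (m i)"] lim
      by blast
    then show ?thesis using that by blast
  qed
  obtain b where b: "\<And>i. t i \<le> b" "\<And>c. c < b \<Longrightarrow> \<exists>i. c < t i"
    using om1_sequence_sup by blast
  have "run bm bs u b = limvec m" using run_at_sup[of t b bm bs u m] t(3) b by blast
  moreover have "ismin (\<lambda>c. bm (run bm bs u c)) {a..<b} m'"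
    using strict_chain_Union[of t b] t b ismin_UN[of UNIV "\<lambda>c. bm (run bm bs u c)" "\<lambda>i. {t i..<t (Suc i)}" m m'] lim.hyps(2)
    by simp
  moreover have "a < b" using t(1,3) b(1) by (metis order.strict_trans2)
  ultimately show ?case by blast
qed


text \<open>Stated for any well-order with countable initial segments, because it is applied both to
  computations along well-orders of numbers and to \<open>run\<close> along \<open>om1\<close>. The
  induction is on the end \<open>t\<close>: at a limit, countability gives a cofinal sequence of
  type omega, and the limit rule joins the segments between its members.\<close>

lemma gseg_complete:
  assumes wo: "Well_order r" and cnt: "\<And>t. t \<in> Field r \<Longrightarrow> countable (underS r t)"
    and suc: "\<And>s t. t \<in> Field r \<Longrightarrow> immediate_pred r s t \<Longrightarrow> C t = bs (C s)"
    and lim: "\<And>t. t \<in> Field r \<Longrightarrow> underS r t \<noteq> {} \<Longrightarrow> \<nexists>s. immediate_pred r s t \<Longrightarrow>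
       C t = (\<lambda>j. lv {M. \<exists>s\<in>underS r t. \<forall>u\<in>underS r t. (s, u) \<in> r \<longrightarrow> M \<le> bm (C u) j})"
    and t: "s \<in> underS r t"
  shows "\<exists>m. gseg bm bs (C s) m (C t) \<and> ismin (\<lambda>c. bm (C c)) {u \<in> underS r t. (s, u) \<in> r} m"
proof -
  have wr: "wo_rel r" using wo by (simp add: wo_rel_def)
  have F: "a \<in> Field r" "b \<in> Field r" if "(a, b) \<in> r" for a b using that by (auto simp: Field_def)
  have tr: "(a, b) \<in> r \<Longrightarrow> (b, c) \<in> r \<Longrightarrow> (a, c) \<in> r" for a b c using wo_rel.TRANS[OF wr] by (meson transD)
  have an: "(a, b) \<in> r \<Longrightarrow> (b, a) \<in> r \<Longrightarrow> a = b" for a b using wo_rel.ANTISYM[OF wr] by (meson antisymD)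
  have re: "a \<in> Field r \<Longrightarrow> (a, a) \<in> r" for a using wo_rel.REFL[OF wr] by (meson refl_onD)
  have tot: "(a, b) \<in> r \<or> (b, a) \<in> r" if "a \<in> Field r" "b \<in> Field r" for a b
    using that wo_rel.TOTALS[OF wr] by blast
  have "\<forall>s\<in>underS r t. \<exists>m. gseg bm bs (C s) m (C t) \<and>
      ismin (\<lambda>c. bm (C c)) {u \<in> underS r t. (s, u) \<in> r} m" for t
  proof (induction t rule: wo_rel.well_order_induct[OF wr])
    case (1 t)
    show ?case
    proof
      fix s assume s: "s \<in> underS r t"
      then have tF: "t \<in> Field r" by (auto simp: underS_def Field_def)
      show "\<exists>m. gseg bm bs (C s) m (C t) \<and> ismin (\<lambda>c. bm (C c)) {u \<in> underS r t. (s, u) \<in> r} m"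
      proof (cases "\<exists>p. immediate_pred r p t")
        case True
        then obtain p where p: "p \<in> underS r t" "\<And>u. u \<in> underS r t \<Longrightarrow> (u, p) \<in> r"
          and pr: "immediate_pred r p t" by (auto simp: immediate_pred_def)
        have Ct: "C t = bs (C p)" using suc tF pr by blast
        show ?thesis
        proof (cases "s = p")
          case True
          have "{u \<in> underS r t. (s, u) \<in> r} = {p}"
            using p True an re F by (auto simp: underS_def)
          then show ?thesis using gseg.step[of bm bs "C p"] Ct True by auto
        next
          case False
          then have sp: "s \<in> underS r p" using p(2)[OF s] by (simp add: underS_def)
          then obtain m where m: "gseg bm bs (C s) m (C p)"
             "ismin (\<lambda>c. bm (C c)) {u \<in> underS r p. (s, u) \<in> r} m"
            using 1 p(1) by (auto simp: underS_def)
          have "{u \<in> underS r t. (s, u) \<in> r} = {u \<in> underS r p. (s, u) \<in> r} \<union> {p}"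
            using p sp by (auto simp: underS_def intro: tr an)
          then show ?thesis
            using gseg.trans[OF m(1) gseg.step] ismin_Un[OF m(2), of "{p}" "bm (C p)"] Ct by auto
        qed
      next
        case False
        let ?A = "underS r t"
        have lim_t: "\<exists>w\<in>?A. (u, w) \<in> r \<and> u \<noteq> w \<and> (v, w) \<in> r" if uv: "u \<in> ?A" "v \<in> ?A" for u v
        proof -
          obtain w where w: "w \<in> ?A" "(w, u) \<notin> r" using False uv by (auto simp: immediate_pred_def)
          have Fs: "u \<in> Field r" "v \<in> Field r" "w \<in> Field r" using that w by (auto simp: underS_def Field_def)
          show ?thesis
          proof (cases "(v, w) \<in> r")
            case True
            then show ?thesis using w Fs tot re by (metis)
          next
            case False
            then have "(w, v) \<in> r" using tot Fs by blast
            moreover have "(u, w) \<in> r" using w tot Fs by blast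
            ultimately have "(u, v) \<in> r" "u \<noteq> v" using tr w by blast+
            then show ?thesis using that Fs re by blast
          qed
        qed
        define e where "e = from_nat_into ?A"
        have e: "range e = ?A" using cnt[OF tF] s by (auto simp: e_def intro!: range_from_nat_into)
        define good where "good i u w \<longleftrightarrow> (u, w) \<in> r \<and> u \<noteq> w \<and> (e i, w) \<in> r" for i u w
        \<comment> \<open>\<open>q\<close> increases strictly, and \<open>q (Suc i)\<close> lies at
          or above the \<open>i\<close>-th element of the enumeration \<open>e\<close>; this makes
          \<open>q\<close> cofinal below \<open>t\<close>.\<close>
        obtain q where q: "q 0 = s" "\<And>i. q i \<in> ?A" "\<And>i. good i (q i) (q (Suc i))"
        proof -
          have "\<exists>q. \<forall>i. (q i \<in> ?A \<and> (i = 0 \<longrightarrow> q i = s)) \<and> good i (q i) (q (Suc i))"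
          proof (rule dependent_nat_choice[of "\<lambda>i z. z \<in> ?A \<and> (i = 0 \<longrightarrow> z = s)" good])
            show "\<exists>x. x \<in> ?A \<and> ((0::nat) = 0 \<longrightarrow> x = s)" using s by blast
          next
            fix x and n :: nat
            assume "x \<in> ?A \<and> (n = 0 \<longrightarrow> x = s)"
            then show "\<exists>y. (y \<in> ?A \<and> (Suc n = 0 \<longrightarrow> y = s)) \<and> good n x y"
              using lim_t[of x "e n"] e by (auto simp: good_def)
          qed
          then show ?thesis using that by blast
        qed
        have step: "(q i, q (Suc i)) \<in> r" "q i \<noteq> q (Suc i)" "(e i, q (Suc i)) \<in> r" for i
          using q(3)[of i] by (auto simp: good_def)
        have mono: "(q i, q j) \<in> r" if "i \<le> j" for i j
          using that
        proof (induction j)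
          case 0
          then show ?case using re q(2)[of 0] by (auto simp: underS_def Field_def)
        next
          case (Suc j)
          then show ?case using step(1) tr re F by (metis le_Suc_eq)
        qed
        have "\<forall>i. \<exists>m. gseg bm bs (C (q i)) m (C (q (Suc i))) \<and>
            ismin (\<lambda>c. bm (C c)) {u \<in> underS r (q (Suc i)). (q i, u) \<in> r} m"
        proof
          fix i
          have "q i \<in> underS r (q (Suc i))" using step[of i] by (simp add: underS_def)
          moreover have "q (Suc i) \<noteq> t" "(q (Suc i), t) \<in> r" using q(2)[of "Suc i"] by (auto simp: underS_def)
          ultimately show "\<exists>m. gseg bm bs (C (q i)) m (C (q (Suc i))) \<and>
              ismin (\<lambda>c. bm (C c)) {u \<in> underS r (q (Suc i)). (q i, u) \<in> r} m"
            using 1 by blast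
        qed
        then obtain m where m: "\<And>i. gseg bm bs (C (q i)) (m i) (C (q (Suc i)))"
            "\<And>i. ismin (\<lambda>c. bm (C c)) {u \<in> underS r (q (Suc i)). (q i, u) \<in> r} (m i)" by metis
        obtain m' where m': "ismin m UNIV m'" using ismin_ex by blast
        have block: "\<exists>i\<ge>k. u \<in> underS r (q (Suc i)) \<and> (q i, u) \<in> r"
          if u: "u \<in> ?A" "(q k, u) \<in> r" for k u
        proof -
          have uF: "u \<in> Field r" using u F by blast
          have "\<exists>i. (u, q i) \<in> r \<and> u \<noteq> q i"
          proof -
            obtain i where "u = e i" using e u by blast
            then have "(u, q (Suc i)) \<in> r" using step(3) by blast
            then show ?thesis using step(1,2)[of "Suc i"] tr an by metis
          qed
          then obtain n where n: "(u, q n) \<in> r" "u \<noteq> q n" "\<forall>i<n. \<not> ((u, q i) \<in> r \<and> u \<noteq> q i)"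
            using exists_least_iff[of "\<lambda>i. (u, q i) \<in> r \<and> u \<noteq> q i"] by blast
          have "n > k" using n u mono an by (metis not_le_imp_less tr)
          then obtain i where i: "n = Suc i" "i \<ge> k" by (cases n) auto
          then have "(q i, u) \<in> r" using n(3) tot[OF uF, of "q i"] F[OF mono[of i i]] re uF by blast
          then show ?thesis using i n by (auto simp: underS_def)
        qed
        have sub: "u \<in> ?A \<and> (q i, u) \<in> r" if "u \<in> underS r (q (Suc i))" "(q i, u) \<in> r" for u i
          using that q(2)[of "Suc i"] tr an by (auto simp: underS_def)
        have "{u \<in> ?A. (s, u) \<in> r} = (\<Union>i. {u \<in> underS r (q (Suc i)). (q i, u) \<in> r})"
          using block[of _ 0] q(1) sub mono[of 0] tr by (auto, blast+)
        then have "ismin (\<lambda>c. bm (C c)) {u \<in> ?A. (s, u) \<in> r} m'"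
          using ismin_UN[of UNIV "\<lambda>c. bm (C c)", OF m(2) m'] by simp
        moreover have "C t = limvec m"
        proof -
          have "(\<exists>s\<in>?A. \<forall>u\<in>?A. (s, u) \<in> r \<longrightarrow> M \<le> bm (C u) j) \<longleftrightarrow> (\<exists>i. \<forall>k\<ge>i. M \<le> m k j)"
            (is "?L \<longleftrightarrow> ?R") for M j
          proof
            assume ?L
            then obtain w where w: "w \<in> ?A" "\<And>u. u \<in> ?A \<Longrightarrow> (w, u) \<in> r \<Longrightarrow> M \<le> bm (C u) j" by blast
            obtain i where i: "w = e i" using e w by blast
            have "M \<le> m k j" if "k \<ge> Suc i" for k
            proof -
              obtain u where u: "u \<in> underS r (q (Suc k))" "(q k, u) \<in> r" "m k j = bm (C u) j"
                using m(2)[of k] unfolding ismin_def by blast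
              have "(w, u) \<in> r" using i step(3)[of i] mono[OF that] u(2) tr by blast
              then show ?thesis using w(2) sub[OF u(1,2)] u(3) by simp
            qed
            then show ?R by blast
          next
            assume ?R
            then obtain i where i: "\<And>k. k \<ge> i \<Longrightarrow> M \<le> m k j" by blast
            have "M \<le> bm (C u) j" if u: "u \<in> ?A" "(q i, u) \<in> r" for u
            proof -
              obtain k where k: "k \<ge> i" "u \<in> underS r (q (Suc k))" "(q k, u) \<in> r"
                using block[OF u] by blast
              then have "m k j \<le> bm (C u) j" using m(2)[of k] unfolding ismin_def by blast
              then show ?thesis using i[OF k(1)] by simp
            qed
            then show ?L using q(2)[of i] by blast
          qed
          then show ?thesis using lim[OF tF _ False] s by (auto simp: limvec_def)
        qed
        ultimately show ?thesis using gseg.lim[OF m(1) m'] q(1) by auto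
      qed
    qed
  qed
  then show ?thesis using t by blast
qed

abbreviation le_om1 :: "om1 rel" where "le_om1 \<equiv> {(a, b). a \<le> b}"

lemma Well_order_le_om1: "Well_order le_om1"
proof -
  have "le_om1 - Id = {(a, b). a < b}" by auto
  moreover have "Field le_om1 = UNIV" by (auto simp: Field_def)
  ultimately show ?thesis
    unfolding order_on_defs using wf
    by (auto simp: refl_on_def trans_def antisym_def total_on_def)
qed

lemma underS_le_om1: "underS le_om1 t = {..<t}"
  by (auto simp: underS_def)

lemma immediate_pred_le_om1: "immediate_pred le_om1 s t \<longleftrightarrow> t = osuc s"
proof
  assume "immediate_pred le_om1 s t"
  then have s: "s < t" "\<And>u. u < t \<Longrightarrow> u \<le> s"
    by (auto simp: immediate_pred_def underS_le_om1)
  have "\<not> osuc s < t" using s(2)[of "osuc s"] less_osuc[of s] by (meson leD)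
  then show "t = osuc s" using s(1) by (simp add: order.antisym osuc_le_iff)
qed (auto simp: immediate_pred_def underS_le_om1 less_osuc_iff)

lemma limit_le_om1:
  assumes "underS le_om1 t \<noteq> {}" "\<nexists>s. immediate_pred le_om1 s t"
  shows "om0 < t" "\<And>s. s < t \<Longrightarrow> osuc s < t"
proof -
  obtain s where "s < t" using assms(1) by (auto simp: underS_le_om1)
  then show "om0 < t" by (metis om0_le order.strict_trans1)
  show "osuc s < t" if "s < t" for s
    using that assms(2) by (metis immediate_pred_le_om1 order_le_less osuc_le_iff)
qed

lemma gseg_run:
  assumes "a < b"
  shows "\<exists>m. gseg bm bs (run bm bs v a) m (run bm bs v b) \<and>
    ismin (\<lambda>c. bm (run bm bs v c)) {a..<b} m"
proof -
  have cnt: "countable {..<t :: om1}" for t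
    by (rule countable_subset[OF _ countable_atMost_om1[of t]]) auto
  have "\<exists>m. gseg bm bs (run bm bs v a) m (run bm bs v b) \<and>
      ismin (\<lambda>c. bm (run bm bs v c)) {u \<in> underS le_om1 b. (a, u) \<in> le_om1} m"
  proof (rule gseg_complete[OF Well_order_le_om1])
    fix t assume "underS le_om1 t \<noteq> {}" "\<nexists>s. immediate_pred le_om1 s t"
    note lim = limit_le_om1[OF this]
    show "run bm bs v t = (\<lambda>j. lv {M. \<exists>s\<in>underS le_om1 t. \<forall>u\<in>underS le_om1 t.
        (s, u) \<in> le_om1 \<longrightarrow> M \<le> bm (run bm bs v u) j})"
      by (auto simp: run_limit[OF lim] underS_le_om1 Bex_def intro!: ext arg_cong[of _ _ lv])
  qed (use assms cnt in \<open>auto simp: underS_le_om1 immediate_pred_le_om1\<close>)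
  moreover have "{u \<in> underS le_om1 b. (a, u) \<in> le_om1} = {a..<b}" by (auto simp: underS_le_om1)
  ultimately show ?thesis by simp
qed

section \<open>Program runs as run segments\<close>

text \<open>With line and registers in one vector, a single limit rule covers both. The output
  register 0 becomes component 1.\<close>

definition vec_of :: "state \<Rightarrow> vec" where
  "vec_of c = case_nat (fst c) (snd c)"

definition stp :: "program \<Rightarrow> nat set \<Rightarrow> vec \<Rightarrow> vec" where
  "stp P x v = vec_of (step P x (v 0, \<lambda>n. v (Suc n)))"

abbreviation pseg :: "program \<Rightarrow> nat set \<Rightarrow> vec \<Rightarrow> vec \<Rightarrow> vec \<Rightarrow> bool" where
  "pseg P x \<equiv> gseg (\<lambda>v. v) (stp P x)"


lemma vec_of_simps [simp]: "vec_of (l, R) = case_nat l R" "vec_of c 0 = fst c"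
  "vec_of c (Suc n) = snd c n"
  by (simp_all add: vec_of_def)

lemma case_nat_eta [simp]: "case_nat (v 0) (\<lambda>n. v (Suc n)) = v"
  by (auto split: nat.split)

lemma stp_vec_of: "stp P x (vec_of c) = vec_of (step P x c)"
  by (simp add: stp_def)

lemma limit_value_eq_lv:
  assumes "underS r t \<noteq> {}"
  shows "limit_value r f t =
    lv {M. \<exists>s\<in>underS r t. \<forall>u\<in>underS r t. (s, u) \<in> r \<longrightarrow> M \<le> f u}"
proof -
  have "{M. \<exists>s\<in>underS r t. \<forall>u\<in>underS r t. (s, u) \<in> r \<longrightarrow> M \<le> f u} =
      {M. enat M \<le> liminf_below r f t}"
    using liminf_below_ge_iff[OF assms] by auto
  moreover have "limit_value r f t = lv {M. enat M \<le> liminf_below r f t}"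
    by (cases "liminf_below r f t") (auto simp: limit_value_def lv_infinite)
  ultimately show ?thesis by simp
qed

lemma vec_of_limit_state:
  assumes "underS r t \<noteq> {}"
  shows "vec_of (limit_state r C t) = (\<lambda>j. lv {M. \<exists>s\<in>underS r t. \<forall>u\<in>underS r t.
    (s, u) \<in> r \<longrightarrow> M \<le> vec_of (C u) j})"
  by (rule ext) (simp add: vec_of_def limit_state_def limit_value_eq_lv[OF assms] split: nat.split)

theorem halts_with_iff_pseg:
  "halts_with P x k \<longleftrightarrow> (\<exists>m w. pseg P x (\<lambda>_. 0) m w \<and> length P \<le> w 0 \<and> w 1 = k)"
proof
  assume "halts_with P x k"
  then obtain r :: "nat rel" and C t where comp: "computation P x r C" and t: "t \<in> Field r"
    and h: "halted P (C t)" "snd (C t) 0 = k"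
    unfolding halts_with_def by blast
  have wo: "Well_order r" using comp by (simp add: computation_def)
  have wr: "wo_rel r" using wo by (simp add: wo_rel_def)
  obtain z where z: "z \<in> Field r" "underS r z = {}" "z = t \<or> z \<in> underS r t"
  proof -
    define z where "z = wo_rel.minim r (Field r)"
    have z: "z \<in> Field r" "\<And>b. b \<in> Field r \<Longrightarrow> (z, b) \<in> r"
      using wo_rel.minim_in[OF wr, of "Field r"] wo_rel.minim_least[OF wr, of "Field r"] t by (auto simp: z_def)
    have "underS r z = {}"
      using z wo_rel.ANTISYM[OF wr] by (auto simp: underS_def Field_def antisym_def)
    then show ?thesis using that z t by (auto simp: underS_def)
  qed
  have Cz: "vec_of (C z) = (\<lambda>_. 0)"
    using comp z by (auto simp: computation_def vec_of_def split: nat.split)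
  have "\<exists>m. pseg P x (vec_of (C z)) m (vec_of (C t))"
  proof (cases "z = t")
    case True
    \<comment> \<open>A segment contains at least one move; if the computation is halted at its
      first time, the halted state moves to itself.\<close>
    then have "stp P x (vec_of (C z)) = vec_of (C t)"
      using h by (simp add: stp_vec_of step_def)
    then show ?thesis by (metis gseg.step)
  next
    case False
    then have "z \<in> underS r t" using z by blast
    then show ?thesis
      using gseg_complete[OF wo, of "\<lambda>c. vec_of (C c)" "stp P x" "\<lambda>v. v" z t] comp
      by (auto simp: computation_def stp_vec_of vec_of_limit_state)
  qed
  then show "\<exists>m w. pseg P x (\<lambda>_. 0) m w \<and> length P \<le> w 0 \<and> w 1 = k"
    using h unfolding Cz halted_def by (metis One_nat_def vec_of_simps(2,3))
next
  assume "\<exists>m w. pseg P x (\<lambda>_. 0) m w \<and> length P \<le> w 0 \<and> w 1 = k"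
  then obtain m w where w: "pseg P x (\<lambda>_. 0) m w" "length P \<le> w 0" "w 1 = k" by blast
  define R where "R = run (\<lambda>v. v) (stp P x) (\<lambda>_. 0)"
  define C where "C t = (R t 0, \<lambda>n. R t (Suc n))" for t
  have CR: "vec_of (C t) = R t" for t by (simp add: C_def)
  have inj: "c = c'" if "vec_of c = vec_of c'" for c c'
    using that by (metis ext prod.expand vec_of_simps(2) vec_of_simps(3))
  obtain b where b: "R b = w" using gseg_sound[OF w(1) run_om0] by (auto simp: R_def)
  have "computation P x le_om1 C"
    unfolding computation_def
  proof (intro conjI ballI allI impI Well_order_le_om1)
    fix t assume "underS le_om1 t = {}"
    then have "t = om0" by (metis empty_iff lessThan_iff om0_le order_le_less underS_le_om1)
    then show "C t = (0, \<lambda>_. 0)" by (simp add: C_def R_def)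
  next
    fix t s assume "immediate_pred le_om1 s t"
    then show "C t = step P x (C s)"
      by (intro inj) (simp add: CR R_def immediate_pred_le_om1 flip: stp_vec_of)
  next
    fix t assume t: "underS le_om1 t \<noteq> {} \<and> (\<nexists>s. immediate_pred le_om1 s t)"
    then have "vec_of (C t) = vec_of (limit_state le_om1 C t)"
      unfolding CR vec_of_limit_state[OF conjunct1[OF t]] unfolding R_def
      by (subst run_limit[OF limit_le_om1])
        (use t in \<open>auto simp: underS_le_om1 Bex_def intro!: ext arg_cong[of _ _ lv]\<close>)
    then show "C t = limit_state le_om1 C t" by (rule inj)
  qed
  moreover have "b \<in> Field le_om1" by (auto simp: Field_def)
  moreover have "halted P (C b)" "snd (C b) 0 = k"
    using w b by (auto simp: halted_def C_def)
  ultimately show "halts_with P x k"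
    using computation_halts_with[of P x le_om1 C b] by simp
qed

section \<open>Code fragments\<close>

text \<open>Jump targets in a fragment are relative to its first line.\<close>

fun shift :: "nat \<Rightarrow> instr \<Rightarrow> instr" where
  "shift k (Jump m n q) = Jump m n (q + k)"
| "shift k (Zero n) = Zero n"
| "shift k (Succ n) = Succ n"
| "shift k (Transfer m n) = Transfer m n"
| "shift k (Query n) = Query n"

lemma shift_shift [simp]: "shift a (shift b i) = shift (a + b) i"
  by (cases i) (auto simp: ac_simps)

lemma shift_0 [simp]: "shift 0 i = i"
  by (cases i) auto

definition placed_at :: "program \<Rightarrow> nat \<Rightarrow> nat \<Rightarrow> program \<Rightarrow> bool" where
  "placed_at P a k Q \<longleftrightarrow> (\<forall>i<length Q. a + k + i < length P \<and> P ! (a + k + i) = shift a (Q ! i))"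

abbreviation placed :: "program \<Rightarrow> nat \<Rightarrow> program \<Rightarrow> bool" where
  "placed P a Q \<equiv> placed_at P a 0 Q"

lemma placed_at_Nil [simp]: "placed_at P a k []"
  by (simp add: placed_at_def)

lemma placed_at_Cons [simp]:
  "placed_at P a k (i # Q) \<longleftrightarrow> a + k < length P \<and> P ! (a + k) = shift a i \<and> placed_at P a (Suc k) Q"
  unfolding placed_at_def by (auto simp: All_less_Suc2)

lemma placed_at_append [simp]:
  "placed_at P a k (Q @ Q') \<longleftrightarrow> placed_at P a k Q \<and> placed_at P a (k + length Q) Q'"
  by (induction Q arbitrary: k) auto

lemma placed_at_map_shift [simp]: "placed_at P a k (map (shift k) Q) \<longleftrightarrow> placed P (a + k) Q"
  by (auto simp: placed_at_def)

lemma pseg_exec: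
  assumes "a < length P" "P ! a = i"
  shows "pseg P x (case_nat a R) (case_nat a R) (vec_of (exec x i (a, R)))"
  using gseg.step[of "\<lambda>v. v" "stp P x" "case_nat a R"] assms
  by (simp add: stp_def step_def halted_def)

lemma pseg_trans:
  assumes "pseg P x v (case_nat l \<mu>) w" "pseg P x w (case_nat l' \<mu>') u"
  shows "pseg P x v (case_nat (min l l') (\<lambda>r. min (\<mu> r) (\<mu>' r))) u"
proof -
  have "(\<lambda>j. min (case_nat l \<mu> j) (case_nat l' \<mu>' j)) = case_nat (min l l') (\<lambda>r. min (\<mu> r) (\<mu>' r))"
    by (auto split: nat.split)
  then show ?thesis using gseg.trans[OF assms] by simp
qed

text \<open>The recorded minimum of the line component is exactly \<open>a\<close>: control never
  drops below the first line of the fragment. Hence, when a loop is repeated infinitely often, the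
  limit line is the head of the loop.\<close>

definition ecall :: "program \<Rightarrow> nat set \<Rightarrow> vec \<Rightarrow> vec \<Rightarrow> vec \<Rightarrow> bool" where
  "ecall Q x R \<mu> R' \<longleftrightarrow> (\<forall>P a. placed P a Q \<longrightarrow>
     pseg P x (case_nat a R) (case_nat a \<mu>) (case_nat (a + length Q) R'))"

definition seqq :: "program \<Rightarrow> program \<Rightarrow> program" (infixr ";;" 60) where
  "Q ;; Q' = Q @ map (shift (length Q)) Q'"

text \<open>The loop ends when registers \<open>i\<close> and \<open>j\<close> agree. In
  \<open>ite\<close>, agreement selects the first branch, which is placed last.\<close>

definition whil :: "nat \<Rightarrow> nat \<Rightarrow> program \<Rightarrow> program" where
  "whil i j Q = Jump i j (length Q + 2) # map (shift 1) Q @ [Jump 0 0 0]"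

definition ite :: "nat \<Rightarrow> nat \<Rightarrow> program \<Rightarrow> program \<Rightarrow> program" where
  "ite i j Q Q' = Jump i j (length Q' + 2) # map (shift 1) Q' @
     Jump 0 0 (length Q' + 2 + length Q) # map (shift (length Q' + 2)) Q"

lemma length_whil [simp]: "length (whil i j Q) = length Q + 2"
  by (simp add: whil_def)

lemma placed_whil:
  "placed P a (whil i j Q) \<longleftrightarrow> a < length P \<and> P ! a = Jump i j (length Q + 2 + a) \<and>
     placed P (a + 1) Q \<and> a + 1 + length Q < length P \<and> P ! (a + 1 + length Q) = Jump 0 0 a"
  using placed_at_map_shift[of P a 1 Q] by (auto simp: whil_def)

lemma ecall_Zero: "ecall [Zero n] x R R (R(n := 0))"
  using pseg_exec[of _ _ "Zero n"] by (auto simp: ecall_def)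
lemma ecall_Succ: "ecall [Succ n] x R R (R(n := Suc (R n)))"
  using pseg_exec[of _ _ "Succ n"] by (auto simp: ecall_def)
lemma ecall_Transfer: "ecall [Transfer m n] x R R (R(n := R m))"
  using pseg_exec[of _ _ "Transfer m n"] by (auto simp: ecall_def)
lemma ecall_Query: "ecall [Query n] x R R (R(n := (if R n \<in> x then 1 else 0)))"
  using pseg_exec[of _ _ "Query n" x] by (auto simp: ecall_def)

lemma ecall_seqq:
  assumes "ecall Q x R \<mu> R'" "ecall Q' x R' \<mu>' R''"
  shows "ecall (Q ;; Q') x R (\<lambda>r. min (\<mu> r) (\<mu>' r)) R''"
  unfolding ecall_def seqq_def
proof (intro allI impI)
  fix P a
  assume "placed P a (Q @ map (shift (length Q)) Q')"
  then have "placed P a Q" "placed P (a + length Q) Q'" by auto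
  then have "pseg P x (case_nat a R) (case_nat a \<mu>) (case_nat (a + length Q) R')"
    "pseg P x (case_nat (a + length Q) R') (case_nat (a + length Q) \<mu>')
       (case_nat (a + length Q + length Q') R'')"
    using assms unfolding ecall_def by blast+
  from pseg_trans[OF this]
  show "pseg P x (case_nat a R) (case_nat a (\<lambda>r. min (\<mu> r) (\<mu>' r)))
     (case_nat (a + length (Q @ map (shift (length Q)) Q')) R'')"
    by (simp add: add.assoc)
qed

lemma pseg_whil_body:
  assumes "placed P a (whil i j Q)" "R i \<noteq> R j" "ecall Q x R \<mu> R'"
  shows "pseg P x (case_nat a R) (case_nat a (\<lambda>r. min (R r) (min (\<mu> r) (R' r)))) (case_nat a R')"
proof -
  note p = assms(1)[unfolded placed_whil]
  have 1: "pseg P x (case_nat a R) (case_nat a R) (case_nat (a + 1) R)"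
    using pseg_exec[of a P _ x R] p assms(2) by auto
  have 2: "pseg P x (case_nat (a + 1) R) (case_nat (a + 1) \<mu>) (case_nat (a + 1 + length Q) R')"
    using p assms(3) unfolding ecall_def by blast
  have 3: "pseg P x (case_nat (a + 1 + length Q) R') (case_nat (a + 1 + length Q) R') (case_nat a R')"
    using pseg_exec[of "a + 1 + length Q" P _ x R'] p by auto
  show ?thesis using pseg_trans[OF 1 pseg_trans[OF 2 3]] by simp
qed

lemma ecall_whil_done:
  assumes "R i = R j"
  shows "ecall (whil i j Q) x R R R"
  unfolding ecall_def placed_whil
  using assms pseg_exec[of _ _ "Jump i j _" x R] by (fastforce simp: ac_simps)

lemma ecall_whil_step:
  assumes "R i \<noteq> R j" "ecall Q x R \<mu> R'" "ecall (whil i j Q) x R' \<mu>' R''"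
  shows "ecall (whil i j Q) x R (\<lambda>r. min (min (R r) (min (\<mu> r) (R' r))) (\<mu>' r)) R''"
  unfolding ecall_def
proof (intro allI impI)
  fix P a
  assume p: "placed P a (whil i j Q)"
  then have "pseg P x (case_nat a R') (case_nat a \<mu>') (case_nat (a + length (whil i j Q)) R'')"
    using assms(3) unfolding ecall_def by blast
  from pseg_trans[OF pseg_whil_body[OF p assms(1,2)] this]
  show "pseg P x (case_nat a R) (case_nat a (\<lambda>r. min (min (R r) (min (\<mu> r) (R' r))) (\<mu>' r)))
     (case_nat (a + length (whil i j Q)) R'')" by simp
qed

lemma ecall_ite:
  assumes "R i = R j \<Longrightarrow> ecall Q x R \<mu> R'" "R i \<noteq> R j \<Longrightarrow> ecall Q' x R \<mu> R'"
  shows "ecall (ite i j Q Q') x R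
     (\<lambda>r. min (R r) (if R i = R j then \<mu> r else min (\<mu> r) (R' r))) R'"
  unfolding ecall_def
proof (intro allI impI)
  fix P a
  assume "placed P a (ite i j Q Q')"
  then have p: "a < length P" "P ! a = Jump i j (length Q' + 2 + a)" "placed P (a + 1) Q'"
     "a + 1 + length Q' < length P" "P ! (a + 1 + length Q') = Jump 0 0 (length Q' + 2 + length Q + a)"
     "placed P (a + (length Q' + 2)) Q"
    using placed_at_map_shift[of P a 1 Q'] placed_at_map_shift[of P a "length Q' + 2" Q]
    by (auto simp: ite_def)
  have len: "length (ite i j Q Q') = length Q' + 2 + length Q" by (simp add: ite_def)
  show "pseg P x (case_nat a R) (case_nat a (\<lambda>r. min (R r) (if R i = R j then \<mu> r else min (\<mu> r) (R' r))))
     (case_nat (a + length (ite i j Q Q')) R')"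
  proof (cases "R i = R j")
    case True
    have 1: "pseg P x (case_nat a R) (case_nat a R) (case_nat (a + (length Q' + 2)) R)"
      using pseg_exec[of a P _ x R] p True by (auto simp: ac_simps)
    have 2: "pseg P x (case_nat (a + (length Q' + 2)) R) (case_nat (a + (length Q' + 2)) \<mu>)
        (case_nat (a + (length Q' + 2) + length Q) R')"
      using assms(1)[OF True] p(6) unfolding ecall_def by blast
    show ?thesis using pseg_trans[OF 1 2] True len by (simp add: ac_simps)
  next
    case False
    have 1: "pseg P x (case_nat a R) (case_nat a R) (case_nat (a + 1) R)"
      using pseg_exec[of a P _ x R] p False by auto
    have 2: "pseg P x (case_nat (a + 1) R) (case_nat (a + 1) \<mu>) (case_nat (a + 1 + length Q') R')"
      using assms(2)[OF False] p(3) unfolding ecall_def by blast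
    have 3: "pseg P x (case_nat (a + 1 + length Q') R') (case_nat (a + 1 + length Q') R')
        (case_nat (a + (length Q' + 2 + length Q)) R')"
      using pseg_exec[of "a + 1 + length Q'" P _ x R'] p by (auto simp: ac_simps)
    show ?thesis using pseg_trans[OF 1 pseg_trans[OF 2 3]] False len by simp
  qed
qed

text \<open>Registers below \<open>d\<close> are restored at the end and, moreover, never fall below
  their values in between. A surrounding loop needs both, since its limit states depend on the
  minima during each round.\<close>

definition calls :: "nat \<Rightarrow> program \<Rightarrow> nat set \<Rightarrow> vec \<Rightarrow> vec \<Rightarrow> bool" where
  "calls d Q x R R' \<longleftrightarrow> (\<exists>\<mu>. ecall Q x R \<mu> R' \<and> (\<forall>r<d. \<mu> r = R r \<and> R' r = R r))"

lemma calls_mono: "calls d Q x R R' \<Longrightarrow> d' \<le> d \<Longrightarrow> calls d' Q x R R'"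
  unfolding calls_def by (meson order_less_le_trans)

lemma calls_frame: "calls d Q x R R' \<Longrightarrow> r < d \<Longrightarrow> R' r = R r"
  by (auto simp: calls_def)

lemma calls_Zero: "d \<le> n \<Longrightarrow> calls d [Zero n] x R (R(n := 0))"
  unfolding calls_def by (rule exI, rule conjI, rule ecall_Zero) auto
lemma calls_Succ: "d \<le> n \<Longrightarrow> calls d [Succ n] x R (R(n := Suc (R n)))"
  unfolding calls_def by (rule exI, rule conjI, rule ecall_Succ) auto
lemma calls_Transfer: "d \<le> n \<Longrightarrow> calls d [Transfer m n] x R (R(n := R m))"
  unfolding calls_def by (rule exI, rule conjI, rule ecall_Transfer) auto
lemma calls_Query: "d \<le> n \<Longrightarrow> calls d [Query n] x R (R(n := (if R n \<in> x then 1 else 0)))"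
  unfolding calls_def by (rule exI, rule conjI, rule ecall_Query) auto

lemma calls_seqq:
  assumes "calls d Q x R R'" "calls d Q' x R' R''"
  shows "calls d (Q ;; Q') x R R''"
proof -
  obtain \<mu> \<mu>' where "ecall Q x R \<mu> R'" "\<forall>r<d. \<mu> r = R r \<and> R' r = R r"
     "ecall Q' x R' \<mu>' R''" "\<forall>r<d. \<mu>' r = R' r \<and> R'' r = R' r"
    using assms by (auto simp: calls_def)
  then show ?thesis
    unfolding calls_def by (intro exI[of _ "\<lambda>r. min (\<mu> r) (\<mu>' r)"] conjI ecall_seqq) auto
qed

lemma calls_whil_done: "R i = R j \<Longrightarrow> calls d (whil i j Q) x R R"
  unfolding calls_def using ecall_whil_done by blast

lemma calls_whil_step:
  assumes "R i \<noteq> R j" "calls d Q x R R'" "calls d (whil i j Q) x R' R''"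
  shows "calls d (whil i j Q) x R R''"
proof -
  obtain \<mu> \<mu>' where "ecall Q x R \<mu> R'" "\<forall>r<d. \<mu> r = R r \<and> R' r = R r"
     "ecall (whil i j Q) x R' \<mu>' R''" "\<forall>r<d. \<mu>' r = R' r \<and> R'' r = R' r"
    using assms by (auto simp: calls_def)
  then show ?thesis
    unfolding calls_def
    by (intro exI[of _ "\<lambda>r. min (min (R r) (min (\<mu> r) (R' r))) (\<mu>' r)"] conjI
        ecall_whil_step) (use assms(1) in auto)
qed

lemma calls_ite:
  assumes "R i = R j \<Longrightarrow> calls d Q x R R'" "R i \<noteq> R j \<Longrightarrow> calls d Q' x R R'"
  shows "calls d (ite i j Q Q') x R R'"
proof -
  obtain \<mu> where m: "R i = R j \<Longrightarrow> ecall Q x R \<mu> R'" "R i \<noteq> R j \<Longrightarrow> ecall Q' x R \<mu> R'"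
     "\<forall>r<d. \<mu> r = R r \<and> R' r = R r"
    using assms unfolding calls_def by (cases "R i = R j") auto
  then show ?thesis
    unfolding calls_def using ecall_ite[OF m(1,2)]
    by (intro exI[of _ "\<lambda>r. min (R r) (if R i = R j then \<mu> r else min (\<mu> r) (R' r))"]) auto
qed

subsection \<open>Arithmetic\<close>

definition pfst :: "nat \<Rightarrow> nat" where "pfst z = fst (prod_decode z)"
definition psnd :: "nat \<Rightarrow> nat" where "psnd z = snd (prod_decode z)"

lemma pair_simps [simp]:
  "pfst (prod_encode (a, b)) = a" "psnd (prod_encode (a, b)) = b" "prod_encode (pfst z, psnd z) = z"
  by (simp_all add: pfst_def psnd_def)

lemma calls_count:
  assumes "c \<noteq> t" "n \<noteq> c" "n \<noteq> t" "d \<le> t" "d \<le> c" "R c \<le> R n"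
  shows "calls d (whil c n ([Succ t] ;; [Succ c])) x R (R(t := R t + (R n - R c), c := R n))"
  using assms(6)
proof (induction "R n - R c" arbitrary: R)
  case 0
  then have "R c = R n" by simp
  moreover from this have "R(t := R t + (R n - R c), c := R n) = R" by auto
  ultimately show ?case using calls_whil_done by metis
next
  case (Suc k)
  let ?R = "R(t := Suc (R t), c := Suc (R c))"
  have "calls d ([Succ t] ;; [Succ c]) x R ?R"
    using calls_seqq[OF calls_Succ[of d t x R] calls_Succ[of d c x "R(t := Suc (R t))"]] assms by simp
  moreover have "calls d (whil c n ([Succ t] ;; [Succ c])) x ?R
      (?R(t := ?R t + (?R n - ?R c), c := ?R n))"
    using Suc assms by (intro Suc.hyps(1)) auto
  moreover have "?R(t := ?R t + (?R n - ?R c), c := ?R n) = R(t := R t + (R n - R c), c := R n)"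
    using Suc.hyps(2) Suc.prems assms(1-3) by (intro ext) auto
  ultimately show ?case using Suc calls_whil_step[of R c n] by auto
qed

definition addl :: "nat \<Rightarrow> nat \<Rightarrow> nat \<Rightarrow> program" where
  "addl t n c = [Zero c] ;; whil c n ([Succ t] ;; [Succ c])"

lemma calls_addl:
  assumes "c \<noteq> t" "n \<noteq> c" "n \<noteq> t" "d \<le> t" "d \<le> c"
  shows "calls d (addl t n c) x R (R(t := R t + R n, c := R n))"
proof -
  have "calls d (addl t n c) x R
      ((R(c := 0))(t := (R(c := 0)) t + ((R(c := 0)) n - (R(c := 0)) c), c := (R(c := 0)) n))"
    unfolding addl_def using assms
    by (intro calls_seqq[OF calls_Zero] calls_count) auto
  moreover have "((R(c := 0))(t := (R(c := 0)) t + ((R(c := 0)) n - (R(c := 0)) c), c := (R(c := 0)) n))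
      = R(t := R t + R n, c := R n)" using assms by auto
  ultimately show ?thesis by simp
qed

lemma calls_triangle:
  assumes "R (w+2) \<le> R (w+1)" "R w = triangle (R (w+2))"
  shows "\<exists>R'. calls w (whil (w+2) (w+1) ([Succ (w+2)] ;; addl w (w+2) (w+3))) x R R' \<and>
    R' w = triangle (R (w+1))"
  using assms
proof (induction "R (w+1) - R (w+2)" arbitrary: R)
  case 0
  then show ?case using calls_whil_done[of R "w+2" "w+1"] by (metis diff_is_0_eq le_antisym)
next
  case (Suc k)
  let ?R = "R(w+2 := Suc (R (w+2)))"
  let ?R' = "?R(w := ?R w + ?R (w+2), w+3 := ?R (w+2))"
  have body: "calls w ([Succ (w+2)] ;; addl w (w+2) (w+3)) x R ?R'"
    by (intro calls_seqq[OF calls_Succ] calls_addl) auto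
  obtain R' where R': "calls w (whil (w+2) (w+1) ([Succ (w+2)] ;; addl w (w+2) (w+3))) x ?R' R'"
      "R' w = triangle (?R' (w+1))"
  proof -
    have "k = ?R' (w+1) - ?R' (w+2)" "?R' (w+2) \<le> ?R' (w+1)" "?R' w = triangle (?R' (w+2))"
      using Suc.hyps(2) Suc.prems by auto
    from Suc.hyps(1)[OF this] that show ?thesis by blast
  qed
  have "calls w (whil (w+2) (w+1) ([Succ (w+2)] ;; addl w (w+2) (w+3))) x R R'"
    using Suc.hyps(2) by (intro calls_whil_step[OF _ body R'(1)]) auto
  then show ?case using R'(2) by auto
qed

text \<open>\<open>prod_encode (a, b)\<close> is the triangle number of \<open>a + b\<close>,
  increased by \<open>a\<close>. Register \<open>w+1\<close> holds the sum, \<open>w+2\<close>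
  counts up to it, and \<open>w\<close> collects the triangle number.\<close>

definition pair_code :: "nat \<Rightarrow> nat \<Rightarrow> nat \<Rightarrow> program" where
  "pair_code i j w = [Transfer i (w+1)] ;; addl (w+1) j (w+3) ;; [Zero w] ;; [Zero (w+2)] ;;
     whil (w+2) (w+1) ([Succ (w+2)] ;; addl w (w+2) (w+3)) ;; addl w i (w+3)"

lemma calls_pair_code:
  assumes "i < w" "j < w"
  shows "\<exists>R'. calls w (pair_code i j w) x R R' \<and> R' w = prod_encode (R i, R j)"
proof -
  define R1 where "R1 = R(w+1 := R i)"
  define R2 where "R2 = R1(w+1 := R1 (w+1) + R1 j, w+3 := R1 j)"
  define R3 where "R3 = R2(w := 0)"
  define R4 where "R4 = R3(w+2 := 0)"
  note defs = R1_def R2_def R3_def R4_def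
  obtain R5 where R5: "calls w (whil (w+2) (w+1) ([Succ (w+2)] ;; addl w (w+2) (w+3))) x R4 R5"
      "R5 w = triangle (R4 (w+1))"
    using calls_triangle[of R4 w x] by (auto simp: R4_def R3_def)
  have "calls w (pair_code i j w) x R (R5(w := R5 w + R5 i, w+3 := R5 i))"
    unfolding pair_code_def
    using calls_seqq[OF calls_Transfer[of w "w+1" i x R, folded R1_def]
        calls_seqq[OF calls_addl[of "w+3" "w+1" j w x R1, folded R2_def]
          calls_seqq[OF calls_Zero[of w w x R2, folded R3_def]
            calls_seqq[OF calls_Zero[of w "w+2" x R3, folded R4_def]
              calls_seqq[OF R5(1) calls_addl[of "w+3" w i w x R5]]]]]] assms
    by auto
  moreover have "R5 i = R i" using calls_frame[OF R5(1)] assms by (simp add: defs)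
  moreover have "R4 (w+1) = R i + R j" using assms by (simp add: defs)
  ultimately show ?thesis using R5(2) by (auto simp: prod_encode_def)
qed

lemma prod_encode_next:
  "prod_encode (m, Suc n) + 1 = prod_encode (Suc m, n)" "prod_encode (m, 0) + 1 = prod_encode (0, Suc m)"
  by (simp_all add: prod_encode_def)

text \<open>Unpairing walks through all pairs in the order of their codes until the counter
  \<open>w+3\<close> reaches the code in \<open>w\<close>. The current pair is kept as its first
  component in \<open>w+1\<close> and its sum in \<open>w+2\<close>, so these registers agree
  exactly at the end of a diagonal.\<close>

definition next_code :: "nat \<Rightarrow> program" where
  "next_code w = [Succ (w+3)] ;; ite (w+1) (w+2) ([Succ (w+2)] ;; [Zero (w+1)]) [Succ (w+1)]"

definition unpair_code :: "nat \<Rightarrow> program" where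
  "unpair_code w = [Zero (w+1)] ;; [Zero (w+2)] ;; [Zero (w+3)] ;; whil (w+3) w (next_code w) ;;
     [Zero (w+4)] ;; [Transfer (w+1) (w+5)] ;; whil (w+5) (w+2) ([Succ (w+4)] ;; [Succ (w+5)])"

lemma calls_next_code:
  assumes "R (w+1) \<le> R (w+2)" "R (w+3) = prod_encode (R (w+1), R (w+2) - R (w+1))"
  shows "\<exists>R'. calls (w+1) (next_code w) x R R' \<and> R' (w+1) \<le> R' (w+2) \<and> R' (w+3) = Suc (R (w+3)) \<and>
    R' (w+3) = prod_encode (R' (w+1), R' (w+2) - R' (w+1))"
proof -
  define R1 where "R1 = R(w+3 := Suc (R (w+3)))"
  define R' where "R' = (if R (w+1) = R (w+2) then R1(w+2 := Suc (R1 (w+2)), w+1 := 0)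
     else R1(w+1 := Suc (R1 (w+1))))"
  have 1: "calls (w+1) ([Succ (w+2)] ;; [Zero (w+1)]) x R1 (R1(w+2 := Suc (R1 (w+2)), w+1 := 0))"
    by (rule calls_seqq[OF calls_Succ calls_Zero]) auto
  have "calls (w+1) (ite (w+1) (w+2) ([Succ (w+2)] ;; [Zero (w+1)]) [Succ (w+1)]) x R1 R'"
    using 1 calls_Succ[of "w+1" "w+1" x R1] by (intro calls_ite) (auto simp: R'_def R1_def)
  then have "calls (w+1) (next_code w) x R R'"
    unfolding next_code_def
    by (rule calls_seqq[OF calls_Succ[of "w+1" "w+3" x R, folded R1_def], rotated]) simp
  moreover have "R' (w+1) \<le> R' (w+2)" "R' (w+3) = Suc (R (w+3))" using assms(1)
    by (auto simp: R'_def R1_def)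
  moreover have "R' (w+3) = prod_encode (R' (w+1), R' (w+2) - R' (w+1))"
  proof (cases "R (w+1) = R (w+2)")
    case True
    then show ?thesis using assms(2) prod_encode_next(2)[of "R (w+2)"] by (simp add: R'_def R1_def)
  next
    case False
    then obtain n where n: "R (w+2) - R (w+1) = Suc n"
      using assms(1) by (metis Suc_diff_Suc le_neq_implies_less)
    then have "R (w+2) - Suc (R (w+1)) = n" by simp
    then show ?thesis using False n assms(2) prod_encode_next(1)[of "R (w+1)" n]
      by (simp add: R'_def R1_def)
  qed
  ultimately show ?thesis by blast
qed

lemma calls_unpair_loop:
  assumes "R (w+1) \<le> R (w+2)" "R (w+3) = prod_encode (R (w+1), R (w+2) - R (w+1))" "R (w+3) \<le> R w"
  shows "\<exists>R'. calls (w+1) (whil (w+3) w (next_code w)) x R R' \<and> R' (w+1) = pfst (R w) \<and>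
    R' (w+1) \<le> R' (w+2) \<and> R' (w+2) - R' (w+1) = psnd (R w)"
  using assms
proof (induction "R w - R (w+3)" arbitrary: R)
  case 0
  then have eq: "R (w+3) = R w" by simp
  then have "pfst (R w) = R (w+1)" "psnd (R w) = R (w+2) - R (w+1)"
    using 0 by (metis pair_simps(1), metis pair_simps(2))
  then show ?case using calls_whil_done[of R "w+3" w] eq 0 by (intro exI[of _ R]) auto
next
  case (Suc k)
  obtain R1 where R1: "calls (w+1) (next_code w) x R R1" "R1 (w+1) \<le> R1 (w+2)"
      "R1 (w+3) = Suc (R (w+3))" "R1 (w+3) = prod_encode (R1 (w+1), R1 (w+2) - R1 (w+1))"
    using calls_next_code[OF Suc.prems(1,2)] by blast
  have w: "R1 w = R w" using calls_frame[OF R1(1)] by simp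
  obtain R' where R': "calls (w+1) (whil (w+3) w (next_code w)) x R1 R'" "R' (w+1) = pfst (R w)"
    "R' (w+1) \<le> R' (w+2)" "R' (w+2) - R' (w+1) = psnd (R w)"
  proof -
    have "k = R1 w - R1 (w+3)" "R1 (w+3) \<le> R1 w" using Suc.hyps(2) R1(3) w by auto
    from Suc.hyps(1)[OF this(1) R1(2,4) this(2)] that w show ?thesis by auto
  qed
  have "calls (w+1) (whil (w+3) w (next_code w)) x R R'"
    using Suc.hyps(2) by (intro calls_whil_step[OF _ R1(1) R'(1)]) auto
  then show ?case using R' by blast
qed

lemma calls_unpair_code:
  "\<exists>R'. calls (w+1) (unpair_code w) x R R' \<and> R' (w+1) = pfst (R w) \<and> R' (w+4) = psnd (R w)"
proof -
  define R3 where "R3 = R(w+1 := 0, w+2 := 0, w+3 := 0)"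
  obtain R4 where R4: "calls (w+1) (whil (w+3) w (next_code w)) x R3 R4" "R4 (w+1) = pfst (R w)"
    "R4 (w+1) \<le> R4 (w+2)" "R4 (w+2) - R4 (w+1) = psnd (R w)"
    using calls_unpair_loop[of R3 w x] by (auto simp: R3_def prod_encode_def)
  define R6 where "R6 = R4(w+4 := 0, w+5 := R4 (w+1))"
  have R6: "R6 (w+5) \<le> R6 (w+2)" using R4 by (simp add: R6_def)
  let ?R = "R6(w+4 := R6 (w+4) + (R6 (w+2) - R6 (w+5)), w+5 := R6 (w+2))"
  have 1: "calls (w+1) (whil (w+5) (w+2) ([Succ (w+4)] ;; [Succ (w+5)])) x R6 ?R"
    using R6 by (intro calls_count) auto
  have 2: "calls (w+1) [Transfer (w+1) (w+5)] x (R4(w+4 := 0)) R6"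
    using calls_Transfer[of "w+1" "w+5" "w+1" x "R4(w+4 := 0)"] by (simp add: R6_def)
  have "calls (w+1) (unpair_code w) x R ?R"
    unfolding unpair_code_def
    using calls_seqq[OF calls_Zero[of "w+1" "w+1" x R]
        calls_seqq[OF calls_Zero[of "w+1" "w+2" x "R(w+1 := 0)"]
          calls_seqq[OF calls_Zero[of "w+1" "w+3" x "R(w+1 := 0, w+2 := 0)", folded R3_def]
            calls_seqq[OF R4(1) calls_seqq[OF calls_Zero[of "w+1" "w+4" x R4]
              calls_seqq[OF 2 1]]]]]]
    by simp
  moreover have "?R (w+1) = pfst (R w)" "?R (w+4) = psnd (R w)" using R4 by (auto simp: R6_def)
  ultimately show ?thesis by blast
qed

section \<open>Functions computed by infinite time register machines\<close>

text \<open>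
  The argument is passed in register \<open>d\<close>, which receives the value; the code may use all
  registers above \<open>d\<close> and makes no assumption on their contents.
\<close>

definition itrm_fn :: "(nat set \<Rightarrow> nat \<Rightarrow> nat) \<Rightarrow> bool" where
  "itrm_fn F \<longleftrightarrow> (\<forall>d. \<exists>Q. \<forall>x R. \<exists>R'. calls d Q x R R' \<and> R' d = F x (R d))"

lemma itrm_fnI:
  "(\<And>d. \<exists>Q. \<forall>x R. \<exists>R'. calls d Q x R R' \<and> R' d = F x (R d)) \<Longrightarrow> itrm_fn F"
  by (simp add: itrm_fn_def)

lemma itrm_fnE:
  assumes "itrm_fn F"
  obtains Q where "\<And>x R. \<exists>R'. calls d Q x R R' \<and> R' d = F x (R d)"
  using assms unfolding itrm_fn_def by meson

lemma itrm_id: "itrm_fn (\<lambda>x n. n)"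
proof (rule itrm_fnI)
  fix d show "\<exists>Q. \<forall>x R. \<exists>R'. calls d Q x R R' \<and> R' d = R d"
    using calls_Transfer[of d d d] by (intro exI[of _ "[Transfer d d]"]) auto
qed

lemma itrm_comp:
  assumes "itrm_fn F" "itrm_fn G"
  shows "itrm_fn (\<lambda>x n. F x (G x n))"
proof (rule itrm_fnI)
  fix d
  obtain QF where QF: "\<And>x R. \<exists>R'. calls d QF x R R' \<and> R' d = F x (R d)" using assms(1) itrm_fnE by blast
  obtain QG where QG: "\<And>x R. \<exists>R'. calls d QG x R R' \<and> R' d = G x (R d)" using assms(2) itrm_fnE by blast
  show "\<exists>Q. \<forall>x R. \<exists>R'. calls d Q x R R' \<and> R' d = F x (G x (R d))"
    using QF QG by (intro exI[of _ "QG ;; QF"]) (metis calls_seqq)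
qed

lemma itrm_Suc':  "itrm_fn (\<lambda>x n. Suc n)"
proof (rule itrm_fnI)
  fix d show "\<exists>Q. \<forall>x R. \<exists>R'. calls d Q x R R' \<and> R' d = Suc (R d)"
    using calls_Succ[of d d] by (intro exI[of _ "[Succ d]"]) fastforce
qed

lemmas itrm_Suc = itrm_comp[OF itrm_Suc']

lemma itrm_const: "itrm_fn (\<lambda>x n. c)"
proof (induction c)
  case 0
  show ?case
  proof (rule itrm_fnI)
    fix d show "\<exists>Q. \<forall>x R. \<exists>R'. calls d Q x R R' \<and> R' d = 0"
      using calls_Zero[of d d] by (intro exI[of _ "[Zero d]"]) fastforce
  qed
qed (rule itrm_Suc)

lemma itrm_query: "itrm_fn (\<lambda>x n. if n \<in> x then 1 else 0)"
proof (rule itrm_fnI)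
  fix d show "\<exists>Q. \<forall>x R. \<exists>R'. calls d Q x R R' \<and> R' d = (if R d \<in> x then 1 else 0)"
    using calls_Query[of d d] by (intro exI[of _ "[Query d]"]) fastforce
qed

lemma itrm_two_args:
  assumes "itrm_fn F" "itrm_fn G"
  obtains Q where "\<And>x R. \<exists>R'. calls (d+1) Q x R R' \<and> R' (d+1) = F x (R d) \<and> R' (d+2) = G x (R d)"
proof -
  obtain QF where QF: "\<And>x R. \<exists>R'. calls (d+1) QF x R R' \<and> R' (d+1) = F x (R (d+1))"
    using assms(1) itrm_fnE by blast
  obtain QG where QG: "\<And>x R. \<exists>R'. calls (d+2) QG x R R' \<and> R' (d+2) = G x (R (d+2))"
    using assms(2) itrm_fnE by blast
  have "\<exists>R'. calls (d+1) ([Transfer d (d+1)] ;; QF ;; [Transfer d (d+2)] ;; QG) x R R' \<and>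
    R' (d+1) = F x (R d) \<and> R' (d+2) = G x (R d)" for x R
  proof -
    obtain R2 where R2: "calls (d+1) QF x (R(d+1 := R d)) R2" "R2 (d+1) = F x (R d)"
      using QF[of x "R(d+1 := R d)"] by auto
    have d: "R2 d = R d" using calls_frame[OF R2(1), of d] by simp
    obtain R4 where R4: "calls (d+2) QG x (R2(d+2 := R2 d)) R4" "R4 (d+2) = G x (R2 d)"
      using QG[of x "R2(d+2 := R2 d)"] by auto
    have "calls (d+1) ([Transfer d (d+1)] ;; QF ;; [Transfer d (d+2)] ;; QG) x R R4"
      by (rule calls_seqq[OF calls_Transfer], simp, rule calls_seqq[OF R2(1)],
          rule calls_seqq[OF calls_Transfer], simp, rule calls_mono[OF R4(1)], simp)
    moreover have "R4 (d+1) = F x (R d)" using calls_frame[OF R4(1), of "d+1"] R2(2) by simp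
    ultimately show ?thesis using R4(2) d by auto
  qed
  then show ?thesis using that by blast
qed

lemma itrm_pair:
  assumes "itrm_fn F" "itrm_fn G"
  shows "itrm_fn (\<lambda>x n. prod_encode (F x n, G x n))"
proof (rule itrm_fnI)
  fix d
  obtain Q where Q: "\<And>x R. \<exists>R'. calls (d+1) Q x R R' \<and> R' (d+1) = F x (R d) \<and> R' (d+2) = G x (R d)"
    using itrm_two_args[OF assms] by blast
  have "\<exists>R'. calls d (Q ;; pair_code (d+1) (d+2) (d+3) ;; [Transfer (d+3) d]) x R R' \<and>
     R' d = prod_encode (F x (R d), G x (R d))" for x R
  proof -
    obtain R1 where R1: "calls (d+1) Q x R R1" "R1 (d+1) = F x (R d)" "R1 (d+2) = G x (R d)"
      using Q by blast
    obtain R2 where R2: "calls (d+3) (pair_code (d+1) (d+2) (d+3)) x R1 R2"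
      "R2 (d+3) = prod_encode (F x (R d), G x (R d))"
      using calls_pair_code[of "d+1" "d+3" "d+2" x R1] R1 by auto
    have "calls d (Q ;; pair_code (d+1) (d+2) (d+3) ;; [Transfer (d+3) d]) x R (R2(d := R2 (d+3)))"
      by (rule calls_seqq[OF calls_mono[OF R1(1)]], simp, rule calls_seqq[OF calls_mono[OF R2(1)]], simp,
          rule calls_Transfer) simp
    then show ?thesis using R2(2) by auto
  qed
  then show "\<exists>Q. \<forall>x R. \<exists>R'. calls d Q x R R' \<and> R' d = prod_encode (F x (R d), G x (R d))"
    by blast
qed

lemma itrm_pfst': "itrm_fn (\<lambda>x n. pfst n)" and itrm_psnd': "itrm_fn (\<lambda>x n. psnd n)"
proof -
  have *: "\<exists>R'. calls d (unpair_code d ;; [Transfer (d+1) d]) x R R' \<and> R' d = pfst (R d)"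
     "\<exists>R'. calls d (unpair_code d ;; [Transfer (d+4) d]) x R R' \<and> R' d = psnd (R d)" for d x R
  proof -
    obtain R1 where R1: "calls (d+1) (unpair_code d) x R R1" "R1 (d+1) = pfst (R d)" "R1 (d+4) = psnd (R d)"
      using calls_unpair_code by blast
    have c: "calls d (unpair_code d) x R R1" by (rule calls_mono[OF R1(1)]) simp
    show "\<exists>R'. calls d (unpair_code d ;; [Transfer (d+1) d]) x R R' \<and> R' d = pfst (R d)"
      using calls_seqq[OF c calls_Transfer[of d d "d+1"]] R1(2) by fastforce
    show "\<exists>R'. calls d (unpair_code d ;; [Transfer (d+4) d]) x R R' \<and> R' d = psnd (R d)"
      using calls_seqq[OF c calls_Transfer[of d d "d+4"]] R1(3) by fastforce
  qed
  show "itrm_fn (\<lambda>x n. pfst n)" "itrm_fn (\<lambda>x n. psnd n)"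
    using * unfolding itrm_fn_def by blast+
qed

lemmas itrm_pfst = itrm_comp[OF itrm_pfst']
lemmas itrm_psnd = itrm_comp[OF itrm_psnd']

lemma itrm_if_eq:
  assumes "itrm_fn F" "itrm_fn G" "itrm_fn H" "itrm_fn K"
  shows "itrm_fn (\<lambda>x n. if F x n = G x n then H x n else K x n)"
proof (rule itrm_fnI)
  fix d
  obtain Q where Q: "\<And>x R. \<exists>R'. calls (d+1) Q x R R' \<and> R' (d+1) = F x (R d) \<and> R' (d+2) = G x (R d)"
    using itrm_two_args[OF assms(1,2)] by blast
  obtain QH where QH: "\<And>x R. \<exists>R'. calls d QH x R R' \<and> R' d = H x (R d)" using assms(3) itrm_fnE by blast
  obtain QK where QK: "\<And>x R. \<exists>R'. calls d QK x R R' \<and> R' d = K x (R d)" using assms(4) itrm_fnE by blast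
  have "\<exists>R'. calls d (Q ;; ite (d+1) (d+2) QH QK) x R R' \<and>
     R' d = (if F x (R d) = G x (R d) then H x (R d) else K x (R d))" for x R
  proof -
    obtain R1 where R1: "calls (d+1) Q x R R1" "R1 (d+1) = F x (R d)" "R1 (d+2) = G x (R d)"
      using Q by blast
    have d: "R1 d = R d" using calls_frame[OF R1(1)] by simp
    obtain R2 where R2: "R1 (d+1) = R1 (d+2) \<Longrightarrow> calls d QH x R1 R2" "R1 (d+1) \<noteq> R1 (d+2) \<Longrightarrow> calls d QK x R1 R2"
        "R2 d = (if F x (R d) = G x (R d) then H x (R d) else K x (R d))"
      using QH[of x R1] QK[of x R1] R1 d by (cases "R1 (d+1) = R1 (d+2)") auto
    have "calls d (Q ;; ite (d+1) (d+2) QH QK) x R R2"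
      by (rule calls_seqq[OF calls_mono[OF R1(1)] calls_ite[OF R2(1,2)]]) auto
    then show ?thesis using R2(3) by blast
  qed
  then show "\<exists>Q. \<forall>x R. \<exists>R'. calls d Q x R R' \<and>
      R' d = (if F x (R d) = G x (R d) then H x (R d) else K x (R d))"
    by blast
qed

lemma itrm_iterate:
  assumes "itrm_fn F" "itrm_fn G" "itrm_fn K"
  shows "itrm_fn (\<lambda>x n. (F x ^^ K x n) (G x n))"
proof (rule itrm_fnI)
  fix d
  obtain Q where Q: "\<And>x R. \<exists>R'. calls (d+1) Q x R R' \<and> R' (d+1) = K x (R d) \<and> R' (d+2) = G x (R d)"
    using itrm_two_args[OF assms(3,2)] by blast
  obtain QF where QF: "\<And>x R. \<exists>R'. calls (d+4) QF x R R' \<and> R' (d+4) = F x (R (d+4))"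
    using assms(1) itrm_fnE by blast
  define L where "L = whil (d+3) (d+1) (QF ;; [Succ (d+3)])"
  have loop: "\<exists>R'. calls (d+2) L x R R' \<and> R' (d+4) = (F x ^^ (R (d+1) - R (d+3))) (R (d+4))"
    if "R (d+3) \<le> R (d+1)" for x R
    using that
  proof (induction "R (d+1) - R (d+3)" arbitrary: R)
    case 0
    then have "R (d+3) = R (d+1)" by simp
    then show ?case using calls_whil_done[of R "d+3" "d+1"] by (auto simp: L_def)
  next
    case (Suc k)
    obtain R1 where R1: "calls (d+4) QF x R R1" "R1 (d+4) = F x (R (d+4))" using QF by blast
    let ?R = "R1(d+3 := Suc (R1 (d+3)))"
    have fr: "R1 (d+3) = R (d+3)" "R1 (d+1) = R (d+1)" using calls_frame[OF R1(1)] by auto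
    have body: "calls (d+2) (QF ;; [Succ (d+3)]) x R ?R"
      by (rule calls_seqq[OF calls_mono[OF R1(1)] calls_Succ]) auto
    have k: "k = ?R (d+1) - ?R (d+3)" using Suc.hyps(2) fr by auto
    obtain R' where R': "calls (d+2) L x ?R R'"
        "R' (d+4) = (F x ^^ (?R (d+1) - ?R (d+3))) (?R (d+4))"
    proof -
      have "?R (d+3) \<le> ?R (d+1)" using Suc.hyps(2) fr by auto
      from Suc.hyps(1)[OF k this] that show ?thesis by blast
    qed
    have "calls (d+2) L x R R'"
      using Suc.hyps(2) R'(1) unfolding L_def by (intro calls_whil_step[OF _ body]) auto
    moreover have "R' (d+4) = (F x ^^ (R (d+1) - R (d+3))) (R (d+4))"
      using R'(2) R1(2) unfolding k[symmetric] Suc.hyps(2)[symmetric]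
      by (simp add: funpow_swap1)
    ultimately show ?case by blast
  qed
  have "\<exists>R'. calls d (Q ;; [Zero (d+3)] ;; [Transfer (d+2) (d+4)] ;; L ;; [Transfer (d+4) d]) x R R' \<and>
     R' d = (F x ^^ K x (R d)) (G x (R d))" for x R
  proof -
    obtain R1 where R1: "calls (d+1) Q x R R1" "R1 (d+1) = K x (R d)" "R1 (d+2) = G x (R d)"
      using Q by blast
    let ?R = "R1(d+3 := 0, d+4 := R1 (d+2))"
    obtain R2 where R2: "calls (d+2) L x ?R R2" "R2 (d+4) = (F x ^^ K x (R d)) (G x (R d))"
      using loop[of ?R x] R1 by auto
    have t: "calls d [Transfer (d+2) (d+4)] x (R1(d+3 := 0)) ?R"
      using calls_Transfer[of d "d+4" "d+2" x "R1(d+3 := 0)"] by simp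
    have "calls d (Q ;; [Zero (d+3)] ;; [Transfer (d+2) (d+4)] ;; L ;; [Transfer (d+4) d]) x R
        (R2(d := R2 (d+4)))"
      by (rule calls_seqq[OF calls_mono[OF R1(1)]], simp, rule calls_seqq[OF calls_Zero], simp,
          rule calls_seqq[OF t], rule calls_seqq[OF calls_mono[OF R2(1)] calls_Transfer]) auto
    then show ?thesis using R2(2) by auto
  qed
  then show "\<exists>Q. \<forall>x R. \<exists>R'. calls d Q x R R' \<and> R' d = (F x ^^ K x (R d)) (G x (R d))" by blast
qed

section \<open>Depth-first search of infinite trees\<close>

text \<open>
  A finite sequence is coded by pushing its entries onto \<open>1\<close>, where pushing \<open>i\<close> onto \<open>s\<close>
  yields \<open>prod_encode (s, i)\<close>.
\<close>

inductive dead :: "(nat \<Rightarrow> bool) \<Rightarrow> nat \<Rightarrow> bool" for T where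
  leaf: "\<not> T s \<Longrightarrow> dead T s"
| node: "(\<And>i. dead T (prod_encode (s, i))) \<Longrightarrow> dead T s"

lemma Ex_ge_nat [simp]: "Ex ((\<le>) (i :: nat))"
  by blast

lemma le_prod_encode: "s \<le> prod_encode (s, i)"
  by (simp add: prod_encode_def)

text \<open>Growth has to be strict for the node register to overflow along an infinite branch, and
  it fails at 0 because \<open>prod_encode (0, 0) = 0\<close>. With the root coded by 1, all nodes
  are positive, and the content 0 is left to signal the overflow.\<close>

lemma less_prod_encode: "0 < s \<Longrightarrow> s < prod_encode (s, i)"
  by (cases s) (simp_all add: prod_encode_def)

lemma pfst_le: "pfst s \<le> s"
  using le_prod_encode[of "pfst s" "psnd s"] by simp

locale dfs =
  fixes d :: nat and QT QS QP :: program and T :: "nat set \<Rightarrow> nat \<Rightarrow> bool"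
  assumes QT: "\<And>x R. \<exists>R'. calls (d+7) QT x R R' \<and> R' (d+7) = (if T x (R (d+7)) then 1 else 0)"
    and QS: "\<And>x R. \<exists>R'. calls (d+7) QS x R R' \<and> R' (d+7) = psnd (R (d+7))"
    and QP: "\<And>x R. \<exists>R'. calls (d+8) QP x R R' \<and> R' (d+8) = pfst (R (d+8))"
begin

text \<open>
  Register \<open>d+1\<close> holds the current node and \<open>d+2\<close> the mode: \<open>1\<close> when the node is entered,
  \<open>2\<close> when it is known to be dead.  The mode passes through \<open>0\<close> in every round, so that it is
  \<open>0\<close> at the head of the loop exactly at limit times; the node is then \<open>0\<close> if the search
  followed an infinite branch, and otherwise the node all of whose children are dead.
\<close>

definition lim_code where
  "lim_code = ite (d+1) (d+3) ([Transfer (d+4) d] ;; [Transfer (d+4) (d+5)]) [Transfer (d+6) (d+2)]"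

definition enter_code where
  "enter_code = [Zero (d+2)] ;; pair_code d (d+1) (d+7) ;; QT ;;
     ite (d+7) (d+4)
       ([Zero (d+7)] ;; pair_code (d+1) (d+7) (d+8) ;; [Transfer (d+8) (d+1)] ;; [Transfer (d+4) (d+2)])
       [Transfer (d+6) (d+2)]"

text \<open>The parent is written into the node register before the next sibling is. So the minimum
  of this register in such a round is the parent, and after all children of a node have been visited
  the limit inferior is the node itself.\<close>

definition step_code where
  "step_code = [Zero (d+2)] ;; [Transfer (d+1) (d+7)] ;; QS ;; [Succ (d+7)] ;;
      [Transfer (d+1) (d+8)] ;; QP ;; [Transfer (d+8) (d+1)] ;; pair_code (d+1) (d+7) (d+8) ;;
      [Transfer (d+8) (d+1)] ;; [Transfer (d+4) (d+2)]"

definition back_code where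
  "back_code = ite (d+1) (d+4) ([Zero d] ;; [Transfer (d+4) (d+5)]) step_code"

definition body where
  "body = ite (d+2) (d+3) lim_code (ite (d+2) (d+4) enter_code back_code)"

text \<open>Here the node and the mode register change. Their exact minima \<open>k\<close> and
  \<open>k'\<close> are recorded, because the state after infinitely many rounds is computed from
  them.\<close>

definition wcall where
  "wcall Q x R k k' R' \<longleftrightarrow> (\<exists>\<mu>. ecall Q x R \<mu> R' \<and> \<mu> (d+1) = k \<and> \<mu> (d+2) = k' \<and>
     (\<forall>r<d+7. r \<noteq> d+1 \<longrightarrow> r \<noteq> d+2 \<longrightarrow> \<mu> r = R r \<and> R' r = R r))"

lemma wcall_calls: "calls (d+7) Q x R R' \<Longrightarrow> wcall Q x R (R (d+1)) (R (d+2)) R'"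
  by (auto simp: calls_def wcall_def)

lemma wcall_set_mode: "wcall [Transfer m (d+2)] x R (R (d+1)) (R (d+2)) (R(d+2 := R m))"
  "wcall [Zero (d+2)] x R (R (d+1)) (R (d+2)) (R(d+2 := 0))"
  unfolding wcall_def by (rule exI, rule conjI, rule ecall_Transfer ecall_Zero, simp)+

lemma wcall_set_node: "wcall [Transfer m (d+1)] x R (R (d+1)) (R (d+2)) (R(d+1 := R m))"
  unfolding wcall_def by (rule exI, rule conjI, rule ecall_Transfer, simp)

lemma wcall_seqq:
  assumes "wcall Q x R k k' R'" "wcall Q' x R' l l' R''"
  shows "wcall (Q ;; Q') x R (min k l) (min k' l') R''"
proof -
  obtain \<mu> \<mu>' where "ecall Q x R \<mu> R'" "\<mu> (d+1) = k" "\<mu> (d+2) = k'"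
    "\<forall>r<d+7. r \<noteq> d+1 \<longrightarrow> r \<noteq> d+2 \<longrightarrow> \<mu> r = R r \<and> R' r = R r"
    "ecall Q' x R' \<mu>' R''" "\<mu>' (d+1) = l" "\<mu>' (d+2) = l'"
    "\<forall>r<d+7. r \<noteq> d+1 \<longrightarrow> r \<noteq> d+2 \<longrightarrow> \<mu>' r = R' r \<and> R'' r = R' r"
    using assms by (auto simp: wcall_def)
  then show ?thesis
    unfolding wcall_def by (intro exI[of _ "\<lambda>r. min (\<mu> r) (\<mu>' r)"] conjI ecall_seqq) auto
qed

lemma wcall_ite:
  assumes "R i = R j \<Longrightarrow> wcall Q x R k k' R'" "R i \<noteq> R j \<Longrightarrow> wcall Q' x R k k' R'"
    and "k \<le> R (d+1)" "k \<le> R' (d+1)" "k' \<le> R (d+2)" "k' \<le> R' (d+2)"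
  shows "wcall (ite i j Q Q') x R k k' R'"
proof -
  obtain \<mu> where m: "R i = R j \<Longrightarrow> ecall Q x R \<mu> R'" "R i \<noteq> R j \<Longrightarrow> ecall Q' x R \<mu> R'"
     "\<mu> (d+1) = k" "\<mu> (d+2) = k'"
     "\<forall>r<d+7. r \<noteq> d+1 \<longrightarrow> r \<noteq> d+2 \<longrightarrow> \<mu> r = R r \<and> R' r = R r"
    using assms unfolding wcall_def by (cases "R i = R j") auto
  then show ?thesis
    unfolding wcall_def using ecall_ite[OF m(1,2)] assms(3-)
    by (intro exI[of _ "\<lambda>r. min (R r) (if R i = R j then \<mu> r else min (\<mu> r) (R' r))"]) auto
qed

text \<open>Jumps can only compare registers, so \<open>d+3\<close>, \<open>d+4\<close> and
  \<open>d+6\<close> hold the constants 0, 1 and 2. Register \<open>d+5\<close> is the exit flag of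
  the loop, and the scratch registers start at \<open>d+7\<close>.\<close>

definition std where
  "std R0 n a f = R0(d := n, d+1 := a, d+2 := f, d+3 := 0, d+4 := 1, d+5 := 0, d+6 := (2::nat))"

definition ok where
  "ok R0 n a f R \<longleftrightarrow> (\<forall>r<d+7. R r = std R0 n a f r)"

lemma ok_simps:
  assumes "ok R0 n a f R"
  shows "R d = n" "R (d+1) = a" "R (d+2) = f" "R (d+3) = 0" "R (d+4) = 1" "R (d+5) = 0" "R (d+6) = 2"
    "\<And>r. r < d \<Longrightarrow> R r = R0 r"
  using assms unfolding ok_def std_def by auto

lemma ok_wcall:
  assumes "ok R0 n a f R" "wcall Q x R k k' R'" "R' (d+1) = a'" "R' (d+2) = f'"
  shows "ok R0 n a' f' R'"
  unfolding ok_def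
proof (intro allI impI)
  fix r assume r: "r < d+7"
  have "R' r = R r" if "r \<noteq> d+1" "r \<noteq> d+2" using assms(2) that r unfolding wcall_def by blast
  then show "R' r = std R0 n a' f' r"
    using assms(1,3,4) r by (cases "r = d+1"; cases "r = d+2") (auto simp: ok_def std_def)
qed

lemma body_limit:
  assumes "ok R0 n a 0 R" "a \<noteq> 0"
  shows "\<exists>R'. wcall body x R a 0 R' \<and> ok R0 n a 2 R'"
proof -
  note R = ok_simps[OF assms(1)]
  let ?R = "R(d+2 := R (d+6))"
  have "wcall body x R a 0 ?R"
    unfolding body_def lim_code_def
    using wcall_set_mode(1)[of "d+6" x R] R assms(2) by (intro wcall_ite) auto
  then show ?thesis using ok_wcall[OF assms(1), of body x a 0 ?R a 2] R by auto
qed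

lemma enter_test:
  assumes "ok R0 n a 1 R"
  obtains R3 where "wcall ([Zero (d+2)] ;; pair_code d (d+1) (d+7) ;; QT) x R a 0 R3"
    "ok R0 n a 0 R3" "R3 (d+7) = (if T x (prod_encode (n, a)) then 1 else 0)"
proof -
  note R = ok_simps[OF assms(1)]
  let ?R1 = "R(d+2 := 0)"
  obtain R2 where R2: "calls (d+7) (pair_code d (d+1) (d+7)) x ?R1 R2" "R2 (d+7) = prod_encode (n, a)"
    using calls_pair_code[of d "d+7" "d+1" x ?R1] R by auto
  obtain R3 where R3: "calls (d+7) QT x R2 R3" "R3 (d+7) = (if T x (prod_encode (n, a)) then 1 else 0)"
    using QT[of x R2] R2(2) by auto
  have fr: "R3 r = R2 r" "R2 r = ?R1 r" if "r < d+7" for r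
    using calls_frame[OF R3(1)] calls_frame[OF R2(1)] that by auto
  have w: "wcall ([Zero (d+2)] ;; pair_code d (d+1) (d+7) ;; QT) x R a 0 R3"
    using wcall_seqq[OF wcall_set_mode(2) wcall_seqq[OF wcall_calls[OF R2(1)] wcall_calls[OF R3(1)]]]
      R fr by simp
  show ?thesis using that[OF w ok_wcall[OF assms w] R3(2)] fr R by simp
qed

lemma seqq_assoc: "(Q ;; Q') ;; Q'' = Q ;; Q' ;; Q''"
  by (simp add: seqq_def add.commute)

lemma body_enter_fail:
  assumes "ok R0 n a 1 R" "\<not> T x (prod_encode (n, a))"
  shows "\<exists>R'. wcall body x R a 0 R' \<and> ok R0 n a 2 R'"
proof -
  note R = ok_simps[OF assms(1)]
  obtain R3 where R3: "wcall ([Zero (d+2)] ;; pair_code d (d+1) (d+7) ;; QT) x R a 0 R3"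
    "ok R0 n a 0 R3" "R3 (d+7) = 0"
    using enter_test[OF assms(1), of x] assms(2) by (metis)
  note R' = ok_simps[OF R3(2)]
  let ?R = "R3(d+2 := R3 (d+6))"
  let ?I = "ite (d+7) (d+4)
       ([Zero (d+7)] ;; pair_code (d+1) (d+7) (d+8) ;; [Transfer (d+8) (d+1)] ;; [Transfer (d+4) (d+2)])
       [Transfer (d+6) (d+2)]"
  have "wcall ?I x R3 a 0 ?R"
    using wcall_set_mode(1)[of "d+6" x R3] R' R3(3) by (intro wcall_ite) auto
  from wcall_seqq[OF R3(1) this] have "wcall enter_code x R a 0 ?R"
    by (simp add: enter_code_def seqq_assoc)
  then have "wcall body x R a 0 ?R"
    unfolding body_def using R R' by (intro wcall_ite) auto
  then show ?thesis using ok_wcall[OF assms(1), of body x a 0 ?R a 2] R' by auto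
qed

lemma body_enter_push:
  assumes "ok R0 n a 1 R" "T x (prod_encode (n, a))"
  shows "\<exists>R'. wcall body x R a 0 R' \<and> ok R0 n (prod_encode (a, 0)) 1 R'"
proof -
  note R = ok_simps[OF assms(1)]
  obtain R3 where R3: "wcall ([Zero (d+2)] ;; pair_code d (d+1) (d+7) ;; QT) x R a 0 R3"
    "ok R0 n a 0 R3" "R3 (d+7) = 1"
    using enter_test[OF assms(1), of x] assms(2) by (metis)
  note R' = ok_simps[OF R3(2)]
  let ?R4 = "R3(d+7 := 0)"
  obtain R5 where R5: "calls (d+8) (pair_code (d+1) (d+7) (d+8)) x ?R4 R5"
      "R5 (d+8) = prod_encode (a, 0)"
    using calls_pair_code[of "d+1" "d+8" "d+7" x ?R4] R' by auto
  have fr: "R5 r = ?R4 r" if "r < d+8" for r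
    using calls_frame[OF R5(1)] that by auto
  have c5: "calls (d+7) (pair_code (d+1) (d+7) (d+8)) x ?R4 R5" by (rule calls_mono[OF R5(1)]) simp
  have c4: "calls (d+7) [Zero (d+7)] x R3 ?R4" by (rule calls_Zero) simp
  let ?R = "R5(d+1 := R5 (d+8), d+2 := R5 (d+4))"
  let ?I = "ite (d+7) (d+4)
       ([Zero (d+7)] ;; pair_code (d+1) (d+7) (d+8) ;; [Transfer (d+8) (d+1)] ;; [Transfer (d+4) (d+2)])
       [Transfer (d+6) (d+2)]"
  have t: "wcall [Transfer (d+4) (d+2)] x (R5(d+1 := R5 (d+8))) (prod_encode (a, 0)) 0 ?R"
    using wcall_set_mode(1)[of "d+4" x "R5(d+1 := R5 (d+8))"] R' R5(2) fr by simp
  have "wcall ([Zero (d+7)] ;; pair_code (d+1) (d+7) (d+8) ;; [Transfer (d+8) (d+1)] ;; [Transfer (d+4) (d+2)])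
      x R3 a 0 ?R"
    using wcall_seqq[OF wcall_calls[OF c4] wcall_seqq[OF wcall_calls[OF c5] wcall_seqq[OF wcall_set_node t]]]
      R' fr le_prod_encode[of a 0] by simp
  then have "wcall ?I x R3 a 0 ?R"
    using R' R3(3) R5(2) fr le_prod_encode[of a 0] by (intro wcall_ite) auto
  from wcall_seqq[OF R3(1) this] have "wcall enter_code x R a 0 ?R"
    by (simp add: enter_code_def seqq_assoc)
  then have "wcall body x R a 0 ?R"
    unfolding body_def using R R' R5(2) fr le_prod_encode[of a 0] by (intro wcall_ite) auto
  then show ?thesis using ok_wcall[OF assms(1), of body x a 0 ?R "prod_encode (a, 0)" 1] R' R5(2) fr by auto
qed

lemma body_back:
  assumes "ok R0 n a 2 R" "a \<noteq> 1"
  shows "\<exists>R'. wcall body x R (pfst a) 0 R' \<and> ok R0 n (prod_encode (pfst a, Suc (psnd a))) 1 R'"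
proof -
  note R = ok_simps[OF assms(1)]
  define R2 where "R2 = R(d+2 := 0, d+7 := R (d+1))"
  obtain R3 where R3: "calls (d+7) QS x R2 R3" "R3 (d+7) = psnd a"
    using QS[of x R2] R by (auto simp: R2_def)
  have f3: "R3 r = R2 r" if "r < d+7" for r using calls_frame[OF R3(1)] that by auto
  define R5 where "R5 = R3(d+7 := Suc (R3 (d+7)), d+8 := R3 (d+1))"
  obtain R6 where R6: "calls (d+8) QP x R5 R6" "R6 (d+8) = pfst a"
    using QP[of x R5] R f3[of "d+1"] by (auto simp: R5_def R2_def)
  have f6: "R6 r = R5 r" if "r < d+8" for r using calls_frame[OF R6(1)] that by auto
  define R7 where "R7 = R6(d+1 := R6 (d+8))"
  have f7: "R7 (d+1) = pfst a" "R7 (d+7) = Suc (psnd a)"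
    using f6 R6(2) R3(2) by (auto simp: R7_def R5_def)
  obtain R8 where R8: "calls (d+8) (pair_code (d+1) (d+7) (d+8)) x R7 R8"
      "R8 (d+8) = prod_encode (pfst a, Suc (psnd a))"
    using calls_pair_code[of "d+1" "d+8" "d+7" x R7] f7 by auto
  have f8: "R8 r = R7 r" if "r < d+8" for r using calls_frame[OF R8(1)] that by auto
  let ?R = "R8(d+1 := R8 (d+8), d+2 := R8 (d+4))"
  have vals: "R8 (d+4) = 1" "R8 (d+2) = 0" "R8 (d+1) = pfst a" "R7 (d+2) = 0" "R6 (d+2) = 0" "R6 (d+1) = a"
    "R5 (d+1) = a" "R5 (d+2) = 0" "R3 (d+1) = a" "R3 (d+2) = 0" "R2 (d+1) = a" "R2 (d+2) = 0"
    using f8 f6 f3 R f7 by (simp_all add: R7_def R5_def R2_def)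
  have c1: "wcall [Zero (d+2)] x R a 2 (R(d+2 := 0))" using wcall_set_mode(2)[of x R] R by simp
  have c2: "wcall [Transfer (d+1) (d+7)] x (R(d+2 := 0)) a 0 R2"
    using wcall_calls[OF calls_Transfer[of "d+7" "d+7" "d+1" x "R(d+2 := 0)"]] R by (simp add: R2_def)
  have c3: "wcall QS x R2 a 0 R3" using wcall_calls[OF R3(1)] vals by simp
  have c4: "wcall [Succ (d+7)] x R3 a 0 (R3(d+7 := Suc (R3 (d+7))))"
    using wcall_calls[OF calls_Succ[of "d+7" "d+7" x R3]] vals by simp
  have c5: "wcall [Transfer (d+1) (d+8)] x (R3(d+7 := Suc (R3 (d+7)))) a 0 R5"
    using wcall_calls[OF calls_Transfer[of "d+7" "d+8" "d+1" x "R3(d+7 := Suc (R3 (d+7)))"]] vals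
    by (simp add: R5_def)
  have c6: "wcall QP x R5 a 0 R6" using wcall_calls[OF calls_mono[OF R6(1)]] vals by simp
  have c7: "wcall [Transfer (d+8) (d+1)] x R6 a 0 R7"
    using wcall_set_node[of "d+8" x R6] vals by (simp add: R7_def)
  have c8: "wcall (pair_code (d+1) (d+7) (d+8)) x R7 (pfst a) 0 R8"
    using wcall_calls[OF calls_mono[OF R8(1)]] vals f7 by simp
  have c9: "wcall [Transfer (d+8) (d+1)] x R8 (pfst a) 0 (R8(d+1 := R8 (d+8)))"
    using wcall_set_node[of "d+8" x R8] vals by simp
  have c10: "wcall [Transfer (d+4) (d+2)] x (R8(d+1 := R8 (d+8))) (prod_encode (pfst a, Suc (psnd a))) 0 ?R"
    using wcall_set_mode(1)[of "d+4" x "R8(d+1 := R8 (d+8))"] vals R8(2) by simp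
  have "wcall step_code x R (pfst a) 0 ?R"
    using wcall_seqq[OF c1 wcall_seqq[OF c2 wcall_seqq[OF c3 wcall_seqq[OF c4 wcall_seqq[OF c5
      wcall_seqq[OF c6 wcall_seqq[OF c7 wcall_seqq[OF c8 wcall_seqq[OF c9 c10]]]]]]]]]
      pfst_le[of a] le_prod_encode[of "pfst a" "Suc (psnd a)"]
    by (simp add: step_code_def min.absorb1 min.absorb2)
  then have "wcall body x R (pfst a) 0 ?R"
    unfolding body_def back_code_def
    using R vals R8(2) assms(2) pfst_le[of a] le_prod_encode[of "pfst a" "Suc (psnd a)"]
    by (intro wcall_ite) auto
  then show ?thesis
    using ok_wcall[OF assms(1), of body x "pfst a" 0 ?R "prod_encode (pfst a, Suc (psnd a))" 1]
      vals R8(2) by auto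
qed

lemma body_exit_true:
  assumes "ok R0 n 0 0 R"
  shows "calls d body x R (R(d := 1, d+5 := 1))"
proof -
  note R = ok_simps[OF assms(1)]
  have "calls d ([Transfer (d+4) d] ;; [Transfer (d+4) (d+5)]) x R (R(d := 1, d+5 := 1))"
    using calls_seqq[of d "[Transfer (d+4) d]" x R "R(d := 1)" "[Transfer (d+4) (d+5)]"]
      calls_Transfer[of d d "d+4" x R] calls_Transfer[of d "d+5" "d+4" x "R(d := 1)"] R
    by simp
  then show ?thesis unfolding body_def lim_code_def using R by (intro calls_ite) auto
qed

lemma body_exit_false:
  assumes "ok R0 n 1 2 R"
  shows "calls d body x R (R(d := 0, d+5 := 1))"
proof -
  note R = ok_simps[OF assms(1)]
  have "calls d ([Zero d] ;; [Transfer (d+4) (d+5)]) x R (R(d := 0, d+5 := 1))"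
    using calls_seqq[of d "[Zero d]" x R "R(d := 0)" "[Transfer (d+4) (d+5)]"]
      calls_Zero[of d d x R] calls_Transfer[of d "d+5" "d+4" x "R(d := 0)"] R
    by simp
  then show ?thesis unfolding body_def back_code_def using R by (intro calls_ite) auto
qed

subsection \<open>The search loop\<close>

definition lseg where
  "lseg x R \<mu> R' \<longleftrightarrow> (\<forall>P l. placed P l (whil (d+5) (d+4) body) \<longrightarrow>
     pseg P x (case_nat l R) (case_nat l \<mu>) (case_nat l R'))"

lemma lseg_trans: "lseg x R \<mu> R' \<Longrightarrow> lseg x R' \<mu>' R'' \<Longrightarrow> lseg x R (\<lambda>r. min (\<mu> r) (\<mu>' r)) R''"
  unfolding lseg_def using pseg_trans[where l = l and l' = l for l] by fastforce

text \<open>The minimum \<open>k\<close> of the node register determines the node at a limit of such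
  transitions. That the mode has minimum 0 in each of them makes the mode 0 at the limit, by which
  the program recognises limits.\<close>

definition trans_rel where
  "trans_rel x R0 n a f k a' f' \<longleftrightarrow> (\<forall>R. ok R0 n a f R \<longrightarrow> (\<exists>R' \<mu>.
     lseg x R \<mu> R' \<and> ok R0 n a' f' R' \<and>
     \<mu> (d+1) = k \<and> \<mu> (d+2) = 0 \<and>
     (\<forall>r<d+7. r \<noteq> d+1 \<longrightarrow> r \<noteq> d+2 \<longrightarrow> \<mu> r = std R0 n 0 0 r)))"

lemma trans_rel_body:
  assumes "k \<le> a" "k \<le> a'"
    "\<And>R. ok R0 n a f R \<Longrightarrow> \<exists>R'. wcall body x R k 0 R' \<and> ok R0 n a' f' R'"
  shows "trans_rel x R0 n a f k a' f'"
  unfolding trans_rel_def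
proof (intro allI impI)
  fix R assume R: "ok R0 n a f R"
  obtain R' \<mu> where R': "ok R0 n a' f' R'" and e: "ecall body x R \<mu> R'" and m: "\<mu> (d+1) = k" "\<mu> (d+2) = 0"
     "\<forall>r<d+7. r \<noteq> d+1 \<longrightarrow> r \<noteq> d+2 \<longrightarrow> \<mu> r = R r \<and> R' r = R r"
    using assms(3)[OF R] unfolding wcall_def by blast
  have "R (d+5) \<noteq> R (d+4)" using ok_simps[OF R] by simp
  then have "lseg x R (\<lambda>r. min (R r) (min (\<mu> r) (R' r))) R'"
    unfolding lseg_def using pseg_whil_body e by blast
  then show "\<exists>R' \<mu>. lseg x R \<mu> R' \<and> ok R0 n a' f' R' \<and>
     \<mu> (d+1) = k \<and> \<mu> (d+2) = 0 \<and>
     (\<forall>r<d+7. r \<noteq> d+1 \<longrightarrow> r \<noteq> d+2 \<longrightarrow> \<mu> r = std R0 n 0 0 r)"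
    using R' m assms(1,2) ok_simps(2)[OF R] ok_simps(2)[OF R'] R
    by (intro exI conjI) (assumption, auto simp: ok_def std_def)
qed

lemma trans_rel_trans:
  assumes "trans_rel x R0 n a f k a' f'" "trans_rel x R0 n a' f' k' a'' f''"
  shows "trans_rel x R0 n a f (min k k') a'' f''"
  unfolding trans_rel_def
proof (intro allI impI)
  fix R assume "ok R0 n a f R"
  then obtain R' \<mu> where 1: "lseg x R \<mu> R'" "ok R0 n a' f' R'"
     "\<mu> (d+1) = k" "\<mu> (d+2) = 0" "\<forall>r<d+7. r \<noteq> d+1 \<longrightarrow> r \<noteq> d+2 \<longrightarrow> \<mu> r = std R0 n 0 0 r"
    using assms(1) unfolding trans_rel_def by blast
  then obtain R'' \<mu>' where 2: "lseg x R' \<mu>' R''" "ok R0 n a'' f'' R''"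
     "\<mu>' (d+1) = k'" "\<mu>' (d+2) = 0" "\<forall>r<d+7. r \<noteq> d+1 \<longrightarrow> r \<noteq> d+2 \<longrightarrow> \<mu>' r = std R0 n 0 0 r"
    using assms(2) unfolding trans_rel_def by blast
  show "\<exists>R' \<mu>. lseg x R \<mu> R' \<and> ok R0 n a'' f'' R' \<and>
     \<mu> (d+1) = min k k' \<and> \<mu> (d+2) = 0 \<and>
     (\<forall>r<d+7. r \<noteq> d+1 \<longrightarrow> r \<noteq> d+2 \<longrightarrow> \<mu> r = std R0 n 0 0 r)"
    using lseg_trans[OF 1(1) 2(1)] 1 2
    by (intro exI[of _ R''] exI[of _ "\<lambda>r. min (\<mu> r) (\<mu>' r)"]) auto
qed

lemma trans_rel_lim:
  assumes tr: "\<And>i. trans_rel x R0 n (a i) 1 (k i) (a (Suc i)) 1"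
    and k': "\<And>i. k' \<le> k i" "\<exists>i. k' = k i"
  shows "trans_rel x R0 n (a 0) 1 k' (lv {M. \<exists>i. \<forall>j\<ge>i. M \<le> k j}) 0"
  unfolding trans_rel_def
proof (intro allI impI)
  fix R assume R: "ok R0 n (a 0) 1 R"
  define nice where "nice i S S' \<mu> \<longleftrightarrow> lseg x S \<mu> S' \<and>
     \<mu> (d+1) = k i \<and> \<mu> (d+2) = 0 \<and> (\<forall>r<d+7. r \<noteq> d+1 \<longrightarrow> r \<noteq> d+2 \<longrightarrow> \<mu> r = std R0 n 0 0 r)" for i S S' \<mu>
  have "\<exists>S. \<forall>i. (ok R0 n (a i) 1 (S i) \<and> (i = 0 \<longrightarrow> S i = R)) \<and> (\<exists>\<mu>. nice i (S i) (S (Suc i)) \<mu>)"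
  proof (rule dependent_nat_choice)
    show "\<exists>S. ok R0 n (a 0) 1 S \<and> ((0::nat) = 0 \<longrightarrow> S = R)" using R by blast
  next
    fix S i assume "ok R0 n (a i) 1 S \<and> (i = 0 \<longrightarrow> S = R)"
    then have "ok R0 n (a i) 1 S" by blast
    from tr[of i, unfolded trans_rel_def, rule_format, OF this]
    obtain S' \<mu> where "ok R0 n (a (Suc i)) 1 S'" "nice i S S' \<mu>"
      unfolding nice_def by metis
    then show "\<exists>S'. (ok R0 n (a (Suc i)) 1 S' \<and> (Suc i = 0 \<longrightarrow> S' = R)) \<and> (\<exists>\<mu>. nice i S S' \<mu>)"
      by auto
  qed
  then obtain S \<mu> where S: "S 0 = R" and nice: "\<And>i. nice i (S i) (S (Suc i)) (\<mu> i)" by metis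
  have lseg: "lseg x (S i) (\<mu> i) (S (Suc i))"
    and m: "\<mu> i (d+1) = k i" "\<mu> i (d+2) = 0"
     "\<And>r. r < d+7 \<Longrightarrow> r \<noteq> d+1 \<Longrightarrow> r \<noteq> d+2 \<Longrightarrow> \<mu> i r = std R0 n 0 0 r" for i
    using nice[of i] unfolding nice_def by auto
  obtain \<mu>' where \<mu>': "ismin \<mu> UNIV \<mu>'" using ismin_ex by blast
  have min: "ismin (\<lambda>i. case_nat l (\<mu> i)) UNIV (case_nat l \<mu>')" for l
    using \<mu>' unfolding ismin_def by (auto split: nat.split)
  have lim: "limvec (\<lambda>i. case_nat l (\<mu> i)) = case_nat l (limvec \<mu>)" for l
    by (rule ext) (auto simp: limvec_def split: nat.split)
  have "lseg x R \<mu>' (limvec \<mu>)"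
    unfolding lseg_def
  proof (intro allI impI)
    fix P l assume "placed P l (whil (d+5) (d+4) body)"
    then have "pseg P x (case_nat l (S i)) (case_nat l (\<mu> i)) (case_nat l (S (Suc i)))" for i
      using lseg unfolding lseg_def by blast
    from gseg.lim[OF this min]
    show "pseg P x (case_nat l R) (case_nat l \<mu>') (case_nat l (limvec \<mu>))" unfolding lim S .
  qed
  moreover have "ok R0 n (lv {M. \<exists>i. \<forall>j\<ge>i. M \<le> k j}) 0 (limvec \<mu>)"
    unfolding ok_def
  proof (intro allI impI)
    fix r assume r: "r < d+7"
    consider "r = d+1" | "r = d+2" | "r \<noteq> d+1" "r \<noteq> d+2" by blast
    then show "limvec \<mu> r = std R0 n (lv {M. \<exists>i. \<forall>j\<ge>i. M \<le> k j}) 0 r"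
    proof cases
      case 1
      then show ?thesis by (simp add: limvec_def m(1)[simplified] std_def)
    next
      case 2
      have "{M. M \<le> (0::nat)} = {0}" by auto
      then show ?thesis using 2 lv_atMost[of 0] by (simp add: limvec_def m(2)[simplified] std_def)
    next
      case 3
      then show ?thesis using r lv_atMost by (auto simp: limvec_def m std_def)
    qed
  qed
  moreover have "\<mu>' (d+1) = k'" "\<mu>' (d+2) = 0"
    "\<forall>r<d+7. r \<noteq> d+1 \<longrightarrow> r \<noteq> d+2 \<longrightarrow> \<mu>' r = std R0 n 0 0 r"
    using \<mu>' k' unfolding ismin_def by (metis m(1) le_antisym UNIV_I, metis m(2) UNIV_I, metis m(3) UNIV_I)
  ultimately show "\<exists>R' \<mu>. lseg x R \<mu> R' \<and>
     ok R0 n (lv {M. \<exists>i. \<forall>j\<ge>i. M \<le> k j}) 0 R' \<and> \<mu> (d+1) = k' \<and> \<mu> (d+2) = 0 \<and>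
     (\<forall>r<d+7. r \<noteq> d+1 \<longrightarrow> r \<noteq> d+2 \<longrightarrow> \<mu> r = std R0 n 0 0 r)"
    by blast
qed

section \<open>The traversal of well-founded and of ill-founded trees\<close>

context
  fixes x :: "nat set" and R0 :: vec and n :: nat
begin

abbreviation (input) "tr \<equiv> trans_rel x R0 n"
abbreviation (input) "tree s \<equiv> T x (prod_encode (n, s))"

lemma tr_push: "tree s \<Longrightarrow> tr s 1 s (prod_encode (s, 0)) 1"
  by (rule trans_rel_body) (use body_enter_push le_prod_encode in auto)

lemma tr_fail: "\<not> tree s \<Longrightarrow> tr s 1 s s 2"
  by (rule trans_rel_body) (use body_enter_fail in auto)

lemma tr_limit: "s \<noteq> 0 \<Longrightarrow> tr s 0 s s 2"
  by (rule trans_rel_body) (use body_limit in auto)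

lemma tr_back: "0 < s \<Longrightarrow> tr (prod_encode (s, i)) 2 s (prod_encode (s, Suc i)) 1"
  using body_back[of R0 n "prod_encode (s, i)" _ x] less_prod_encode[of s i] le_prod_encode[of s]
  by (intro trans_rel_body) auto

lemma tr_siblings:
  assumes "0 < s" "tree s" "\<And>i. i < j \<Longrightarrow> tr (prod_encode (s, i)) 1 (prod_encode (s, i)) (prod_encode (s, i)) 2"
  shows "tr s 1 s (prod_encode (s, j)) 1"
  using assms(3)
proof (induction j)
  case 0
  then show ?case using tr_push assms by blast
next
  case (Suc j)
  show ?case
    using trans_rel_trans[OF trans_rel_trans[OF Suc.IH Suc.prems[of j]] tr_back[OF assms(1)]]
      Suc.prems le_prod_encode[of s j] by simp
qed

text \<open>Moving from one dead child to the next has minimum \<open>s\<close>, since a child's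
  subtree is searched above the code of the child and the change of sibling passes through
  \<open>s\<close>. The limit over all children is therefore node \<open>s\<close> in mode 0, and
  one more round sets mode 2.\<close>

lemma tr_dead: "dead tree s \<Longrightarrow> 0 < s \<Longrightarrow> tr s 1 s s 2"
proof (induction rule: dead.induct)
  case (leaf s)
  then show ?case using tr_fail by blast
next
  case (node s)
  have child: "tr (prod_encode (s, i)) 1 (prod_encode (s, i)) (prod_encode (s, i)) 2" for i
    using node less_prod_encode[of s i] by auto
  show ?case
  proof (cases "tree s")
    case True
    have "tr (prod_encode (s, i)) 1 s (prod_encode (s, Suc i)) 1" for i
      using trans_rel_trans[OF child[of i] tr_back[OF node.prems]] le_prod_encode[of s i] by simp
    from trans_rel_lim[of x R0 n "\<lambda>i. prod_encode (s, i)" "\<lambda>_. s" s, OF this]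
    have "tr (prod_encode (s, 0)) 1 s s 0" by simp
    from trans_rel_trans[OF trans_rel_trans[OF tr_push[OF True] this] tr_limit] node.prems
    show ?thesis by simp
  qed (use tr_fail in blast)
qed

lemma tr_not_dead:
  assumes "\<not> dead tree s" "0 < s"
  shows "\<exists>i. \<not> dead tree (prod_encode (s, i)) \<and> tr s 1 s (prod_encode (s, i)) 1"
proof -
  have t: "tree s" using assms(1) dead.leaf[of tree s] by blast
  define i where "i = (LEAST i. \<not> dead tree (prod_encode (s, i)))"
  have "\<exists>i. \<not> dead tree (prod_encode (s, i))" using assms(1) dead.node[of tree s] by blast
  then have "\<not> dead tree (prod_encode (s, i))" unfolding i_def by (rule LeastI_ex)
  moreover have "dead tree (prod_encode (s, j))" if "j < i" for j
    using that not_less_Least unfolding i_def by blast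
  then have "tr s 1 s (prod_encode (s, i)) 1"
    using tr_siblings[OF assms(2) t] tr_dead less_prod_encode[OF assms(2)] assms(2)
    by (meson order.strict_trans)
  ultimately show ?thesis by blast
qed

text \<open>The search descends from each node to its least child that is not dead. The nodes
  entered increase strictly and no transition falls below its start, so the limit inferior is
  infinite and is reset to node 0.\<close>

lemma tr_infinite:
  assumes "\<not> dead tree 1"
  shows "\<exists>k. tr 1 1 k 0 0"
proof -
  have "\<exists>a. \<forall>i. (\<not> dead tree (a i) \<and> 0 < a i \<and> (i = 0 \<longrightarrow> a i = 1)) \<and>
      (a i < a (Suc i) \<and> tr (a i) 1 (a i) (a (Suc i)) 1)"
  proof (rule dependent_nat_choice)
    show "\<exists>a. \<not> dead tree a \<and> 0 < a \<and> ((0::nat) = 0 \<longrightarrow> a = 1)" using assms by auto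
  next
    fix a and i :: nat assume "\<not> dead tree a \<and> 0 < a \<and> (i = 0 \<longrightarrow> a = 1)"
    then show "\<exists>b. (\<not> dead tree b \<and> 0 < b \<and> (Suc i = 0 \<longrightarrow> b = 1)) \<and> (a < b \<and> tr a 1 a b 1)"
      using tr_not_dead[of a] less_prod_encode[of a] by (metis nat.distinct(1) order.strict_trans)
  qed
  then obtain a where a: "a 0 = 1" "\<And>i. a i < a (Suc i)" "\<And>i. tr (a i) 1 (a i) (a (Suc i)) 1" by blast
  have mono: "strict_mono a" using a(2) by (simp add: strict_mono_Suc_iff)
  have "M \<le> a j" if "j \<ge> M" for M j
    using that strict_mono_imp_increasing[OF mono, of j] by simp
  then have "{M. \<exists>i. \<forall>j\<ge>i. M \<le> a j} = UNIV" by blast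
  then have "lv {M. \<exists>i. \<forall>j\<ge>i. M \<le> a j} = 0" by (simp add: lv_infinite)
  moreover have "a 0 \<le> a i" for i using mono by (simp add: strict_mono_less_eq)
  ultimately show ?thesis
    using trans_rel_lim[of x R0 n a a "a 0", OF a(3)] a(1) by metis
qed

end

definition search_code where
  "search_code = [Zero (d+1)] ;; [Succ (d+1)] ;; [Transfer (d+1) (d+2)] ;; [Zero (d+3)] ;;
     [Transfer (d+1) (d+4)] ;; [Zero (d+5)] ;; [Transfer (d+1) (d+6)] ;; [Succ (d+6)] ;;
     whil (d+5) (d+4) body"

lemma calls_search_code:
  "\<exists>R'. calls d search_code x R R' \<and> R' d = (if dead (\<lambda>s. T x (prod_encode (R d, s))) 1 then 0 else 1)"
proof -
  let ?n = "R d" and ?dead = "dead (\<lambda>s. T x (prod_encode (R d, s))) 1"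
  define R1 where "R1 = std R ?n 1 1"
  have ok1: "ok R ?n 1 1 R1" by (simp add: ok_def R1_def)
  have init: "calls d ([Zero (d+1)] ;; [Succ (d+1)] ;; [Transfer (d+1) (d+2)] ;; [Zero (d+3)] ;;
     [Transfer (d+1) (d+4)] ;; [Zero (d+5)] ;; [Transfer (d+1) (d+6)] ;; [Succ (d+6)]) x R R1"
  proof -
    let ?S = "R(d+1 := 1, d+2 := 1, d+3 := 0, d+4 := 1, d+5 := 0, d+6 := 1)"
    have "calls d [Zero (d+1)] x R (R(d+1 := 0))" by (rule calls_Zero) simp
    moreover have "calls d [Succ (d+1)] x (R(d+1 := 0)) (R(d+1 := 1))"
      using calls_Succ[of d "d+1" x "R(d+1 := 0)"] by simp
    moreover have "calls d [Transfer (d+1) (d+2)] x (R(d+1 := 1)) (R(d+1 := 1, d+2 := 1))"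
      using calls_Transfer[of d "d+2" "d+1" x "R(d+1 := 1)"] by simp
    moreover have "calls d [Zero (d+3)] x (R(d+1 := 1, d+2 := 1)) (R(d+1 := 1, d+2 := 1, d+3 := 0))"
      by (rule calls_Zero) simp
    moreover have "calls d [Transfer (d+1) (d+4)] x (R(d+1 := 1, d+2 := 1, d+3 := 0))
        (R(d+1 := 1, d+2 := 1, d+3 := 0, d+4 := 1))"
      using calls_Transfer[of d "d+4" "d+1" x "R(d+1 := 1, d+2 := 1, d+3 := 0)"] by simp
    moreover have "calls d [Zero (d+5)] x (R(d+1 := 1, d+2 := 1, d+3 := 0, d+4 := 1))
        (R(d+1 := 1, d+2 := 1, d+3 := 0, d+4 := 1, d+5 := 0))"
      by (rule calls_Zero) simp
    moreover have "calls d [Transfer (d+1) (d+6)] x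
        (R(d+1 := 1, d+2 := 1, d+3 := 0, d+4 := 1, d+5 := 0)) ?S"
      using calls_Transfer[of d "d+6" "d+1" x "R(d+1 := 1, d+2 := 1, d+3 := 0, d+4 := 1, d+5 := 0)"] by simp
    moreover have "calls d [Succ (d+6)] x ?S R1"
    proof -
      have "R1 = ?S(d+6 := Suc (?S (d+6)))" by (auto simp: R1_def std_def)
      then show ?thesis using calls_Succ[of d "d+6" x ?S] by simp
    qed
    ultimately show ?thesis by (intro calls_seqq)
  qed
  define a f where "a = (if ?dead then 1 else 0 :: nat)" and "f = (if ?dead then 2 else 0 :: nat)"
  define v where "v = (if ?dead then 0 else 1 :: nat)"
  have "\<exists>k. trans_rel x R ?n 1 1 k a f"
    using tr_dead[of x ?n 1 R] tr_infinite[of x ?n R] by (auto simp: a_def f_def)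
  then obtain R' \<mu> where R': "ok R ?n a f R'" and seg: "lseg x R1 \<mu> R'"
      and \<mu>: "\<forall>r<d+7. r \<noteq> d+1 \<longrightarrow> r \<noteq> d+2 \<longrightarrow> \<mu> r = std R ?n 0 0 r"
    using ok1 unfolding trans_rel_def by blast
  have fr: "R1 r = R r" "\<mu> r = R r" "R' r = R r" if "r < d" for r
    using that \<mu> ok_simps(8)[OF R'] by (auto simp: R1_def std_def)
  have body: "calls d body x R' (R'(d := v, d+5 := 1))"
    using R' body_exit_true[of R ?n R' x] body_exit_false[of R ?n R' x]
    by (cases ?dead) (auto simp: a_def f_def v_def)
  have loop: "calls d (whil (d+5) (d+4) body) x R' (R'(d := v, d+5 := 1))"
    using ok_simps[OF R'] by (intro calls_whil_step[OF _ body] calls_whil_done) auto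
  then obtain \<nu> where \<nu>: "ecall (whil (d+5) (d+4) body) x R' \<nu> (R'(d := v, d+5 := 1))" "\<forall>r<d. \<nu> r = R' r"
    unfolding calls_def by blast
  have "ecall (whil (d+5) (d+4) body) x R1 (\<lambda>r. min (\<mu> r) (\<nu> r)) (R'(d := v, d+5 := 1))"
    unfolding ecall_def
  proof (intro allI impI)
    fix P l assume pl: "placed P l (whil (d+5) (d+4) body)"
    have "pseg P x (case_nat l R1) (case_nat l \<mu>) (case_nat l R')"
      using seg pl unfolding lseg_def by blast
    moreover have "pseg P x (case_nat l R') (case_nat l \<nu>)
        (case_nat (l + length (whil (d+5) (d+4) body)) (R'(d := v, d+5 := 1)))"
      using \<nu>(1) pl unfolding ecall_def by blast
    ultimately show "pseg P x (case_nat l R1) (case_nat l (\<lambda>r. min (\<mu> r) (\<nu> r)))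
        (case_nat (l + length (whil (d+5) (d+4) body)) (R'(d := v, d+5 := 1)))"
      using pseg_trans by fastforce
  qed
  then have "calls d (whil (d+5) (d+4) body) x R1 (R'(d := v, d+5 := 1))"
    unfolding calls_def using fr \<nu>(2) by (intro exI conjI) (assumption, auto)
  from calls_seqq[OF init this] have "calls d search_code x R (R'(d := v, d+5 := 1))"
    by (simp add: search_code_def seqq_assoc)
  then show ?thesis by (intro exI) (auto simp: v_def)
qed

end

lemma itrm_dead:
  assumes "itrm_fn (\<lambda>x n. if T x n then 1 else 0)"
  shows "itrm_fn (\<lambda>x n. if dead (\<lambda>s. T x (prod_encode (n, s))) 1 then 0 else 1)"
proof (rule itrm_fnI)
  fix d
  obtain QT where QT: "\<And>x R. \<exists>R'. calls (d+7) QT x R R' \<and> R' (d+7) = (if T x (R (d+7)) then 1 else 0)"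
    using assms itrm_fnE by blast
  obtain QS where QS: "\<And>x R. \<exists>R'. calls (d+7) QS x R R' \<and> R' (d+7) = psnd (R (d+7))"
    using itrm_psnd' itrm_fnE by blast
  obtain QP where QP: "\<And>x R. \<exists>R'. calls (d+8) QP x R R' \<and> R' (d+8) = pfst (R (d+8))"
    using itrm_pfst' itrm_fnE by blast
  interpret dfs d QT QS QP T by unfold_locales (rule QT QS QP)+
  show "\<exists>Q. \<forall>x R. \<exists>R'. calls d Q x R R' \<and>
      R' d = (if dead (\<lambda>s. T x (prod_encode (R d, s))) 1 then 0 else 1)"
    using calls_search_code by blast
qed

section \<open>Classes of relations closed under tree search\<close>

definition dec :: "(nat set \<Rightarrow> nat \<Rightarrow> bool) \<Rightarrow> bool" where
  "dec R \<longleftrightarrow> itrm_fn (\<lambda>x n. if R x n then 1 else 0)"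

lemmas itrm_intros = itrm_id itrm_const itrm_Suc itrm_pair itrm_pfst itrm_psnd

lemma dec_eq: "itrm_fn F \<Longrightarrow> itrm_fn G \<Longrightarrow> dec (\<lambda>x n. F x n = G x n)"
  unfolding dec_def by (intro itrm_if_eq itrm_intros)

lemma dec_not: "dec R \<Longrightarrow> dec (\<lambda>x n. \<not> R x n)"
proof -
  assume a: "dec R"
  have "(\<lambda>x n. if \<not> R x n then 1 else 0 :: nat) =
     (\<lambda>x n. if (if R x n then 1 else 0) = (1::nat) then 0 else 1)"
    by (auto simp: fun_eq_iff)
  then show ?thesis
    using itrm_if_eq[of "\<lambda>x n. if R x n then 1 else 0" "\<lambda>_ _. 1" "\<lambda>_ _. 0" "\<lambda>_ _. 1"] a
    by (simp add: itrm_intros dec_def)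
qed

lemma dec_conj: "dec R \<Longrightarrow> dec S \<Longrightarrow> dec (\<lambda>x n. R x n \<and> S x n)"
proof -
  assume a: "dec R" "dec S"
  have "(\<lambda>x n. if R x n \<and> S x n then 1 else 0 :: nat) =
     (\<lambda>x n. if (if R x n then 1 else 0) = (1::nat) then (if S x n then 1 else 0) else 0)"
    by (auto simp: fun_eq_iff)
  then show ?thesis
    using itrm_if_eq[of "\<lambda>x n. if R x n then 1 else 0" "\<lambda>_ _. 1" "\<lambda>x n. if S x n then 1 else 0" "\<lambda>_ _. 0"] a
    by (simp add: itrm_intros dec_def)
qed

lemma dec_comp: "dec R \<Longrightarrow> itrm_fn F \<Longrightarrow> dec (\<lambda>x n. R x (F x n))"
  unfolding dec_def by (rule itrm_comp)

lemma dec_query: "itrm_fn F \<Longrightarrow> dec (\<lambda>x n. F x n \<in> x)"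
  using itrm_comp[OF itrm_query] unfolding dec_def by blast

lemma not_if: "(if \<not> P then a else b) = (if P then b else a)"
  by simp

lemma dec_dead: "dec Q \<Longrightarrow> dec (\<lambda>x n. dead (\<lambda>s. Q x (prod_encode (n, s))) 1)"
proof -
  assume "dec Q"
  then have "dec (\<lambda>x n. \<not> dead (\<lambda>s. Q x (prod_encode (n, s))) 1)"
    unfolding dec_def not_if using itrm_dead[of Q] by simp
  from dec_not[OF this] show ?thesis by simp
qed

subsection \<open>Branches\<close>

primrec branch :: "(nat \<Rightarrow> nat) \<Rightarrow> nat \<Rightarrow> nat" where
  "branch f 0 = 1"
| "branch f (Suc k) = prod_encode (branch f k, f k)"

lemma branch_pos: "0 < branch f k"
  by (induction k) (auto intro: order_less_trans[OF _ less_prod_encode])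

lemma branch_eq_1_iff [simp]: "branch f k = Suc 0 \<longleftrightarrow> k = 0"
proof (cases k)
  case (Suc j)
  then show ?thesis using less_prod_encode[OF branch_pos[of f j], of "f j"] branch_pos[of f j] by simp
qed simp

lemma pfst_0 [simp]: "pfst 0 = 0" and pfst_1 [simp]: "pfst (Suc 0) = 0"
proof -
  have "prod_encode (0, 0) = 0" "prod_encode (0, 1) = 1" by (simp_all add: prod_encode_def)
  then show "pfst 0 = 0" "pfst (Suc 0) = 0" by (metis pair_simps(1), metis One_nat_def pair_simps(1))
qed

lemma pfst_funpow_0 [simp]: "(pfst ^^ i) 0 = 0"
  by (induction i) auto

lemma pfst_funpow_branch: "(pfst ^^ i) (branch f k) = (if i \<le> k then branch f (k - i) else 0)"
proof (induction k arbitrary: i)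
  case 0
  show ?case by (cases i) (auto simp: funpow_swap1)
next
  case (Suc k)
  show ?case using Suc by (cases i) (auto simp: funpow_swap1)
qed

text \<open>Positions count from the root, but codes are taken apart from the last entry. After
  removal of the last \<open>i\<close> entries, entry \<open>j\<close> is on top exactly if removing
  \<open>Suc j\<close> more ends at the root 1. This identifies \<open>i\<close>, because
  \<open>pfst\<close> sends 1 and 0 to 0, so that 1 is not met again.\<close>

definition entry :: "nat \<Rightarrow> nat \<Rightarrow> nat \<Rightarrow> bool" where
  "entry s j y \<longleftrightarrow> (\<exists>i. (pfst ^^ Suc j) ((pfst ^^ i) s) = 1 \<and> psnd ((pfst ^^ i) s) = y)"

lemma entry_branch: "entry (branch f k) j y \<longleftrightarrow> j < k \<and> y = f j"
proof -
  have "(pfst ^^ Suc j) ((pfst ^^ i) (branch f k)) = 1 \<longleftrightarrow> k = i + Suc j" for i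
  proof -
    have "(pfst ^^ Suc j) ((pfst ^^ i) (branch f k)) = (pfst ^^ (Suc j + i)) (branch f k)"
      by (simp add: funpow_add)
    then show ?thesis unfolding pfst_funpow_branch by auto
  qed
  moreover have "psnd ((pfst ^^ i) (branch f (i + Suc j))) = f j" for i
    unfolding pfst_funpow_branch by simp
  ultimately show ?thesis
    unfolding entry_def by (metis add.commute less_iff_Suc_add add_Suc add_Suc_right)
qed

lemma dead_iff_no_branch: "dead T 1 \<longleftrightarrow> \<not> (\<exists>f. \<forall>k. T (branch f k))"
proof
  have "dead T s \<Longrightarrow> \<forall>k. T (branch f k) \<Longrightarrow> s \<noteq> branch f k" for f s k
    by (induction arbitrary: k rule: dead.induct) (auto, metis branch.simps(2))
  then show "dead T 1 \<Longrightarrow> \<not> (\<exists>f. \<forall>k. T (branch f k))" by (metis branch.simps(1))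
next
  assume no: "\<not> (\<exists>f. \<forall>k. T (branch f k))"
  show "dead T 1"
  proof (rule ccontr)
    assume nd: "\<not> dead T 1"
    have "\<exists>a. \<forall>i. (\<not> dead T (a i) \<and> (i = 0 \<longrightarrow> a i = 1)) \<and> (\<exists>y. a (Suc i) = prod_encode (a i, y))"
    proof (rule dependent_nat_choice)
      show "\<exists>a. \<not> dead T a \<and> ((0::nat) = 0 \<longrightarrow> a = 1)" using nd by auto
    next
      fix a and i :: nat assume "\<not> dead T a \<and> (i = 0 \<longrightarrow> a = 1)"
      then have "\<exists>y. \<not> dead T (prod_encode (a, y))" using dead.node[of T a] by blast
      then show "\<exists>b. (\<not> dead T b \<and> (Suc i = 0 \<longrightarrow> b = 1)) \<and> (\<exists>y. b = prod_encode (a, y))" by auto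
    qed
    then obtain a where a: "a 0 = 1" "\<And>i. \<not> dead T (a i)" "\<And>i. \<exists>y. a (Suc i) = prod_encode (a i, y)" by blast
    then obtain f where f: "\<And>i. a (Suc i) = prod_encode (a i, f i)" by metis
    have "a i = branch f i" for i by (induction i) (auto simp: a f)
    moreover have "T (a i)" for i using a(2)[of i] dead.leaf[of T "a i"] by blast
    ultimately show False using no by metis
  qed
qed

subsection \<open>Inductive definitions\<close>

text \<open>Here \<open>a\<close> names a rule with conclusion \<open>t\<close> and \<open>i\<close>
  one of its premises; \<open>N t a i\<close> says that this premise is void, and
  \<open>G t a i b\<close> that \<open>b\<close> may fulfil it. An inductive definition with
  infinitely many premises is thus given by two relations on numbers.\<close>

inductive ind :: "(nat \<Rightarrow> nat \<Rightarrow> nat \<Rightarrow> bool) \<Rightarrow> (nat \<Rightarrow> nat \<Rightarrow> nat \<Rightarrow> nat \<Rightarrow> bool) \<Rightarrow> nat \<Rightarrow> bool"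
  for N G where
  rule: "(\<And>i. N t a i \<or> (\<exists>b. G t a i b \<and> ind N G b)) \<Longrightarrow> ind N G t"

text \<open>
  A branch codes a set \<open>X\<close> closed under the rules and avoiding \<open>t0\<close> (position \<open>(0, t)\<close>), together
  with a choice of a failing premise for each rule whose conclusion is not in \<open>X\<close> (position
  \<open>(1, (t, a))\<close>).
\<close>

definition ind_cond :: "(nat \<Rightarrow> nat \<Rightarrow> nat \<Rightarrow> bool) \<Rightarrow> (nat \<Rightarrow> nat \<Rightarrow> nat \<Rightarrow> nat \<Rightarrow> bool) \<Rightarrow> nat \<Rightarrow> nat \<Rightarrow> bool" where
  "ind_cond N G t0 s \<longleftrightarrow> (\<forall>y. entry s (prod_encode (0, t0)) y \<longrightarrow> y = 0) \<and>
     (\<forall>t a i. entry s (prod_encode (0, t)) 0 \<and> entry s (prod_encode (1, prod_encode (t, a))) i \<longrightarrow>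
        \<not> N t a i \<and> (\<forall>b y. G t a i b \<and> entry s (prod_encode (0, b)) y \<longrightarrow> y = 0))"

lemma ind_iff_dead: "ind N G t0 \<longleftrightarrow> dead (ind_cond N G t0) 1"
proof -
  have "(\<exists>f. \<forall>k. ind_cond N G t0 (branch f k)) \<longleftrightarrow> \<not> ind N G t0"
  proof
    assume "\<exists>f. \<forall>k. ind_cond N G t0 (branch f k)"
    then obtain f where f: "\<And>k. ind_cond N G t0 (branch f k)" by blast
    have "ind N G t \<Longrightarrow> f (prod_encode (0, t)) \<noteq> 0" for t
    proof (induction rule: ind.induct)
      case (rule t a)
      show ?case
      proof
        assume z: "f (prod_encode (0, t)) = 0"
        let ?i = "f (prod_encode (1, prod_encode (t, a)))"
        have c: "\<not> N t a ?i" "\<And>b. G t a ?i b \<Longrightarrow> f (prod_encode (0, b)) = 0"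
        proof -
          have "\<not> N t a ?i \<and> (G t a ?i b \<longrightarrow> f (prod_encode (0, b)) = 0)" for b
          proof -
            \<comment> \<open>The initial segment of this length contains all three positions that
              the condition relates.\<close>
            let ?k = "Suc (prod_encode (0, t) + prod_encode (1, prod_encode (t, a)) + prod_encode (0, b))"
            have "entry (branch f ?k) (prod_encode (0, t)) 0"
              "entry (branch f ?k) (prod_encode (1, prod_encode (t, a))) ?i"
              "entry (branch f ?k) (prod_encode (0, b)) (f (prod_encode (0, b)))"
              unfolding entry_branch using z by simp_all
            then show ?thesis
              using f[of ?k, unfolded ind_cond_def, THEN conjunct2, THEN spec[of _ t], THEN spec[of _ a],
                  THEN spec[of _ ?i], THEN mp] by blast
          qed
          then show "\<not> N t a ?i" "\<And>b. G t a ?i b \<Longrightarrow> f (prod_encode (0, b)) = 0" by simp_all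
        qed
        from rule[of ?i] c(1) obtain b where "G t a ?i b" "f (prod_encode (0, b)) \<noteq> 0" by auto
        with c(2) show False by simp
      qed
    qed
    moreover have "f (prod_encode (0, t0)) = 0"
      using f[of "Suc (prod_encode (0, t0))"] unfolding ind_cond_def entry_branch by blast
    ultimately show "\<not> ind N G t0" by blast
  next
    assume t0: "\<not> ind N G t0"
    define h where "h t a = (SOME i. \<not> N t a i \<and> (\<forall>b. G t a i b \<longrightarrow> \<not> ind N G b))" for t a
    have h: "\<not> N t a (h t a) \<and> (\<forall>b. G t a (h t a) b \<longrightarrow> \<not> ind N G b)" if "\<not> ind N G t" for t a
      unfolding h_def by (rule someI_ex) (use that ind.rule[of N t a G] in blast)
    define f where "f p = (if pfst p = 0 then (if ind N G (psnd p) then 1 else 0)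
       else h (pfst (psnd p)) (psnd (psnd p)))" for p
    have "ind_cond N G t0 (branch f k)" for k
      unfolding ind_cond_def entry_branch f_def using t0 h by auto
    then show "\<exists>f. \<forall>k. ind_cond N G t0 (branch f k)" by blast
  qed
  then show ?thesis unfolding dead_iff_no_branch by blast
qed

subsection \<open>Closure properties\<close>

text \<open>Instantiated with \<open>dec\<close>, which makes forcing relations and dense sets
  computable, and with \<open>tame\<close>, which provides forcing for relations about the oracle.
  Base relations and substituted functions are free of the oracle; it enters through
  \<open>dec_query\<close> and \<open>tame_query\<close>.\<close>

locale tree_class =
  fixes K :: "(nat set \<Rightarrow> nat \<Rightarrow> bool) \<Rightarrow> bool"
  assumes K_dec: "\<And>R. dec (\<lambda>x. R) \<Longrightarrow> K (\<lambda>x. R)"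
    and K_not: "\<And>R. K R \<Longrightarrow> K (\<lambda>x n. \<not> R x n)"
    and K_conj: "\<And>R S. K R \<Longrightarrow> K S \<Longrightarrow> K (\<lambda>x n. R x n \<and> S x n)"
    and K_comp: "\<And>R F. K R \<Longrightarrow> itrm_fn (\<lambda>x. F) \<Longrightarrow> K (\<lambda>x n. R x (F n))"
    and K_dead: "\<And>Q. K Q \<Longrightarrow> K (\<lambda>x n. dead (\<lambda>s. Q x (prod_encode (n, s))) 1)"
begin

lemma K_eq: "itrm_fn (\<lambda>x. F) \<Longrightarrow> itrm_fn (\<lambda>x. G) \<Longrightarrow> K (\<lambda>x n. F n = G n)"
  by (rule K_dec) (rule dec_eq)

lemma K_disj: "K R \<Longrightarrow> K S \<Longrightarrow> K (\<lambda>x n. R x n \<or> S x n)"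
  using K_not[OF K_conj[OF K_not[of R] K_not[of S]]] by simp

lemma K_imp: "K R \<Longrightarrow> K S \<Longrightarrow> K (\<lambda>x n. R x n \<longrightarrow> S x n)"
  unfolding imp_conv_disj by (intro K_disj K_not)

lemma K_comp2:
  assumes "K (\<lambda>x n. R x (pfst n) (psnd n))" "itrm_fn (\<lambda>x. A)" "itrm_fn (\<lambda>x. B)"
  shows "K (\<lambda>x n. R x (A n) (B n))"
  using K_comp[OF assms(1) itrm_pair[OF assms(2,3)]] by simp

lemma K_comp3:
  assumes "K (\<lambda>x n. R x (pfst n) (pfst (psnd n)) (psnd (psnd n)))"
    "itrm_fn (\<lambda>x. A)" "itrm_fn (\<lambda>x. B)" "itrm_fn (\<lambda>x. C)"
  shows "K (\<lambda>x n. R x (A n) (B n) (C n))"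
  using K_comp[OF assms(1) itrm_pair[OF assms(2) itrm_pair[OF assms(3,4)]]] by simp

lemma K_comp4:
  assumes "K (\<lambda>x n. R x (pfst n) (pfst (psnd n)) (pfst (psnd (psnd n))) (psnd (psnd (psnd n))))"
    "itrm_fn (\<lambda>x. A)" "itrm_fn (\<lambda>x. B)" "itrm_fn (\<lambda>x. C)" "itrm_fn (\<lambda>x. D)"
  shows "K (\<lambda>x n. R x (A n) (B n) (C n) (D n))"
  using K_comp[OF assms(1) itrm_pair[OF assms(2) itrm_pair[OF assms(3) itrm_pair[OF assms(4,5)]]]] by simp

lemma K_ex:
  assumes "K (\<lambda>x n. R x (pfst n) (psnd n))"
  shows "K (\<lambda>x n. \<exists>m. R x n m)"
proof -
  define T where "T x n s \<longleftrightarrow> (pfst s = 1 \<longrightarrow> R x n (psnd s))" for x n s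
  have "dead (T x n) 1 \<longleftrightarrow> \<not> (\<exists>m. R x n m)" for x n
  proof
    assume d: "dead (T x n) 1"
    show "\<not> (\<exists>m. R x n m)"
    proof
      assume "\<exists>m. R x n m"
      then obtain m where m: "R x n m" by blast
      \<comment> \<open>None of the listed nodes is a leaf and each has a listed child: the root has
        \<open>prod_encode (1, m)\<close>, and any other one has its child number 0, which lies
        below the first level.\<close>
      have "dead (T x n) s \<Longrightarrow> \<not> (s = 1 \<or> s = prod_encode (1, m) \<or> (pfst s \<noteq> 1 \<and> s \<noteq> 1 \<and> 0 < s))" for s
      proof (induction rule: dead.induct)
        case (leaf s)
        then show ?case using m by (auto simp: T_def)
      next
        case (node s)
        show ?case
        proof
          assume s: "s = 1 \<or> s = prod_encode (1, m) \<or> (pfst s \<noteq> 1 \<and> s \<noteq> 1 \<and> 0 < s)"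
          show False
          proof (cases "s = 1")
            case True
            then show False using node[of m] by blast
          next
            case False
            then have "0 < s" using s less_prod_encode[of 1 m] by auto
            then have "s < prod_encode (s, 0)" by (rule less_prod_encode)
            then show False using node[of 0] False \<open>0 < s\<close> by auto
          qed
        qed
      qed
      then show False using d by blast
    qed
  next
    assume "\<not> (\<exists>m. R x n m)"
    then have "dead (T x n) (prod_encode (1, i))" for i by (intro dead.leaf) (simp add: T_def)
    then show "dead (T x n) 1" by (rule dead.node)
  qed
  moreover have "K (\<lambda>x k. T x (pfst k) (psnd k))"
    unfolding T_def by (intro K_imp K_eq K_comp2[OF assms] itrm_intros)
  from K_not[OF K_dead[OF this]] have "K (\<lambda>x n. \<not> dead (T x n) 1)" by simp
  ultimately show ?thesis by simp
qed

lemma K_all: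
  assumes "K (\<lambda>x n. R x (pfst n) (psnd n))"
  shows "K (\<lambda>x n. \<forall>m. R x n m)"
  using K_not[OF K_ex[OF K_not[OF assms]]] by simp

lemmas K_intros = K_all K_ex K_imp K_disj K_conj K_not K_eq

lemma K_entry:
  assumes "itrm_fn (\<lambda>x. A)" "itrm_fn (\<lambda>x. B)" "itrm_fn (\<lambda>x. C)"
  shows "K (\<lambda>x n. entry (A n) (B n) (C n))"
proof (rule K_comp3[OF _ assms])
  show "K (\<lambda>x n. entry (pfst n) (pfst (psnd n)) (psnd (psnd n)))"
    unfolding entry_def
    by (intro K_intros itrm_iterate itrm_intros)
qed

lemma K_ind:
  assumes N: "K (\<lambda>x n. N x (pfst n) (pfst (psnd n)) (psnd (psnd n)))"
    and G: "K (\<lambda>x n. G x (pfst n) (pfst (psnd n)) (pfst (psnd (psnd n))) (psnd (psnd (psnd n))))"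
  shows "K (\<lambda>x n. ind (N x) (G x) n)"
proof -
  have "K (\<lambda>x n. ind_cond (N x) (G x) (pfst n) (psnd n))"
    unfolding ind_cond_def
    by (intro K_intros K_entry K_comp3[OF N] K_comp4[OF G] itrm_intros)
  from K_dead[OF this] show ?thesis by (simp add: ind_iff_dead)
qed

lemma K_le:
  assumes "itrm_fn (\<lambda>x. A)" "itrm_fn (\<lambda>x. B)"
  shows "K (\<lambda>x n. A n \<le> B n)"
proof -
  have "K (\<lambda>x n. \<exists>i. (Suc ^^ i) (pfst n) = psnd n)"
    by (intro K_intros itrm_iterate itrm_intros)
  moreover have "(\<exists>i. (Suc ^^ i) a = b) \<longleftrightarrow> a \<le> b" for a b :: nat
    by (auto simp: le_iff_add add.commute)
  ultimately show ?thesis using K_comp2[of "\<lambda>x a b. a \<le> b" A B] assms by simp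
qed

end

interpretation dec: tree_class dec
  by unfold_locales (assumption | intro dec_not dec_conj dec_dead | rule dec_comp)+

subsection \<open>Stages of an inductive definition\<close>

definition stg :: "(nat \<Rightarrow> nat \<Rightarrow> nat \<Rightarrow> bool) \<Rightarrow> (nat \<Rightarrow> nat \<Rightarrow> nat \<Rightarrow> nat \<Rightarrow> bool) \<Rightarrow> om1 \<Rightarrow> nat set" where
  "stg N G = wfrec {(s, t). s < t} (\<lambda>f \<alpha>.
     {t. \<exists>a. \<forall>i. N t a i \<or> (\<exists>b. G t a i b \<and> (\<exists>\<beta><\<alpha>. b \<in> f \<beta>))})"

lemma stg_unfold:
  "stg N G \<alpha> = {t. \<exists>a. \<forall>i. N t a i \<or> (\<exists>b. G t a i b \<and> (\<exists>\<beta><\<alpha>. b \<in> stg N G \<beta>))}"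
  unfolding stg_def by (subst wfrec[OF wf]) (simp add: cut_def cong: conj_cong)

lemma stg_mono: "\<alpha> \<le> \<beta> \<Longrightarrow> stg N G \<alpha> \<subseteq> stg N G \<beta>"
  unfolding stg_unfold[of N G \<alpha>] stg_unfold[of N G \<beta>] by (auto, meson order.strict_trans2)

lemma stg_imp_ind: "t \<in> stg N G \<alpha> \<Longrightarrow> ind N G t"
proof (induction \<alpha> arbitrary: t rule: less_induct)
  case (less \<alpha>)
  then obtain a where "\<forall>i. N t a i \<or> (\<exists>b. G t a i b \<and> (\<exists>\<beta><\<alpha>. b \<in> stg N G \<beta>))"
    by (subst (asm) (2) stg_unfold) blast
  then show ?case using less.IH by (intro ind.rule[of N t a G]) blast
qed

lemma ind_imp_stg: "ind N G t \<Longrightarrow> \<exists>\<alpha>. t \<in> stg N G \<alpha>"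
proof (induction rule: ind.induct)
  case (rule t a)
  then have "\<forall>i. \<exists>\<alpha>. N t a i \<or> (\<exists>b. G t a i b \<and> b \<in> stg N G \<alpha>)" by blast
  then obtain A where A: "\<And>i. N t a i \<or> (\<exists>b. G t a i b \<and> b \<in> stg N G (A i))" by metis
  obtain \<gamma> where "\<And>\<beta>. \<beta> \<in> range A \<Longrightarrow> \<beta> < \<gamma>"
    using countable_bounded_om1[of "range A"] by (metis countableI_type countable_image)
  then have "t \<in> stg N G \<gamma>" using A by (subst stg_unfold) blast
  then show ?case by blast
qed

definition rk :: "(nat \<Rightarrow> nat \<Rightarrow> nat \<Rightarrow> bool) \<Rightarrow> (nat \<Rightarrow> nat \<Rightarrow> nat \<Rightarrow> nat \<Rightarrow> bool) \<Rightarrow> nat \<Rightarrow> om1" where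
  "rk N G t = (LEAST \<alpha>. t \<in> stg N G \<alpha>)"

lemma stg_iff: "t \<in> stg N G \<alpha> \<longleftrightarrow> ind N G t \<and> rk N G t \<le> \<alpha>"
proof
  assume "t \<in> stg N G \<alpha>"
  then show "ind N G t \<and> rk N G t \<le> \<alpha>" unfolding rk_def by (auto intro: stg_imp_ind Least_le)
next
  assume "ind N G t \<and> rk N G t \<le> \<alpha>"
  moreover from this have "t \<in> stg N G (rk N G t)"
    unfolding rk_def using ind_imp_stg by (metis LeastI)
  ultimately show "t \<in> stg N G \<alpha>" using stg_mono by blast
qed

lemma ind_rk:
  assumes "ind N G t"
  shows "\<exists>a. \<forall>i. N t a i \<or> (\<exists>b. G t a i b \<and> ind N G b \<and> rk N G b < rk N G t)"
proof -
  have "t \<in> stg N G (rk N G t)" using assms by (simp add: stg_iff)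
  then show ?thesis by (subst (asm) stg_unfold) (auto simp: stg_iff, meson order.strict_trans1)
qed

lemma not_stg_rule:
  assumes "t \<notin> stg N G \<alpha>"
  shows "\<exists>i. \<not> N t a i \<and> (\<forall>b. G t a i b \<longrightarrow> (\<forall>\<beta><\<alpha>. b \<notin> stg N G \<beta>))"
  using assms by (subst (asm) stg_unfold) blast

text \<open>
  Comparison of stages as an inductive definition: tag \<open>0\<close> is \<open>rk u < rk t\<close>, tag \<open>2\<close> is
  \<open>rk u \<le> rk b\<close>, and tag \<open>1\<close> says that the rule \<open>a\<close> does not put \<open>t\<close> into the stage \<open>rk u\<close>.
\<close>

definition cmpN :: "(nat \<Rightarrow> nat \<Rightarrow> nat \<Rightarrow> bool) \<Rightarrow> (nat \<Rightarrow> nat \<Rightarrow> nat \<Rightarrow> nat \<Rightarrow> bool) \<Rightarrow> nat \<Rightarrow> nat \<Rightarrow> nat \<Rightarrow> bool" where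
  "cmpN N G z \<alpha> i \<longleftrightarrow>
     (pfst z = 1 \<and> \<not> N (psnd (pfst (psnd z))) (psnd (psnd z)) \<alpha> \<and>
        \<not> G (psnd (pfst (psnd z))) (psnd (psnd z)) \<alpha> i) \<or>
     (pfst z = 2 \<and> N (pfst (psnd z)) \<alpha> i)"

definition cmpG :: "(nat \<Rightarrow> nat \<Rightarrow> nat \<Rightarrow> bool) \<Rightarrow> (nat \<Rightarrow> nat \<Rightarrow> nat \<Rightarrow> nat \<Rightarrow> bool) \<Rightarrow> nat \<Rightarrow> nat \<Rightarrow> nat \<Rightarrow> nat \<Rightarrow> bool" where
  "cmpG N G z \<alpha> i w \<longleftrightarrow>
     (pfst z = 0 \<and> ind N G (pfst (psnd z)) \<and> w = prod_encode (1, prod_encode (psnd z, i))) \<or>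
     (pfst z = 1 \<and> \<not> N (psnd (pfst (psnd z))) (psnd (psnd z)) \<alpha> \<and>
        w = prod_encode (2, prod_encode (pfst (pfst (psnd z)), i))) \<or>
     (pfst z = 2 \<and> (\<exists>b. G (pfst (psnd z)) \<alpha> i b \<and> w = prod_encode (0, prod_encode (b, psnd (psnd z)))))"

text \<open>\<open>u\<close> belongs to the inductive set and enters it at a strictly earlier stage
  than \<open>t\<close>, where \<open>t\<close> may fail to enter at all.\<close>

definition ind_less where
  "ind_less N G u t \<longleftrightarrow> ind (cmpN N G) (cmpG N G) (prod_encode (0, prod_encode (u, t)))"

lemma cmp_sound:
  assumes "ind (cmpN N G) (cmpG N G) z"
  shows "(pfst z = 0 \<longrightarrow> ind N G (pfst (psnd z)) \<and> psnd (psnd z) \<notin> stg N G (rk N G (pfst (psnd z)))) \<and>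
    (pfst z = 1 \<longrightarrow> (\<exists>i. \<not> N (psnd (pfst (psnd z))) (psnd (psnd z)) i \<and>
       (\<forall>b. G (psnd (pfst (psnd z))) (psnd (psnd z)) i b \<longrightarrow>
         (\<forall>\<beta>. b \<in> stg N G \<beta> \<longrightarrow> pfst (pfst (psnd z)) \<in> stg N G \<beta>)))) \<and>
    (pfst z = 2 \<longrightarrow> (\<forall>\<beta>. psnd (psnd z) \<in> stg N G \<beta> \<longrightarrow> pfst (psnd z) \<in> stg N G \<beta>))"
  using assms
proof (induction rule: ind.induct)
  case (rule z \<alpha>)
  consider "pfst z = 0" | "pfst z = 1" | "pfst z = 2" | "pfst z \<notin> {0, 1, 2}" by auto
  then show ?case
  proof cases
    case 1
    let ?u = "pfst (psnd z)" and ?t = "psnd (psnd z)"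
    have u: "ind N G ?u" using rule[of 0] 1 by (auto simp: cmpN_def cmpG_def)
    have a: "\<exists>i. \<not> N ?t a i \<and> (\<forall>b. G ?t a i b \<longrightarrow> (\<forall>\<beta>. b \<in> stg N G \<beta> \<longrightarrow> ?u \<in> stg N G \<beta>))" for a
      using rule[of a] 1 by (auto simp: cmpN_def cmpG_def)
    have "?t \<notin> stg N G (rk N G ?u)"
    proof
      assume "?t \<in> stg N G (rk N G ?u)"
      then obtain a where "\<forall>i. N ?t a i \<or> (\<exists>b. G ?t a i b \<and> (\<exists>\<beta><rk N G ?u. b \<in> stg N G \<beta>))"
        by (subst (asm) stg_unfold) blast
      with a[of a] obtain \<beta> where "\<beta> < rk N G ?u" "?u \<in> stg N G \<beta>" by blast
      then show False by (auto simp: stg_iff)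
    qed
    then show ?thesis using u 1 by simp
  next
    case 2
    let ?u = "pfst (pfst (psnd z))" and ?t = "psnd (pfst (psnd z))" and ?a = "psnd (psnd z)"
    have i: "\<not> N ?t ?a \<alpha>" using rule[of 0] 2 by (auto simp: cmpN_def cmpG_def)
    have "\<forall>\<beta>. b \<in> stg N G \<beta> \<longrightarrow> ?u \<in> stg N G \<beta>" if "G ?t ?a \<alpha> b" for b
      using rule[of b] 2 that by (auto simp: cmpN_def cmpG_def)
    then show ?thesis using 2 i by auto
  next
    case 3
    let ?u = "pfst (psnd z)" and ?b = "psnd (psnd z)"
    have "?u \<in> stg N G \<beta>" if b: "?b \<in> stg N G \<beta>" for \<beta>
    proof -
      have "N ?u \<alpha> i \<or> (\<exists>w. G ?u \<alpha> i w \<and> (\<exists>\<gamma><\<beta>. w \<in> stg N G \<gamma>))" for i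
      proof (cases "N ?u \<alpha> i")
        case False
        then obtain w where w: "G ?u \<alpha> i w" "ind N G w" "?b \<notin> stg N G (rk N G w)"
          using rule[of i] 3 by (auto simp: cmpN_def cmpG_def)
        then have "rk N G w < \<beta>" using b stg_mono by (metis not_le subsetD)
        moreover have "w \<in> stg N G (rk N G w)" using w by (simp add: stg_iff)
        ultimately show ?thesis using w by blast
      qed blast
      then show ?thesis by (subst stg_unfold) blast
    qed
    then show ?thesis using 3 by simp
  qed auto
qed

text \<open>The stage comparison theorem. \<open>u\<close> precedes \<open>t\<close> if every rule
  for \<open>t\<close> has a premise that can only be fulfilled at the stage of \<open>u\<close> or
  later; and \<open>u\<close> is no later than \<open>b\<close> if some rule for \<open>u\<close>
  has all its premises void or fulfilled strictly before \<open>b\<close>. Soundness is an induction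
  on this definition, completeness one on the rank of \<open>u\<close>.\<close>

lemma ind_less_iff: "ind_less N G u t \<longleftrightarrow> ind N G u \<and> t \<notin> stg N G (rk N G u)"
proof
  assume "ind_less N G u t"
  then show "ind N G u \<and> t \<notin> stg N G (rk N G u)"
    unfolding ind_less_def using cmp_sound[of N G "prod_encode (0, prod_encode (u, t))"] by simp
next
  let ?I = "ind (cmpN N G) (cmpG N G)"
  have "ind N G u \<Longrightarrow> t \<notin> stg N G (rk N G u) \<Longrightarrow> ?I (prod_encode (0, prod_encode (u, t)))" for u t
  proof (induction "rk N G u" arbitrary: u t rule: less_induct)
    case less
    obtain a' where a': "\<And>i. N u a' i \<or> (\<exists>b. G u a' i b \<and> ind N G b \<and> rk N G b < rk N G u)"
      using ind_rk[OF less.prems(1)] by blast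
    have le: "?I (prod_encode (2, prod_encode (u, b)))" if b: "\<forall>\<beta><rk N G u. b \<notin> stg N G \<beta>" for b
    proof (rule ind.rule[where a = a'])
      fix i
      show "cmpN N G (prod_encode (2, prod_encode (u, b))) a' i \<or>
          (\<exists>w. cmpG N G (prod_encode (2, prod_encode (u, b))) a' i w \<and> ?I w)"
      proof (cases "N u a' i")
        case True
        then show ?thesis by (simp add: cmpN_def)
      next
        case False
        then obtain w where w: "G u a' i w" "ind N G w" "rk N G w < rk N G u" using a' by blast
        then have "?I (prod_encode (0, prod_encode (w, b)))" using less.hyps b by blast
        then show ?thesis using w by (auto simp: cmpG_def)
      qed
    qed
    have "?I (prod_encode (1, prod_encode (prod_encode (u, t), a)))" for a
    proof -
      obtain i where i: "\<not> N t a i" "\<And>b. G t a i b \<Longrightarrow> \<forall>\<beta><rk N G u. b \<notin> stg N G \<beta>"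
        using not_stg_rule[OF less.prems(2), of a] by blast
      show ?thesis
      proof (rule ind.rule[where a = i])
        fix b
        show "cmpN N G (prod_encode (1, prod_encode (prod_encode (u, t), a))) i b \<or>
          (\<exists>w. cmpG N G (prod_encode (1, prod_encode (prod_encode (u, t), a))) i b w \<and> ?I w)"
          using i le[of b] by (auto simp: cmpN_def cmpG_def)
      qed
    qed
    then show ?case
      by (intro ind.rule[where a = 0]) (auto simp: cmpN_def cmpG_def less.prems)
  qed
  then show "ind N G u \<and> t \<notin> stg N G (rk N G u) \<Longrightarrow> ind_less N G u t" by (simp add: ind_less_def)
qed

lemma (in tree_class) K_ind_less:
  assumes N: "K (\<lambda>x n. N x (pfst n) (pfst (psnd n)) (psnd (psnd n)))"
    and G: "K (\<lambda>x n. G x (pfst n) (pfst (psnd n)) (pfst (psnd (psnd n))) (psnd (psnd (psnd n))))"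
    and A: "itrm_fn (\<lambda>x. A)" and B: "itrm_fn (\<lambda>x. B)"
  shows "K (\<lambda>x n. ind_less (N x) (G x) (A n) (B n))"
proof -
  have "K (\<lambda>x n. ind (cmpN (N x) (G x)) (cmpG (N x) (G x)) n)"
    by (rule K_ind; unfold cmpN_def cmpG_def;
        intro K_intros K_comp3[OF N] K_comp4[OF G] K_comp[OF K_ind[OF N G]] itrm_intros)
  from K_comp[OF this itrm_pair[OF itrm_const itrm_pair[OF A B]]]
  show ?thesis unfolding ind_less_def .
qed

section \<open>Conditions\<close>

text \<open>
  Every number \<open>p\<close> is a condition on a real; an entry \<open>(i, 1)\<close> or \<open>(i, 0)\<close> of \<open>p\<close> puts \<open>i\<close> into
  the real or keeps it out.
\<close>

definition mem :: "nat \<Rightarrow> nat \<Rightarrow> bool" where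
  "mem e p \<longleftrightarrow> (\<exists>j. psnd ((pfst ^^ j) p) = e \<and> (pfst ^^ j) p \<noteq> 0 \<and> (pfst ^^ j) p \<noteq> 1)"

definition con :: "nat \<Rightarrow> bool" where
  "con p \<longleftrightarrow> \<not> (\<exists>i. mem (prod_encode (i, 0)) p \<and> mem (prod_encode (i, 1)) p)"

definition sat :: "nat \<Rightarrow> nat set \<Rightarrow> bool" where
  "sat p g \<longleftrightarrow> (\<forall>i. (mem (prod_encode (i, 1)) p \<longrightarrow> i \<in> g) \<and> (mem (prod_encode (i, 0)) p \<longrightarrow> i \<notin> g))"

definition ext :: "nat \<Rightarrow> nat \<Rightarrow> bool" where
  "ext q p \<longleftrightarrow> (\<forall>e. mem e p \<longrightarrow> mem e q)"

lemma mem_1 [simp]: "\<not> mem e 1" "\<not> mem e (Suc 0)"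
proof -
  have "(pfst ^^ j) (Suc 0) = 0 \<or> (pfst ^^ j) (Suc 0) = Suc 0" for j by (induction j) auto
  then show "\<not> mem e 1" "\<not> mem e (Suc 0)" by (auto simp: mem_def)
qed

lemma mem_push: "0 < p \<Longrightarrow> mem e (prod_encode (p, a)) \<longleftrightarrow> e = a \<or> mem e p"
proof -
  assume p: "0 < p"
  have *: "(\<exists>j. Q j) \<longleftrightarrow> Q 0 \<or> (\<exists>j. Q (Suc j))" for Q :: "nat \<Rightarrow> bool" by (metis not0_implies_Suc)
  have "prod_encode (p, a) \<noteq> 0" "prod_encode (p, a) \<noteq> 1" using less_prod_encode[OF p, of a] p by auto
  then show ?thesis unfolding mem_def by (subst *) (auto simp: funpow_swap1)
qed

lemma mem_code:
  assumes "finite E"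
  obtains p where "0 < p" "\<And>e. mem e p \<longleftrightarrow> e \<in> E"
proof -
  have "\<exists>p>0. \<forall>e. mem e p \<longleftrightarrow> e \<in> E" using assms
  proof (induction rule: finite_induct)
    case empty
    show ?case by (intro exI[of _ 1]) auto
  next
    case (insert a E)
    then obtain p where "0 < p" "\<forall>e. mem e p \<longleftrightarrow> e \<in> E" by blast
    then show ?case
      using mem_push[of p _ a] less_prod_encode[of p a] by (intro exI[of _ "prod_encode (p, a)"]) auto
  qed
  then show ?thesis using that by blast
qed

lemma finite_mem: "finite {e. mem e p}"
proof -
  have "(pfst ^^ j) p \<le> p" for j by (induction j) (auto intro: order_trans[OF pfst_le])
  then have "{e. mem e p} \<subseteq> psnd ` {..p}" unfolding mem_def by auto
  then show ?thesis by (rule finite_subset) simp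
qed

lemma ext_refl [simp]: "ext p p" and ext_trans: "ext r q \<Longrightarrow> ext q p \<Longrightarrow> ext r p"
  by (auto simp: ext_def)

lemma sat_con: "sat p g \<Longrightarrow> con p"
  by (auto simp: sat_def con_def)

lemma sat_ext: "sat q g \<Longrightarrow> ext q p \<Longrightarrow> sat p g"
  by (auto simp: sat_def ext_def)

lemma sat_1 [simp]: "sat 1 g" "sat (Suc 0) g"
  by (auto simp: sat_def)

lemma sat_common:
  assumes "sat p g" "sat q g"
  obtains r where "sat r g" "ext r p" "ext r q"
proof -
  have "finite ({e. mem e p} \<union> {e. mem e q})" using finite_mem by simp
  then obtain r where "\<And>e. mem e r \<longleftrightarrow> e \<in> {e. mem e p} \<union> {e. mem e q}"
    using mem_code by metis
  then show ?thesis using that[of r] assms by (auto simp: sat_def ext_def)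
qed

lemma con_decide:
  assumes "con p"
  shows "\<exists>q. ext q p \<and> con q \<and> (mem (prod_encode (n, 0)) q \<or> mem (prod_encode (n, 1)) q)"
proof (cases "mem (prod_encode (n, 0)) p")
  case True
  then show ?thesis using assms by (intro exI[of _ p]) auto
next
  case False
  have "finite (insert (prod_encode (n, 1)) {e. mem e p})" using finite_mem by simp
  then obtain q where "\<And>e. mem e q \<longleftrightarrow> e \<in> insert (prod_encode (n, 1)) {e. mem e p}"
    using mem_code by metis
  then show ?thesis using assms False by (intro exI[of _ q]) (auto simp: ext_def con_def)
qed

context tree_class
begin

lemma K_mem:
  assumes "itrm_fn (\<lambda>x. A)" "itrm_fn (\<lambda>x. B)"
  shows "K (\<lambda>x n. mem (A n) (B n))"
proof (rule K_comp2[OF _ assms])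
  show "K (\<lambda>x n. mem (pfst n) (psnd n))"
    unfolding mem_def by (intro K_intros itrm_iterate itrm_intros)
qed

lemma K_con:
  assumes "itrm_fn (\<lambda>x. A)"
  shows "K (\<lambda>x n. con (A n))"
proof (rule K_comp[OF _ assms])
  show "K (\<lambda>x n. con n)" unfolding con_def by (intro K_intros K_mem itrm_intros)
qed

lemma K_ext:
  assumes "itrm_fn (\<lambda>x. A)" "itrm_fn (\<lambda>x. B)"
  shows "K (\<lambda>x n. ext (A n) (B n))"
proof (rule K_comp2[OF _ assms])
  show "K (\<lambda>x n. ext (pfst n) (psnd n))"
    unfolding ext_def by (intro K_intros K_mem itrm_intros)
qed

lemmas K_cond = K_intros K_mem K_con K_ext

end

section \<open>Tame relations\<close>

definition dec2 :: "(nat \<Rightarrow> nat \<Rightarrow> bool) \<Rightarrow> bool" where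
  "dec2 U \<longleftrightarrow> dec (\<lambda>x n. U (pfst n) (psnd n))"

definition dense :: "(nat \<Rightarrow> nat \<Rightarrow> bool) \<Rightarrow> bool" where
  "dense D \<longleftrightarrow> (\<forall>n p. con p \<longrightarrow> (\<exists>q. ext q p \<and> con q \<and> D n q))"

definition gen :: "(nat \<Rightarrow> nat \<Rightarrow> bool) \<Rightarrow> nat set \<Rightarrow> bool" where
  "gen D g \<longleftrightarrow> (\<forall>n. \<exists>p. sat p g \<and> D n p)"

text \<open>\<open>U n\<close> consists of conditions forcing \<open>R n\<close>; it may be smaller
  than the full forcing relation, as long as every instance true at a real meeting \<open>D\<close>
  is forced by a condition of that real.\<close>

definition forced_by :: "(nat set \<Rightarrow> nat \<Rightarrow> bool) \<Rightarrow> (nat \<Rightarrow> nat \<Rightarrow> bool) \<Rightarrow> (nat \<Rightarrow> nat \<Rightarrow> bool) \<Rightarrow> bool" where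
  "forced_by R U D \<longleftrightarrow> dec2 U \<and> dec2 D \<and> dense D \<and> (\<forall>n p q. U n p \<longrightarrow> ext q p \<longrightarrow> U n q) \<and>
     (\<forall>g. gen D g \<longrightarrow> (\<forall>n. R g n \<longleftrightarrow> (\<exists>p. sat p g \<and> U n p)))"

definition tame :: "(nat set \<Rightarrow> nat \<Rightarrow> bool) \<Rightarrow> bool" where
  "tame R \<longleftrightarrow> (\<exists>U D. forced_by R U D)"

lemma dec2_comp: "dec2 U \<Longrightarrow> itrm_fn (\<lambda>x. A) \<Longrightarrow> itrm_fn (\<lambda>x. B) \<Longrightarrow> dec (\<lambda>x n. U (A n) (B n))"
  unfolding dec2_def by (rule dec.K_comp2)

lemma gen_union:
  assumes "dec2 D" "dense D" "dec2 D'" "dense D'"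
  obtains E where "dec2 E" "dense E" "\<And>g. gen E g \<Longrightarrow> gen D g \<and> gen D' g"
proof -
  define E where "E n p \<longleftrightarrow> (pfst n = 0 \<and> D (psnd n) p) \<or> (pfst n \<noteq> 0 \<and> D' (psnd n) p)" for n p
  have "dec2 E"
    unfolding dec2_def E_def
    by (intro dec.K_intros dec2_comp[OF assms(1)] dec2_comp[OF assms(3)] itrm_intros)
  moreover have "dense E"
    using assms(2,4) unfolding dense_def E_def by (metis)
  moreover have "gen D g \<and> gen D' g" if "gen E g" for g
  proof -
    have "\<exists>p. sat p g \<and> E (prod_encode (i, n)) p" for i n using that by (auto simp: gen_def)
    from this[of 0] this[of 1] show ?thesis by (auto simp: gen_def E_def)
  qed
  ultimately show ?thesis using that by blast
qed

lemma tame_dec: "dec (\<lambda>x. R) \<Longrightarrow> tame (\<lambda>x. R)"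
proof -
  assume R: "dec (\<lambda>x. R)"
  have "dec2 (\<lambda>n p. R n)" unfolding dec2_def by (rule dec.K_comp[OF R itrm_pfst'])
  moreover have "dec2 (\<lambda>n p. True)"
    using dec_eq[OF itrm_const[of 0] itrm_const[of 0]] by (simp add: dec2_def)
  moreover have "dense (\<lambda>n p. True)" using ext_refl unfolding dense_def by blast
  ultimately have "forced_by (\<lambda>x. R) (\<lambda>n p. R n) (\<lambda>n p. True)"
    unfolding forced_by_def using sat_1 by blast
  then show ?thesis unfolding tame_def by blast
qed

lemma tame_comp: "tame R \<Longrightarrow> itrm_fn (\<lambda>x. F) \<Longrightarrow> tame (\<lambda>x n. R x (F n))"
proof -
  assume "tame R" and F: "itrm_fn (\<lambda>x. F)"
  then obtain U D where U: "forced_by R U D" unfolding tame_def by blast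
  have "dec (\<lambda>x n. U (F (pfst n)) (psnd n))"
    using U itrm_comp[OF F itrm_pfst'] by (intro dec2_comp itrm_intros) (auto simp: forced_by_def)
  then have "forced_by (\<lambda>x n. R x (F n)) (\<lambda>n. U (F n)) D"
    using U unfolding forced_by_def by (auto simp: dec2_def)
  then show ?thesis unfolding tame_def by blast
qed

lemma tame_conj: "tame R \<Longrightarrow> tame S \<Longrightarrow> tame (\<lambda>x n. R x n \<and> S x n)"
proof -
  assume "tame R" "tame S"
  then obtain U D V E where U: "forced_by R U D" and V: "forced_by S V E" unfolding tame_def by blast
  obtain H where H: "dec2 H" "dense H" "\<And>g. gen H g \<Longrightarrow> gen D g \<and> gen E g"
    using U V gen_union[of D E] unfolding forced_by_def by blast
  have "R g n \<and> S g n \<longleftrightarrow> (\<exists>p. sat p g \<and> U n p \<and> V n p)" if "gen H g" for g n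
  proof -
    have R: "R g n \<longleftrightarrow> (\<exists>p. sat p g \<and> U n p)" and S: "S g n \<longleftrightarrow> (\<exists>p. sat p g \<and> V n p)"
      using H(3)[OF that] U V unfolding forced_by_def by blast+
    show ?thesis
    proof
      assume "R g n \<and> S g n"
      then obtain p q where pq: "sat p g" "U n p" "sat q g" "V n q" using R S by blast
      obtain r where "sat r g" "ext r p" "ext r q" using sat_common[OF pq(1,3)] .
      then show "\<exists>p. sat p g \<and> U n p \<and> V n p" using pq U V unfolding forced_by_def by blast
    qed (use R S in blast)
  qed
  moreover have "dec2 (\<lambda>n p. U n p \<and> V n p)"
    using U V dec_conj unfolding forced_by_def dec2_def by blast
  ultimately have "forced_by (\<lambda>x n. R x n \<and> S x n) (\<lambda>n p. U n p \<and> V n p) H"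
    using U V H unfolding forced_by_def by blast
  then show ?thesis unfolding tame_def by blast
qed

text \<open>The forcing clause for negation. A real meeting the deciding sets \<open>E\<close>
  satisfies a condition in \<open>U n\<close> or one with no consistent extension in
  \<open>U n\<close>; it cannot satisfy both, since two conditions on one real have a common
  extension.\<close>

lemma dense_decide:
  assumes U: "dec2 U" "\<And>n p q. U n p \<Longrightarrow> ext q p \<Longrightarrow> U n q"
  defines "E \<equiv> \<lambda>n p. U n p \<or> (\<forall>q. ext q p \<and> con q \<longrightarrow> \<not> U n q)"
  shows "dec2 E" "dense E"
    "\<And>g n. gen E g \<Longrightarrow> \<not> (\<exists>p. sat p g \<and> U n p) \<longleftrightarrow>
       (\<exists>p. sat p g \<and> (\<forall>q. ext q p \<and> con q \<longrightarrow> \<not> U n q))"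
proof -
  show "dec2 E"
    unfolding dec2_def E_def by (intro dec.K_cond dec2_comp[OF U(1)] itrm_intros)
  show "dense E"
    unfolding dense_def E_def by (meson ext_refl ext_trans)
  fix g n assume g: "gen E g"
  show "\<not> (\<exists>p. sat p g \<and> U n p) \<longleftrightarrow> (\<exists>p. sat p g \<and> (\<forall>q. ext q p \<and> con q \<longrightarrow> \<not> U n q))"
  proof
    assume "\<not> (\<exists>p. sat p g \<and> U n p)"
    then show "\<exists>p. sat p g \<and> (\<forall>q. ext q p \<and> con q \<longrightarrow> \<not> U n q)"
      using g unfolding gen_def E_def by blast
  next
    assume "\<exists>p. sat p g \<and> (\<forall>q. ext q p \<and> con q \<longrightarrow> \<not> U n q)"
    then obtain p where p: "sat p g" "\<And>q. ext q p \<Longrightarrow> con q \<Longrightarrow> \<not> U n q" by blast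
    show "\<not> (\<exists>p. sat p g \<and> U n p)"
    proof
      assume "\<exists>p. sat p g \<and> U n p"
      then obtain p' where p': "sat p' g" "U n p'" by blast
      obtain r where "sat r g" "ext r p" "ext r p'" using sat_common[OF p(1) p'(1)] .
      then show False using p(2) p'(2) U(2) sat_con by blast
    qed
  qed
qed

lemma tame_not: "tame R \<Longrightarrow> tame (\<lambda>x n. \<not> R x n)"
proof -
  assume "tame R"
  then obtain U D where U: "forced_by R U D" unfolding tame_def by blast
  define U' where "U' n p \<longleftrightarrow> (\<forall>q. ext q p \<and> con q \<longrightarrow> \<not> U n q)" for n p
  define E where "E n p \<longleftrightarrow> U n p \<or> U' n p" for n p
  have U2: "dec2 U" "\<And>n p q. U n p \<Longrightarrow> ext q p \<Longrightarrow> U n q" using U unfolding forced_by_def by blast+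
  have "(\<lambda>n p. U n p \<or> (\<forall>q. ext q p \<and> con q \<longrightarrow> \<not> U n q)) = E" by (simp add: E_def U'_def fun_eq_iff)
  with dense_decide[OF U2(1)] U2(2) have E: "dec2 E" "dense E"
    "\<And>g n. gen E g \<Longrightarrow> \<not> (\<exists>p. sat p g \<and> U n p) \<longleftrightarrow> (\<exists>p. sat p g \<and> U' n p)"
    unfolding U'_def by simp_all
  obtain H where H: "dec2 H" "dense H" "\<And>g. gen H g \<Longrightarrow> gen D g \<and> gen E g"
    using U gen_union[of D E] E(1,2) unfolding forced_by_def by blast
  have "dec2 U'"
    unfolding dec2_def U'_def by (intro dec.K_cond dec2_comp[OF U2(1)] itrm_intros)
  moreover have "U' n q" if "U' n p" "ext q p" for n p q
    using that ext_trans unfolding U'_def by blast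
  moreover have "\<not> R g n \<longleftrightarrow> (\<exists>p. sat p g \<and> U' n p)" if "gen H g" for g n
    using E(3)[of g n] H(3)[OF that] U unfolding forced_by_def by blast
  ultimately have "forced_by (\<lambda>x n. \<not> R x n) U' H" using H unfolding forced_by_def by blast
  then show ?thesis unfolding tame_def by blast
qed

lemma tame_query: "tame (\<lambda>x n. n \<in> x)"
proof -
  let ?U = "\<lambda>n p. mem (prod_encode (n, 1)) p"
  let ?D = "\<lambda>n p. mem (prod_encode (n, 0)) p \<or> mem (prod_encode (n, 1)) p"
  have "dec2 ?U" "dec2 ?D" unfolding dec2_def by (intro dec.K_cond itrm_intros)+
  moreover have "dense ?D" using con_decide unfolding dense_def by blast
  ultimately have "forced_by (\<lambda>x n. n \<in> x) ?U ?D"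
    unfolding forced_by_def gen_def sat_def ext_def by blast
  then show ?thesis unfolding tame_def by blast
qed


text \<open>\<open>W n p s\<close> says that \<open>p\<close> forces the node \<open>s\<close> to be
  dead: either \<open>p\<close> forces it out of the tree, or for every child each consistent
  extension of \<open>p\<close> has a further one that forces the child to be dead.
  \<open>D1\<close> yields that dead nodes are forced. Conversely, it is not enough that every child
  of a forced node be forced by some condition of the real, since such a descent might never end;
  \<open>D2\<close> makes the rank in \<open>ind N G\<close> decrease with each child.\<close>

lemma tame_dead:
  assumes "tame Q"
  shows "tame (\<lambda>x n. dead (\<lambda>s. Q x (prod_encode (n, s))) 1)"
proof -
  obtain U D where U: "forced_by (\<lambda>x n. \<not> Q x n) U D" using tame_not[OF assms] unfolding tame_def by blast
  then have Udec: "dec2 U" and Umono: "\<And>n p q. U n p \<Longrightarrow> ext q p \<Longrightarrow> U n q"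
    and UQ: "\<And>g n. gen D g \<Longrightarrow> \<not> Q g n \<longleftrightarrow> (\<exists>p. sat p g \<and> U n p)"
    unfolding forced_by_def by blast+
  \<comment> \<open>The number \<open>t\<close> codes a triple \<open>cd n p s\<close>. Rule 0 is
    the clause for leaves. For any other rule, premise \<open>i\<close> is a pair of an extension
    and a child number, and is void if its first part is no consistent extension.\<close>
  define N where "N t a i \<longleftrightarrow> (a = 0 \<and> U (prod_encode (pfst t, psnd (psnd t))) (pfst (psnd t))) \<or>
    (a \<noteq> 0 \<and> \<not> (ext (pfst i) (pfst (psnd t)) \<and> con (pfst i)))" for t a i :: nat
  define G where "G t a i b \<longleftrightarrow> a \<noteq> 0 \<and> pfst b = pfst t \<and>
    psnd (psnd b) = prod_encode (psnd (psnd t), psnd i) \<and>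
    ext (pfst (psnd b)) (pfst i) \<and> con (pfst (psnd b))" for t a i b :: nat
  define cd where "cd n p s = prod_encode (n, prod_encode (p, s))" for n p s
  define W where "W n p s \<longleftrightarrow> ind N G (cd n p s)" for n p s
  have NK: "dec (\<lambda>x n. N (pfst n) (pfst (psnd n)) (psnd (psnd n)))"
    unfolding N_def by (intro dec.K_cond dec2_comp[OF Udec] itrm_intros)
  have GK: "dec (\<lambda>x n. G (pfst n) (pfst (psnd n)) (pfst (psnd (psnd n))) (psnd (psnd (psnd n))))"
    unfolding G_def by (intro dec.K_cond itrm_intros)
  have WK: "dec (\<lambda>x n. W (A n) (B n) (C n))"
    if "itrm_fn (\<lambda>x. A)" "itrm_fn (\<lambda>x. B)" "itrm_fn (\<lambda>x. C)" for A B C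
    unfolding W_def cd_def
    by (intro dec.K_comp[OF dec.K_ind[OF NK GK]] itrm_intros that)
  have LK: "dec (\<lambda>x n. ind_less N G (A n) (B n))"
    if "itrm_fn (\<lambda>x. A)" "itrm_fn (\<lambda>x. B)" for A B
    by (rule dec.K_ind_less[OF NK GK that])
  have W_leaf: "W n p s" if "U (prod_encode (n, s)) p" for n p s
    unfolding W_def by (rule ind.rule[where a = 0]) (use that in \<open>auto simp: N_def cd_def\<close>)
  have W_node: "W n p s"
    if node: "\<And>q j. ext q p \<Longrightarrow> con q \<Longrightarrow> \<exists>r. ext r q \<and> con r \<and> W n r (prod_encode (s, j))" for n p s
    unfolding W_def
  proof (rule ind.rule[where a = 1])
    fix i
    show "N (cd n p s) 1 i \<or> (\<exists>b. G (cd n p s) 1 i b \<and> ind N G b)"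
    proof (cases "ext (pfst i) p \<and> con (pfst i)")
      case True
      then obtain r where "ext r (pfst i)" "con r" "W n r (prod_encode (s, psnd i))" using node by blast
      then have "G (cd n p s) 1 i (cd n r (prod_encode (s, psnd i)))" "ind N G (cd n r (prod_encode (s, psnd i)))"
        by (auto simp: G_def cd_def W_def)
      then show ?thesis by blast
    qed (auto simp: N_def cd_def)
  qed
  have W_cases: "U (prod_encode (n, s)) p \<or> (\<forall>q j. ext q p \<longrightarrow> con q \<longrightarrow>
      (\<exists>r. ext r q \<and> con r \<and> W n r (prod_encode (s, j)) \<and>
        rk N G (cd n r (prod_encode (s, j))) < rk N G (cd n p s)))" if Wp: "W n p s" for n p s
  proof -
    obtain a where a: "\<And>i. N (cd n p s) a i \<or>
        (\<exists>b. G (cd n p s) a i b \<and> ind N G b \<and> rk N G b < rk N G (cd n p s))"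
      using ind_rk[OF Wp[unfolded W_def]] by blast
    show ?thesis
    proof (cases "a = 0")
      case True
      then show ?thesis using a[of 0] by (auto simp: N_def G_def cd_def)
    next
      case False
      have "\<exists>r. ext r q \<and> con r \<and> W n r (prod_encode (s, j)) \<and>
        rk N G (cd n r (prod_encode (s, j))) < rk N G (cd n p s)" if q: "ext q p" "con q" for q j
      proof -
        have "\<not> N (cd n p s) a (prod_encode (q, j))" using q False by (auto simp: N_def cd_def)
        then obtain b where b: "G (cd n p s) a (prod_encode (q, j)) b" "ind N G b"
            "rk N G b < rk N G (cd n p s)"
          using a by blast
        then have e: "pfst b = n" "psnd (psnd b) = prod_encode (s, j)" "ext (pfst (psnd b)) q" "con (pfst (psnd b))"
          by (auto simp: G_def cd_def)
        then have "b = cd n (pfst (psnd b)) (prod_encode (s, j))" by (metis cd_def pair_simps(3))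
        then show ?thesis using b e unfolding W_def by metis
      qed
      then show ?thesis by blast
    qed
  qed
  have W_mono: "W n q s" if "W n p s" "ext q p" for n p q s
    using W_cases[OF that(1)] Umono that(2) W_leaf W_node ext_trans by meson
  \<comment> \<open>If the condition does not force the node to be dead, it singles out one child
    that none of its extensions forces to be dead.\<close>
  define D1 where "D1 k p \<longleftrightarrow> W (pfst k) p (psnd k) \<or>
    (\<exists>j. \<forall>r. ext r p \<and> con r \<longrightarrow> \<not> W (pfst k) r (prod_encode (psnd k, j)))" for k p
  define child where "child k r = cd (pfst (pfst k)) r (prod_encode (psnd (psnd (pfst k)), psnd k))" for k r
  \<comment> \<open>The index \<open>k\<close> is a triple \<open>cd n p s\<close> paired with a
    child number. The condition gives the child a smaller rank than the node has with
    \<open>p\<close>, or excludes this for all its extensions. Stage comparison is what makes this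
    computable.\<close>
  define D2 where "D2 k q \<longleftrightarrow> ind_less N G (child k q) (pfst k) \<or>
    (\<forall>r. ext r q \<and> con r \<longrightarrow> \<not> ind_less N G (child k r) (pfst k))" for k q
  have "dec2 D1" "dec2 D2"
    unfolding dec2_def D1_def D2_def child_def cd_def by (intro dec.K_cond WK LK itrm_intros)+
  moreover have "dense D1"
    unfolding dense_def
  proof (intro allI impI)
    fix k p assume p: "con p"
    show "\<exists>q. ext q p \<and> con q \<and> D1 k q"
    proof (cases "W (pfst k) p (psnd k)")
      case True
      then show ?thesis using p by (intro exI[of _ p]) (simp add: D1_def)
    next
      case False
      then obtain q j where "ext q p" "con q" "\<forall>r. ext r q \<and> con r \<longrightarrow> \<not> W (pfst k) r (prod_encode (psnd k, j))"
        using W_node by blast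
      then show ?thesis unfolding D1_def by blast
    qed
  qed
  moreover have "dense D2"
    unfolding dense_def D2_def by (meson ext_refl ext_trans)
  ultimately obtain D12 where D12: "dec2 D12" "dense D12" "\<And>g. gen D12 g \<Longrightarrow> gen D1 g \<and> gen D2 g"
    using gen_union by metis
  obtain H where H: "dec2 H" "dense H" "\<And>g. gen H g \<Longrightarrow> gen D g \<and> gen D12 g"
    using U D12 gen_union[of D D12] unfolding forced_by_def by blast
  have "dead (\<lambda>s. Q g (prod_encode (n, s))) 1 \<longleftrightarrow> (\<exists>p. sat p g \<and> W n p 1)" if "gen H g" for g n
  proof
    have g: "gen D g" "gen D1 g" "gen D2 g" using that H(3) D12(3) by blast+
    have "dead (\<lambda>s. Q g (prod_encode (n, s))) s \<Longrightarrow> \<exists>p. sat p g \<and> W n p s" for s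
    proof (induction rule: dead.induct)
      case (leaf s)
      then show ?case using UQ[OF g(1)] W_leaf by blast
    next
      case (node s)
      obtain p where p: "sat p g" "D1 (prod_encode (n, s)) p" using g(2) unfolding gen_def by blast
      show ?case
      proof (cases "W n p s")
        case False
        then obtain j where j: "\<And>r. ext r p \<Longrightarrow> con r \<Longrightarrow> \<not> W n r (prod_encode (s, j))"
          using p(2) by (auto simp: D1_def)
        obtain p' where p': "sat p' g" "W n p' (prod_encode (s, j))" using node by blast
        obtain r where "sat r g" "ext r p" "ext r p'" using sat_common[OF p(1) p'(1)] .
        then show ?thesis using j p'(2) W_mono sat_con by blast
      qed (use p in blast)
    qed
    then show "dead (\<lambda>s. Q g (prod_encode (n, s))) 1 \<Longrightarrow> \<exists>p. sat p g \<and> W n p 1" .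
    have "dead (\<lambda>s. Q g (prod_encode (n, s))) s" if "W n p s" "sat p g" for p s
      using that
    proof (induction "rk N G (cd n p s)" arbitrary: p s rule: less_induct)
      case less
      from W_cases[OF less.prems(1)] show ?case
      proof
        assume "U (prod_encode (n, s)) p"
        then show ?case using UQ[OF g(1)] less.prems(2) by (intro dead.leaf) blast
      next
        assume node: "\<forall>q j. ext q p \<longrightarrow> con q \<longrightarrow> (\<exists>r. ext r q \<and> con r \<and> W n r (prod_encode (s, j)) \<and>
           rk N G (cd n r (prod_encode (s, j))) < rk N G (cd n p s))"
        show ?case
        proof (rule dead.node)
          fix j
          let ?k = "prod_encode (cd n p s, j)"
          have k: "child ?k r = cd n r (prod_encode (s, j))" for r by (simp add: child_def cd_def)
          have less_iff: "ind_less N G (child ?k r) (pfst ?k) \<longleftrightarrow> W n r (prod_encode (s, j)) \<and>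
              rk N G (cd n r (prod_encode (s, j))) < rk N G (cd n p s)" for r
            using less.prems(1) by (simp add: ind_less_iff stg_iff k W_def not_le)
          obtain q where q: "sat q g" "D2 ?k q" using g(3) unfolding gen_def by blast
          obtain q' where q': "sat q' g" "ext q' p" "ext q' q" using sat_common[OF less.prems(2) q(1)] .
          obtain r where r: "ext r q'" "con r" "ind_less N G (child ?k r) (pfst ?k)"
            unfolding less_iff using node q'(2) sat_con[OF q'(1)] by blast
          \<comment> \<open>The extension \<open>r\<close> of \<open>q\<close> rules out the second
            alternative of \<open>D2\<close>, so \<open>q\<close> itself lowers the rank.\<close>
          then have "ind_less N G (child ?k q) (pfst ?k)"
            using q(2) q'(3) ext_trans unfolding D2_def by blast
          then show "dead (\<lambda>s. Q g (prod_encode (n, s))) (prod_encode (s, j))"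
            unfolding less_iff using less.hyps q(1) by blast
        qed
      qed
    qed
    then show "\<exists>p. sat p g \<and> W n p 1 \<Longrightarrow> dead (\<lambda>s. Q g (prod_encode (n, s))) 1" by blast
  qed
  moreover have "dec2 (\<lambda>n p. W n p 1)" unfolding dec2_def by (intro WK itrm_intros)
  ultimately have "forced_by (\<lambda>x n. dead (\<lambda>s. Q x (prod_encode (n, s))) 1) (\<lambda>n p. W n p 1) H"
    using H W_mono unfolding forced_by_def by blast
  then show ?thesis unfolding tame_def by blast
qed

interpretation tame: tree_class tame
  by unfold_locales (assumption | intro tame_dec tame_not tame_conj tame_dead | rule tame_comp)+

section \<open>Closing off a generalized machine under non-overflowing limits\<close>

text \<open>
  Besides single moves and concatenation, \<open>vreach\<close> admits only those limits at which the
  state \<open>L\<close> reached has been approached from above in all components at once: for every \<open>i\<close>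
  there are \<open>i\<close> consecutive segments with minima exactly \<open>L\<close>.
\<close>

lemma not_less_om0: "\<not> c < om0"
  by (simp add: not_less)

inductive vreach :: "(vec \<Rightarrow> vec) \<Rightarrow> (vec \<Rightarrow> vec) \<Rightarrow> vec \<Rightarrow> vec \<Rightarrow> vec \<Rightarrow> bool"
  and vchain :: "(vec \<Rightarrow> vec) \<Rightarrow> (vec \<Rightarrow> vec) \<Rightarrow> vec \<Rightarrow> vec \<Rightarrow> nat \<Rightarrow> bool" for bm bs where
  base: "vreach bm bs v (bm v) (bs v)"
| trans: "vreach bm bs v m w \<Longrightarrow> vreach bm bs w m' u \<Longrightarrow> vreach bm bs v (\<lambda>j. min (m j) (m' j)) u"
| nil: "vchain bm bs L v 0"
| cons: "vreach bm bs v L w \<Longrightarrow> vchain bm bs L w i \<Longrightarrow> vchain bm bs L v (Suc i)"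
| lim: "(\<And>i. vchain bm bs L v i) \<Longrightarrow> vreach bm bs v L L"

definition full :: "(vec \<Rightarrow> vec) \<Rightarrow> (vec \<Rightarrow> vec) \<Rightarrow> vec \<Rightarrow> om1 \<Rightarrow> om1 \<Rightarrow> bool" where
  "full bm bs u a b \<longleftrightarrow> (\<forall>c d. a \<le> c \<longrightarrow> c < d \<longrightarrow> d \<le> b \<longrightarrow>
     (\<exists>m. ismin (\<lambda>t. bm (run bm bs u t)) {c..<d} m \<and> vreach bm bs (run bm bs u c) m (run bm bs u d)))"

lemma fullD:
  assumes "full bm bs u a b" "a \<le> c" "c < d" "d \<le> b" "ismin (\<lambda>t. bm (run bm bs u t)) {c..<d} m"
  shows "vreach bm bs (run bm bs u c) m (run bm bs u d)"
  using assms ismin_unique unfolding full_def by metis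

lemma full_sub: "full bm bs u a b \<Longrightarrow> a \<le> a' \<Longrightarrow> b' \<le> b \<Longrightarrow> full bm bs u a' b'"
  unfolding full_def by (meson order_trans)

lemma full_join:
  assumes "full bm bs u a b" "full bm bs u b c" "a \<le> b" "b \<le> c"
  shows "full bm bs u a c"
  unfolding full_def
proof (intro allI impI)
  fix d e assume de: "a \<le> d" "d < e" "e \<le> c"
  let ?f = "\<lambda>t. bm (run bm bs u t)"
  consider "e \<le> b" | "b \<le> d" | "d < b" "b < e" by force
  then show "\<exists>m. ismin ?f {d..<e} m \<and> vreach bm bs (run bm bs u d) m (run bm bs u e)"
  proof cases
    case 1
    then show ?thesis using assms(1) de unfolding full_def by blast
  next
    case 2
    then show ?thesis using assms(2) de unfolding full_def by blast
  next
    case 3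
    then obtain m m' where m: "ismin ?f {d..<b} m" "vreach bm bs (run bm bs u d) m (run bm bs u b)"
        "ismin ?f {b..<e} m'" "vreach bm bs (run bm bs u b) m' (run bm bs u e)"
      using assms(1,2) de unfolding full_def by (meson order_refl)
    moreover have "{d..<e} = {d..<b} \<union> {b..<e}" using 3 by auto
    ultimately show ?thesis using ismin_Un[OF m(1,3)] vreach_vchain.trans[OF m(2,4)] by auto
  qed
qed

lemma full_osuc: "full bm bs u a (osuc a)"
  unfolding full_def
proof (intro allI impI)
  fix c d assume "a \<le> c" "c < d" "d \<le> osuc a"
  then have "c = a" "d = osuc a"
    by (metis less_osuc_iff order.strict_trans2 order_antisym,
        metis less_osuc_iff order.strict_trans1 order_antisym osuc_le_iff)
  moreover have "{a..<osuc a} = {a}" by (auto simp: less_osuc_iff)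
  ultimately show "\<exists>m. ismin (\<lambda>t. bm (run bm bs u t)) {c..<d} m \<and>
      vreach bm bs (run bm bs u c) m (run bm bs u d)"
    using vreach_vchain.base[of bm bs "run bm bs u a"] by auto
qed

definition links :: "(vec \<Rightarrow> vec) \<Rightarrow> (vec \<Rightarrow> vec) \<Rightarrow> vec \<Rightarrow> vec \<Rightarrow> (om1 \<times> om1) set" where
  "links bm bs u L = {(c, d). c < d \<and> ismin (\<lambda>t. bm (run bm bs u t)) {c..<d} L \<and> full bm bs u c d}"

lemma links_relpow:
  "(a, b) \<in> links bm bs u L ^^ i \<Longrightarrow> a \<le> b \<and> full bm bs u a b \<and>
    (\<forall>c\<in>{a..<b}. \<forall>j. L j \<le> bm (run bm bs u c) j)"
proof (induction i arbitrary: b)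
  case 0
  then show ?case by (auto simp: full_def)
next
  case (Suc i)
  then obtain c where c: "(a, c) \<in> links bm bs u L ^^ i" "(c, b) \<in> links bm bs u L" by auto
  from Suc.IH[OF c(1)] c(2) show ?case
    unfolding links_def ismin_def
    by (auto intro: full_join)
qed

text \<open>The limit rule of \<open>vreach\<close> supplies chains of every finite length instead
  of one infinite chain, since a rule of a numerical inductive definition has numbers as parameters
  and cannot name an infinite sequence. As the run is deterministic, the earliest ends
  \<open>e i\<close> fit together: the last link of the earliest chain of length
  \<open>Suc i\<close> starts at \<open>e i\<close> or later. So they increase strictly, and the
  state at their supremum is \<open>L\<close>.\<close>

lemma chain_limit:
  assumes ch: "\<And>i. \<exists>b. (a, b) \<in> links bm bs u L ^^ i"
  shows "\<exists>s>a. run bm bs u s = L \<and> ismin (\<lambda>t. bm (run bm bs u t)) {a..<s} L \<and> full bm bs u a s"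
proof -
  let ?f = "\<lambda>t. bm (run bm bs u t)" and ?r = "run bm bs u"
  define e where "e i = (LEAST b. (a, b) \<in> links bm bs u L ^^ i)" for i
  have e: "(a, e i) \<in> links bm bs u L ^^ i" for i unfolding e_def using ch by (rule LeastI_ex)
  have e0: "e 0 = a" using e[of 0] by auto
  have last: "\<exists>c\<ge>e i. (c, e (Suc i)) \<in> links bm bs u L" for i
  proof -
    obtain c where c: "(a, c) \<in> links bm bs u L ^^ i" "(c, e (Suc i)) \<in> links bm bs u L"
      using e[of "Suc i"] by auto
    then show ?thesis using Least_le[of "\<lambda>b. (a, b) \<in> links bm bs u L ^^ i" c] by (auto simp: e_def)
  qed
  have inc: "e i < e (Suc i)" for i using last[of i] by (auto simp: links_def)
  obtain s where s: "\<And>i. e i \<le> s" "\<And>c. c < s \<Longrightarrow> \<exists>i. c < e i" using om1_sequence_sup by blast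
  have lt: "e i < s" for i using inc[of i] s(1)[of "Suc i"] by order
  have low: "L j \<le> ?f c j" if "a \<le> c" "c < s" for c j
    using s(2)[OF that(2)] links_relpow[OF e] that(1) by auto
  have seg: "\<exists>i. c < e i \<and> ismin ?f {c..<e i} L" if c: "a \<le> c" "c < s" for c
  proof -
    obtain i where i: "c < e i" using s(2) c by blast
    obtain d where d: "e i \<le> d" "(d, e (Suc i)) \<in> links bm bs u L" using last by blast
    have "\<exists>t\<in>{c..<e (Suc i)}. L j = ?f t j" for j
    proof -
      obtain t where "t \<in> {d..<e (Suc i)}" "L j = ?f t j"
        using d(2) unfolding links_def ismin_def by blast
      then show ?thesis using i d(1) by (intro bexI[of _ t]) auto
    qed
    moreover have "L j \<le> ?f t j" if "t \<in> {c..<e (Suc i)}" for t j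
      using that c lt[of "Suc i"] by (intro low) auto
    ultimately show ?thesis using i inc[of i] unfolding ismin_def by (metis order.strict_trans)
  qed
  have min: "ismin ?f {c..<s} L" if c: "a \<le> c" "c < s" for c
  proof -
    obtain i where "c < e i" "ismin ?f {c..<e i} L" using seg[OF c] by blast
    then show ?thesis using low c lt[of i] unfolding ismin_def by auto (metis atLeastLessThan_iff order.strict_trans)
  qed
  have as: "a < s" using lt[of 0] e0 by simp
  have rs: "?r s = L"
  proof -
    have "osuc c < s" if "c < s" for c
      using s(2)[OF that] lt by (metis osuc_le_iff order.strict_trans1)
    moreover have "om0 < s" using as by (metis om0_le order.strict_trans1)
    ultimately have "?r s = (\<lambda>j. lv {M. \<exists>c<s. \<forall>t. c \<le> t \<and> t < s \<longrightarrow> M \<le> ?f t j})"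
      by (simp add: run_limit)
    moreover have "(\<exists>c<s. \<forall>t. c \<le> t \<and> t < s \<longrightarrow> M \<le> ?f t j) \<longleftrightarrow> M \<le> L j" for M j
    proof
      assume "\<exists>c<s. \<forall>t. c \<le> t \<and> t < s \<longrightarrow> M \<le> ?f t j"
      then obtain c where c: "c < s" "\<And>t. c \<le> t \<Longrightarrow> t < s \<Longrightarrow> M \<le> ?f t j" by blast
      obtain t where "t \<in> {max a c..<s}" "L j = ?f t j"
        using min[of "max a c"] as c(1) unfolding ismin_def by (metis max.cobounded1 max_less_iff_conj)
      then show "M \<le> L j" using c(2)[of t] by auto
    next
      assume "M \<le> L j"
      then show "\<exists>c<s. \<forall>t. c \<le> t \<and> t < s \<longrightarrow> M \<le> ?f t j" using low as le_trans by blast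
    qed
    ultimately show ?thesis by (simp add: fun_eq_iff)
  qed
  have fe: "full bm bs u a (e i)" for i using links_relpow[OF e] by blast
  have chains: "vchain bm bs L (?r c) k" if "a \<le> c" "c < s" for c k
    using that
  proof (induction k arbitrary: c)
    case 0
    show ?case by (rule vreach_vchain.nil)
  next
    case (Suc k)
    obtain i where i: "c < e i" "ismin ?f {c..<e i} L" using seg Suc.prems by blast
    have "vreach bm bs (?r c) L (?r (e i))" using fullD[OF fe Suc.prems(1) i(1) _ i(2)] by blast
    moreover have "vchain bm bs L (?r (e i)) k" using Suc.IH[of "e i"] lt[of i] i(1) Suc.prems(1) by auto
    ultimately show ?case by (rule vreach_vchain.cons)
  qed
  have "full bm bs u a s"
    unfolding full_def
  proof (intro allI impI)
    fix c d assume cd: "a \<le> c" "c < d" "d \<le> s"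
    show "\<exists>m. ismin ?f {c..<d} m \<and> vreach bm bs (?r c) m (?r d)"
    proof (cases "d = s")
      case True
      have "vreach bm bs (?r c) L L" using chains[of c] cd True by (intro vreach_vchain.lim) auto
      then show ?thesis using True rs min[of c] cd by auto
    next
      case False
      then obtain i where "d < e i" using s(2) cd by force
      then show ?thesis using fe[of i] cd unfolding full_def by (meson less_imp_le)
    qed
  qed
  then show ?thesis using as rs min[of a] by auto
qed

lemma vreach_sound:
  "vreach bm bs v m w \<Longrightarrow> run bm bs u a = v \<Longrightarrow>
     \<exists>b>a. run bm bs u b = w \<and> ismin (\<lambda>t. bm (run bm bs u t)) {a..<b} m \<and> full bm bs u a b"
  "vchain bm bs L v i \<Longrightarrow> run bm bs u a = v \<Longrightarrow> \<exists>b. (a, b) \<in> links bm bs u L ^^ i"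
proof (induction arbitrary: a and a rule: vreach_vchain.inducts)
  case (base v)
  have "{a..<osuc a} = {a}" by (auto simp: less_osuc_iff)
  then show ?case using base full_osuc by (intro exI[of _ "osuc a"]) simp
next
  case (trans v m w m' z)
  obtain b where b: "a < b" "run bm bs u b = w" "ismin (\<lambda>c. bm (run bm bs u c)) {a..<b} m"
      "full bm bs u a b"
    using trans by blast
  obtain d where d: "b < d" "run bm bs u d = z" "ismin (\<lambda>c. bm (run bm bs u c)) {b..<d} m'"
      "full bm bs u b d"
    using trans b(2) by blast
  have "{a..<d} = {a..<b} \<union> {b..<d}" using b(1) d(1) by auto
  then show ?case
    using ismin_Un[OF b(3) d(3)] b(1) d(1,2) full_join[OF b(4) d(4)]
    by (intro exI[of _ d]) auto
next
  case (nil L v)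
  then show ?case by auto
next
  case (cons v L w i)
  obtain b where b: "a < b" "run bm bs u b = w" "ismin (\<lambda>c. bm (run bm bs u c)) {a..<b} L" "full bm bs u a b"
    using cons by blast
  obtain d where "(b, d) \<in> links bm bs u L ^^ i" using cons b(2) by blast
  moreover have "(a, b) \<in> links bm bs u L" using b by (simp add: links_def)
  ultimately show ?case by (meson relpow_Suc_I2)
next
  case (lim L v)
  then show ?case using chain_limit[of a bm bs u L] by blast
qed

lemma vreach_imp_gseg: "vreach bm bs v m w \<Longrightarrow> gseg bm bs v m w"
  using vreach_sound(1)[of bm bs v m w v om0] gseg_run[of om0 _ bm bs v] ismin_unique
  by (metis run_om0)

definition supp :: "nat \<Rightarrow> vec \<Rightarrow> bool" where
  "supp N v \<longleftrightarrow> (\<forall>j>N. v j = 0)"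

section \<open>The machine whose moves lead to the first overflow\<close>

definition reach0 where "reach0 bm bs v c \<longleftrightarrow> c = v \<or> (\<exists>m. vreach bm bs v m c)"

text \<open>\<open>M\<close> is an eventual lower bound of component \<open>j\<close> in the part of
  the run that \<open>vreach\<close> describes. Times do not occur, so the relation can be coded on
  numbers; \<open>Lge_iff\<close> recovers its meaning in time. Accordingly \<open>bs'\<close> is
  the limit inferior along this part and \<open>bm'\<close> its minimum.\<close>

definition Lge where
  "Lge bm bs v j M \<longleftrightarrow> (\<exists>c. reach0 bm bs v c \<and> (\<forall>m w. vreach bm bs c m w \<longrightarrow> M \<le> m j))"

definition bs' :: "(vec \<Rightarrow> vec) \<Rightarrow> (vec \<Rightarrow> vec) \<Rightarrow> vec \<Rightarrow> vec" where
  "bs' bm bs v = (\<lambda>j. lv {M. Lge bm bs v j M})"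

definition bm' :: "(vec \<Rightarrow> vec) \<Rightarrow> (vec \<Rightarrow> vec) \<Rightarrow> vec \<Rightarrow> vec" where
  "bm' bm bs v = (\<lambda>j. LEAST k. \<exists>m w. vreach bm bs v m w \<and> m j = k)"

locale gmachine =
  fixes bm bs :: "vec \<Rightarrow> vec" and N :: nat
  assumes bm_le: "bm v j \<le> v j"
    and bs_supp: "supp N v \<Longrightarrow> supp N (bs v)"
begin

lemma bm_supp: "supp N v \<Longrightarrow> supp N (bm v)"
  using bm_le unfolding supp_def by (metis le_zero_eq)

lemma gseg_supp: "gseg bm bs v m w \<Longrightarrow> supp N v \<Longrightarrow> supp N m \<and> supp N w"
proof (induction rule: gseg.induct)
  case (step v)
  then show ?case using bs_supp bm_supp by blast
next
  case (trans v m w m' u)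
  then show ?case by (simp add: supp_def)
next
  case (lim s m m')
  have s: "supp N (s i)" for i by (induction i) (use lim in auto)
  then have m: "supp N (m i)" for i using lim.IH by blast
  have "{M. M \<le> (0::nat)} = {0}" by auto
  then have "lv {0} = 0" using lv_atMost[of 0] by simp
  then have "supp N (limvec m)" using m by (auto simp: supp_def limvec_def)
  moreover have "supp N m'" using m lim.hyps(2) unfolding supp_def ismin_def by (metis UNIV_I)
  ultimately show ?case by blast
qed

definition zeros :: "vec \<Rightarrow> nat set" where "zeros w = {j. j \<le> N \<and> w j = 0}"

context
  fixes v :: vec
  assumes v: "supp N v"
begin

abbreviation (input) "r \<equiv> run bm bs v"
abbreviation (input) "f \<equiv> \<lambda>t. bm (run bm bs v t)"

definition T where "T = {b. full bm bs v om0 b}"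

lemma T_down: "b \<in> T \<Longrightarrow> a \<le> b \<Longrightarrow> a \<in> T"
  unfolding T_def using full_sub by blast

lemma T_om0: "om0 \<in> T"
  unfolding T_def full_def using not_less_om0 order.strict_trans2 by blast

lemma T_osuc: "b \<in> T \<Longrightarrow> osuc b \<in> T"
  unfolding T_def using full_join[OF _ full_osuc, of bm bs v om0 b] less_imp_le[OF less_osuc] by auto

lemma vreach_iff:
  assumes a: "a \<in> T"
  shows "vreach bm bs (r a) m w \<longleftrightarrow> (\<exists>b\<in>T. a < b \<and> r b = w \<and> ismin f {a..<b} m)"
proof
  assume "vreach bm bs (r a) m w"
  from vreach_sound(1)[OF this refl] obtain b where
    b: "a < b" "r b = w" "ismin f {a..<b} m" "full bm bs v a b" by blast
  then have "b \<in> T" using a full_join[OF _ b(4)] unfolding T_def by auto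
  then show "\<exists>b\<in>T. a < b \<and> r b = w \<and> ismin f {a..<b} m" using b by blast
next
  assume "\<exists>b\<in>T. a < b \<and> r b = w \<and> ismin f {a..<b} m"
  then obtain b where "b \<in> T" "a < b" "r b = w" "ismin f {a..<b} m" by blast
  then show "vreach bm bs (r a) m w" using fullD[of bm bs v om0 b a b m] unfolding T_def by auto
qed

lemma reach0_iff: "reach0 bm bs v c \<longleftrightarrow> (\<exists>a\<in>T. c = r a)"
proof
  assume "reach0 bm bs v c"
  then show "\<exists>a\<in>T. c = r a"
    using vreach_iff[OF T_om0] T_om0 unfolding reach0_def by (metis run_om0)
next
  assume "\<exists>a\<in>T. c = r a"
  then obtain a where a: "a \<in> T" "c = r a" by blast
  show "reach0 bm bs v c"
  proof (cases "a = om0")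
    case False
    then have "om0 < a" by (simp add: order_less_le)
    then have "{om0..<a} \<noteq> {}" by simp
    then show ?thesis using vreach_iff[OF T_om0] a ismin_ex[of "{om0..<a}" f] \<open>om0 < a\<close>
      unfolding reach0_def by auto
  qed (use a in \<open>simp add: reach0_def\<close>)
qed

lemma Lge_iff: "Lge bm bs v j M \<longleftrightarrow> (\<exists>a\<in>T. \<forall>b\<in>T. a \<le> b \<longrightarrow> M \<le> f b j)"
proof
  assume "Lge bm bs v j M"
  then obtain a where a: "a \<in> T" "\<And>m w. vreach bm bs (r a) m w \<Longrightarrow> M \<le> m j"
    unfolding Lge_def reach0_iff by blast
  have "M \<le> f b j" if b: "b \<in> T" "a \<le> b" for b
  proof -
    have ab: "a < osuc b" using b by (simp add: less_osuc_iff)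
    then obtain m where m: "ismin f {a..<osuc b} m" using ismin_ex[of "{a..<osuc b}" f] by auto
    then have "vreach bm bs (r a) m (r (osuc b))" using vreach_iff[OF a(1)] T_osuc[OF b(1)] ab by blast
    moreover have "m j \<le> f b j" using m b unfolding ismin_def by auto
    ultimately show ?thesis using a(2) le_trans by blast
  qed
  then show "\<exists>a\<in>T. \<forall>b\<in>T. a \<le> b \<longrightarrow> M \<le> f b j" using a(1) by blast
next
  assume "\<exists>a\<in>T. \<forall>b\<in>T. a \<le> b \<longrightarrow> M \<le> f b j"
  then obtain a where a: "a \<in> T" "\<And>b. b \<in> T \<Longrightarrow> a \<le> b \<Longrightarrow> M \<le> f b j" by blast
  have "M \<le> m j" if vr: "vreach bm bs (r a) m w" for m w
  proof -
    obtain b where b: "b \<in> T" "ismin f {a..<b} m" using vr vreach_iff[OF a(1)] by blast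
    then obtain c where "c \<in> {a..<b}" "m j = f c j" unfolding ismin_def by blast
    then show ?thesis using a(2)[of c] T_down[OF b(1), of c] by auto
  qed
  then show "Lge bm bs v j M" unfolding Lge_def reach0_iff using a(1) by blast
qed

lemma bm'_min: "(\<forall>b\<in>T. bm' bm bs v j \<le> f b j) \<and> (\<exists>b\<in>T. bm' bm bs v j = f b j)"
proof -
  let ?Q = "\<lambda>k. \<exists>m w. vreach bm bs v m w \<and> m j = k"
  have iff: "vreach bm bs v m w \<longleftrightarrow> (\<exists>b\<in>T. om0 < b \<and> r b = w \<and> ismin f {om0..<b} m)" for m w
    using vreach_iff[OF T_om0] by simp
  have "?Q (bm' bm bs v j)"
    unfolding bm'_def by (rule LeastI_ex) (use vreach_vchain.base in blast)
  then obtain m w b where b: "b \<in> T" "ismin f {om0..<b} m" "m j = bm' bm bs v j"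
    using iff by blast
  then obtain c where "c \<in> {om0..<b}" "m j = f c j" unfolding ismin_def by blast
  moreover have "bm' bm bs v j \<le> f b j" if "b \<in> T" for b
  proof -
    have "om0 < osuc b" by (simp add: less_osuc_iff)
    then obtain m where m: "ismin f {om0..<osuc b} m" using ismin_ex[of "{om0..<osuc b}" f] by auto
    then have "?Q (m j)" using iff T_osuc[OF that] \<open>om0 < osuc b\<close> by blast
    then have "bm' bm bs v j \<le> m j" unfolding bm'_def by (rule Least_le)
    moreover have "m j \<le> f b j" using m unfolding ismin_def by auto
    ultimately show ?thesis by simp
  qed
  ultimately show ?thesis using b T_down[OF b(1), of c] by auto
qed

lemma run_supp: "supp N (r b)" "supp N (f b)"
proof -
  show "supp N (r b)"
  proof (cases "b = om0")
    case False
    then have "om0 < b" by (simp add: order_less_le)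
    then show ?thesis using gseg_run[of om0 b bm bs v] gseg_supp v by auto
  qed (use v in simp)
  then show "supp N (f b)" by (rule bm_supp)
qed

lemma Lge_0: "Lge bm bs v j 0"
  unfolding Lge_iff using T_om0 by blast

lemma Lge_mono: "Lge bm bs v j M \<Longrightarrow> M' \<le> M \<Longrightarrow> Lge bm bs v j M'"
  unfolding Lge_iff using le_trans by blast

lemma overflow_le: "infinite {M. Lge bm bs v j M} \<Longrightarrow> j \<le> N"
proof (rule ccontr)
  assume inf: "infinite {M. Lge bm bs v j M}" and j: "\<not> j \<le> N"
  then have "f b j = 0" for b using run_supp(2)[of b] by (simp add: supp_def)
  then have "{M. Lge bm bs v j M} \<subseteq> {0}" unfolding Lge_iff by auto
  then show False using inf finite_subset by blast
qed

lemma finite_bound: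
  assumes "\<And>j. j \<le> N \<Longrightarrow> \<exists>b\<in>T. c \<le> b \<and> Q j b" "c \<in> T"
  shows "\<exists>b\<in>T. \<forall>j\<le>N. \<exists>b'. c \<le> b' \<and> b' \<le> b \<and> Q j b'"
proof -
  have "\<forall>j. \<exists>b. j \<le> N \<longrightarrow> b \<in> T \<and> c \<le> b \<and> Q j b" using assms by blast
  then obtain B where B: "\<And>j. j \<le> N \<Longrightarrow> B j \<in> T \<and> c \<le> B j \<and> Q j (B j)" by metis
  have "Max (B ` {..N}) \<in> B ` {..N}" by (rule Max_in) auto
  then obtain j where "j \<le> N" "Max (B ` {..N}) = B j" by blast
  then have "Max (B ` {..N}) \<in> T" using B by simp
  then show ?thesis using B by (intro bexI[of _ "Max (B ` {..N})"]) (auto intro!: Max_ge)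
qed

text \<open>With all limits inferior finite, some time \<tau> is followed by no value below
  \<open>L\<close>. Since only \<open>N + 1\<close> components matter, after every later time there
  is a segment in which all of them attain \<open>L\<close>. Chains of such segments lead to the
  state \<open>L\<close>; starting from an occurrence of \<open>L\<close> after \<tau>, they lead
  back to \<open>L\<close> with minima \<open>L\<close>.\<close>

lemma no_overflow:
  assumes fin: "\<And>j. finite {M. Lge bm bs v j M}"
  shows "gseg bm bs v (bm' bm bs v) (bs' bm bs v)"
    "gseg bm bs (bs' bm bs v) (bs' bm bs v) (bs' bm bs v)"
proof -
  define L where "L = bs' bm bs v"
  have L: "Lge bm bs v j M \<longleftrightarrow> M \<le> L j" for j M
  proof
    show "Lge bm bs v j M \<Longrightarrow> M \<le> L j" unfolding L_def bs'_def lv_def using fin[of j] by (simp add: Max_ge)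
    have "L j \<in> {M. Lge bm bs v j M}"
      unfolding L_def bs'_def lv_def using fin[of j] Lge_0[of j] by (metis (mono_tags) Max_in empty_iff mem_Collect_eq)
    then show "M \<le> L j \<Longrightarrow> Lge bm bs v j M" using Lge_mono by blast
  qed
  have supL: "L j = 0" if "j > N" for j
  proof -
    have "f b j = 0" for b using run_supp(2)[of b] that by (simp add: supp_def)
    then show ?thesis using L[of j "L j"] unfolding Lge_iff by auto
  qed
  have "\<exists>b\<in>T. om0 \<le> b \<and> (\<forall>c\<in>T. b \<le> c \<longrightarrow> L j \<le> f c j)" for j
    using L[of j "L j"] unfolding Lge_iff by simp
  then obtain \<tau> where \<tau>T: "\<tau> \<in> T"
    and "\<And>j. j \<le> N \<Longrightarrow> \<exists>b'\<le>\<tau>. \<forall>c\<in>T. b' \<le> c \<longrightarrow> L j \<le> f c j"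
    using finite_bound[of om0 "\<lambda>j b. \<forall>c\<in>T. b \<le> c \<longrightarrow> L j \<le> f c j"] T_om0 by blast
  then have \<tau>: "L j \<le> f c j" if "c \<in> T" "\<tau> \<le> c" for c j
    using that supL[of j] by (cases "j \<le> N") (auto dest: order_trans)
  have hit: "\<exists>b\<in>T. a \<le> b \<and> f b j = L j" if a: "a \<in> T" for a j
  proof -
    have "\<not> Lge bm bs v j (Suc (L j))" using L[of j "Suc (L j)"] by simp
    moreover have "max a \<tau> \<in> T" using a \<tau>T by (simp add: max_def)
    ultimately obtain b where "b \<in> T" "max a \<tau> \<le> b" "\<not> Suc (L j) \<le> f b j" unfolding Lge_iff by blast
    then show ?thesis using \<tau>[of b j] by (intro bexI[of _ b]) auto
  qed
  have seg: "\<exists>b\<in>T. a < b \<and> ismin f {a..<b} L" if a: "a \<in> T" "\<tau> \<le> a" for a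
  proof -
    obtain b where b: "b \<in> T" "\<And>j. j \<le> N \<Longrightarrow> \<exists>b'. a \<le> b' \<and> b' \<le> b \<and> f b' j = L j"
      using finite_bound[of a "\<lambda>j b. f b j = L j"] hit[OF a(1)] a(1) by blast
    have ab: "a \<le> b" using b(2)[of 0] by auto
    have "\<exists>t\<in>{a..<osuc b}. L j = f t j" for j
    proof (cases "j \<le> N")
      case True
      then show ?thesis using b(2)[of j] by (auto simp: less_osuc_iff intro!: bexI)
    next
      case False
      then have "f b j = 0" using run_supp(2)[of b] by (simp add: supp_def)
      then show ?thesis using supL[of j] False ab by (intro bexI[of _ b]) (auto simp: less_osuc_iff)
    qed
    moreover have "L j \<le> f t j" if "t \<in> {a..<osuc b}" for t j
      using that a(2) T_down[OF b(1)] by (intro \<tau>) (auto simp: less_osuc_iff)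
    ultimately have "ismin f {a..<osuc b} L" unfolding ismin_def by blast
    then show ?thesis using T_osuc[OF b(1)] ab by (intro bexI[of _ "osuc b"]) (auto simp: less_osuc_iff)
  qed
  have chains: "vchain bm bs L (r a) i" if "a \<in> T" "\<tau> \<le> a" for a i
    using that
  proof (induction i arbitrary: a)
    case 0
    show ?case by (rule vreach_vchain.nil)
  next
    case (Suc i)
    obtain b where b: "b \<in> T" "a < b" "ismin f {a..<b} L" using seg Suc.prems by blast
    then have "vreach bm bs (r a) L (r b)" using vreach_iff[OF Suc.prems(1)] by blast
    moreover have "vchain bm bs L (r b) i" using Suc.IH[of b] Suc.prems(2) b by auto
    ultimately show ?case by (rule vreach_vchain.cons)
  qed
  have ret: "vreach bm bs (r a) L L" if "a \<in> T" "\<tau> \<le> a" for a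
    using chains[OF that] by (rule vreach_vchain.lim)
  obtain b where b: "b \<in> T" "\<tau> < b" "r b = L" using ret[OF \<tau>T] vreach_iff[OF \<tau>T] by blast
  have "vreach bm bs L L L" using ret[of b] b by auto
  then show "gseg bm bs (bs' bm bs v) (bs' bm bs v) (bs' bm bs v)" unfolding L_def by (rule vreach_imp_gseg)
  obtain d where d: "d \<in> T" "\<And>j. j \<le> N \<Longrightarrow> \<exists>b'. b' \<le> d \<and> f b' j = bm' bm bs v j"
    using finite_bound[of om0 "\<lambda>j b. f b j = bm' bm bs v j"] bm'_min T_om0 by (metis om0_le)
  \<comment> \<open>By time \<open>d\<close> all minima over \<open>T\<close> have been attained, so
    the segment from the start to a return to \<open>L\<close> after \<open>?a\<close> has minima
    \<open>bm' bm bs v\<close>.\<close>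
  let ?a = "max \<tau> (osuc d)"
  have aT: "?a \<in> T" using \<tau>T T_osuc[OF d(1)] by (simp add: max_def)
  obtain b where b: "b \<in> T" "?a < b" "r b = L" using ret[OF aT] vreach_iff[OF aT] by auto
  have b0: "om0 < b" using b(2) by (metis om0_le order.strict_trans1)
  have "ismin f {om0..<b} (bm' bm bs v)"
    unfolding ismin_def
  proof (intro allI conjI ballI)
    fix j t assume "t \<in> {om0..<b}"
    then show "bm' bm bs v j \<le> f t j" using bm'_min[of j] T_down[OF b(1), of t] by auto
  next
    fix j
    show "\<exists>t\<in>{om0..<b}. bm' bm bs v j = f t j"
    proof (cases "j \<le> N")
      case True
      then obtain b' where "b' \<le> d" "f b' j = bm' bm bs v j" using d(2) by blast
      moreover have "d < b" using b(2) less_osuc[of d] by (metis max_less_iff_conj order.strict_trans)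
      ultimately show ?thesis by (intro bexI[of _ b']) auto
    next
      case False
      then have "f t j = 0" for t using run_supp(2)[of t] by (simp add: supp_def)
      then show ?thesis using bm'_min[of j] b0 by (metis atLeastLessThan_iff order_refl)
    qed
  qed
  then show "gseg bm bs v (bm' bm bs v) (bs' bm bs v)"
    using gseg_run[OF b0, of bm bs v] ismin_unique b(3) unfolding L_def by (metis run_om0)
qed

text \<open>If \<open>T\<close> were all of \<open>om1\<close>, one time would lie beyond the
  countably many times at which \<open>j0\<close> passes the bounds for good, and its value there
  would exceed every number. So \<open>T\<close> ends at some \<kappa>, which is a limit because
  \<open>T\<close> is closed under successors.\<close>

lemma overflow:
  assumes inf: "infinite {M. Lge bm bs v j0 M}"
  obtains \<kappa> where "om0 < \<kappa>" "\<And>b. b < \<kappa> \<Longrightarrow> osuc b < \<kappa>" "r \<kappa> = bs' bm bs v" "T = {..<\<kappa>}"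
    "gseg bm bs v (bm' bm bs v) (bs' bm bs v)"
proof -
  have all: "Lge bm bs v j0 M" for M
    using inf Lge_mono by (metis (mono_tags, lifting) finite_nat_set_iff_bounded_le linear mem_Collect_eq)
  have "T \<noteq> UNIV"
  proof
    assume T: "T = UNIV"
    then have "\<forall>M. \<exists>a. \<forall>b\<ge>a. M \<le> f b j0" using all unfolding Lge_iff by blast
    then obtain A where A: "\<And>M b. A M \<le> b \<Longrightarrow> M \<le> f b j0" by metis
    obtain b where "\<And>a. a \<in> range A \<Longrightarrow> a < b"
      using countable_bounded_om1[of "range A"] by (metis countableI_type countable_image)
    then have "M \<le> f b j0" for M using A[of M b] by (simp add: less_imp_le)
    from this[of "Suc (f b j0)"] show False by simp
  qed
  define \<kappa> where "\<kappa> = (LEAST b. b \<notin> T)"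
  have k: "\<kappa> \<notin> T" "\<And>b. b < \<kappa> \<Longrightarrow> b \<in> T"
    unfolding \<kappa>_def using \<open>T \<noteq> UNIV\<close> LeastI_ex[of "\<lambda>b. b \<notin> T"] not_less_Least[of _ "\<lambda>b. b \<notin> T"] by blast+
  then have T: "T = {..<\<kappa>}" using T_down by (auto simp: not_less[symmetric])
  have k0: "om0 < \<kappa>" using k(1) T_om0 T by auto
  have ks: "osuc b < \<kappa>" if "b < \<kappa>" for b using T_osuc that T by auto
  have rk: "r \<kappa> = bs' bm bs v"
    by (subst run_limit[OF k0 ks])
      (auto simp: bs'_def Lge_iff T Bex_def Ball_def intro!: ext arg_cong[of _ _ lv])
  have "ismin f {om0..<\<kappa>} (bm' bm bs v)"
  proof -
    have "{om0..<\<kappa>} = T" unfolding T by auto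
    then show ?thesis using bm'_min unfolding ismin_def by simp
  qed
  then have "gseg bm bs v (bm' bm bs v) (bs' bm bs v)"
    using gseg_run[OF k0, of bm bs v] ismin_unique rk by (metis run_om0)
  with that k0 ks rk T show ?thesis by blast
qed

text \<open>Some set \<open>S\<close> of zero components recurs cofinally below \<kappa>, since
  there are only finitely many sets. Its members have limit inferior 0 and are zero at \<kappa>. The
  overflowing \<open>j0\<close> is not one of them and becomes zero by the reset.\<close>

lemma overflow_zeros:
  assumes inf: "infinite {M. Lge bm bs v j0 M}"
    and k: "\<And>b. b \<in> T \<Longrightarrow> k \<le> card (zeros (bs (r b)))"
  shows "Suc k \<le> card (zeros (bs' bm bs v))"
proof -
  obtain \<kappa> where \<kappa>: "om0 < \<kappa>" "\<And>b. b < \<kappa> \<Longrightarrow> osuc b < \<kappa>" "T = {..<\<kappa>}" using overflow[OF inf] by metis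
  have "\<exists>S. k \<le> card S \<and> (\<forall>a<\<kappa>. \<exists>b<\<kappa>. a \<le> b \<and> zeros (r b) = S)"
  proof (rule ccontr)
    assume no: "\<not> ?thesis"
    define B where "B S = (SOME a. a < \<kappa> \<and> (\<forall>b<\<kappa>. a \<le> b \<longrightarrow> zeros (r b) \<noteq> S))" for S
    have B: "B S < \<kappa> \<and> (\<forall>b<\<kappa>. B S \<le> b \<longrightarrow> zeros (r b) \<noteq> S)" if "k \<le> card S" for S
      unfolding B_def by (rule someI_ex) (use no that in blast)
    let ?F = "{S. S \<subseteq> {..N} \<and> k \<le> card S}"
    have F: "finite ?F" by simp
    \<comment> \<open>\<open>c\<close> lies at or beyond the bounds for all sets that do not recur.
      The hypothesis counts zeros after a move, so the contradiction is found at
      \<open>osuc c\<close>.\<close>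
    define c where "c = Max (insert om0 (B ` ?F))"
    have "c \<in> insert om0 (B ` ?F)" unfolding c_def using F by (intro Max_in) auto
    then have "c < \<kappa>" using B \<kappa>(1) by auto
    then have oc: "osuc c < \<kappa>" "c \<in> T" using \<kappa> by auto
    let ?S = "zeros (r (osuc c))"
    have "?S \<in> ?F" using k[OF oc(2)] by (auto simp: zeros_def)
    then have "B ?S \<le> c" unfolding c_def using F by (intro Max_ge) auto
    then have "B ?S \<le> osuc c" using less_osuc[of c] by order
    then show False using B[of ?S] \<open>?S \<in> ?F\<close> oc(1) by blast
  qed
  then obtain S where S: "k \<le> card S" "\<And>a. a < \<kappa> \<Longrightarrow> \<exists>b<\<kappa>. a \<le> b \<and> zeros (r b) = S" by blast
  have SN: "S \<subseteq> {..N}" using S(2)[OF \<kappa>(1)] by (auto simp: zeros_def)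
  have zero: "{M. Lge bm bs v j M} = {0}" if "j \<in> S" for j
  proof -
    have "M = 0" if M: "Lge bm bs v j M" for M
    proof -
      obtain a where a: "a < \<kappa>" "\<And>b. b < \<kappa> \<Longrightarrow> a \<le> b \<Longrightarrow> M \<le> f b j" using M unfolding Lge_iff \<kappa>(3) by auto
      obtain b where b: "b < \<kappa>" "a \<le> b" "zeros (r b) = S" using S(2)[OF a(1)] by blast
      then have "r b j = 0" using \<open>j \<in> S\<close> by (auto simp: zeros_def)
      then show ?thesis using a(2)[OF b(1,2)] bm_le[of "r b" j] by simp
    qed
    then show ?thesis using Lge_0[of j] by auto
  qed
  have j0: "j0 \<notin> S"
  proof
    assume "j0 \<in> S"
    then have "{M. Lge bm bs v j0 M} = {0}" by (rule zero)
    then show False using inf by simp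
  qed
  have "insert j0 S \<subseteq> zeros (bs' bm bs v)"
    using zero SN overflow_le[OF inf] lv_infinite[OF inf] by (auto simp: zeros_def bs'_def lv_def)
  then have "card (insert j0 S) \<le> card (zeros (bs' bm bs v))"
    by (rule card_mono[rotated]) (simp add: zeros_def)
  then show ?thesis using S(1) j0 finite_subset[OF SN] by simp
qed

end

end


section \<open>Halting is decided after finitely many levels\<close>

fun regs_le :: "nat \<Rightarrow> instr \<Rightarrow> bool" where
  "regs_le N (Zero n) \<longleftrightarrow> Suc n \<le> N"
| "regs_le N (Succ n) \<longleftrightarrow> Suc n \<le> N"
| "regs_le N (Transfer m n) \<longleftrightarrow> Suc m \<le> N \<and> Suc n \<le> N"
| "regs_le N (Jump m n q) \<longleftrightarrow> Suc m \<le> N \<and> Suc n \<le> N"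
| "regs_le N (Query n) \<longleftrightarrow> Suc n \<le> N"

lemma regs_le_mono: "regs_le N i \<Longrightarrow> N \<le> N' \<Longrightarrow> regs_le N' i"
  by (cases i) auto

lemma regs_le_ex: "\<exists>N\<ge>1. \<forall>i\<in>set P. regs_le N i"
proof (induction P)
  case (Cons a P)
  then obtain N where N: "N \<ge> 1" "\<forall>i\<in>set P. regs_le N i" by blast
  have "\<exists>M. regs_le M a" by (cases a) (auto, (meson max.cobounded1 max.cobounded2)+)
  then obtain M where "regs_le M a" by blast
  then show ?case using N regs_le_mono by (intro exI[of _ "max N M"]) (auto intro: regs_le_mono)
qed auto

lemma stp_supp:
  assumes "\<forall>i\<in>set P. regs_le N i" "supp N v"
  shows "supp N (stp P x v)"
proof (cases "length P \<le> v 0")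
  case True
  then show ?thesis using assms(2) by (simp add: stp_def step_def halted_def)
next
  case False
  then have "regs_le N (P ! v 0)" using assms(1) by simp
  then show ?thesis using assms(2) False
    by (cases "P ! v 0") (auto simp: stp_def step_def halted_def supp_def split: nat.split)
qed

lemma stp_halted: "length P \<le> v 0 \<Longrightarrow> stp P x v = v"
  by (simp add: stp_def step_def halted_def)

lemma pseg_halted: "pseg P x v m w \<Longrightarrow> length P \<le> v 0 \<Longrightarrow> m = v \<and> w = v"
proof (induction rule: gseg.induct)
  case (lim s m m')
  have s: "s i = s 0" for i
  proof (induction i)
    case (Suc i)
    then have "length P \<le> s i 0" using lim.prems by simp
    then show ?case using lim.IH[of i] Suc by simp
  qed simp
  then have m: "m i = s 0" for i using lim.IH[of i] lim.prems by metis
  then have "m' = s 0" using lim.hyps(2) unfolding ismin_def by (intro ext) (metis UNIV_I)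
  moreover have "limvec m = s 0" unfolding limvec_def m by (simp add: fun_eq_iff)
  ultimately show ?case by simp
qed (auto simp: stp_halted)

definition final :: "program \<Rightarrow> nat set \<Rightarrow> vec \<Rightarrow> bool" where
  "final P x w \<longleftrightarrow> (\<forall>m u. pseg P x w m u \<longrightarrow> length P \<le> u 0 \<longrightarrow> length P \<le> w 0)"

lemma final_pseg: "final P x w \<Longrightarrow> pseg P x w m w' \<Longrightarrow> final P x w'"
  unfolding final_def
proof (intro allI impI)
  fix m' u
  assume fin: "\<forall>m u. pseg P x w m u \<longrightarrow> length P \<le> u 0 \<longrightarrow> length P \<le> w 0"
    and w': "pseg P x w m w'" and u: "pseg P x w' m' u" "length P \<le> u 0"
  have "length P \<le> w 0" using fin gseg.trans[OF w' u(1)] u(2) by blast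
  then show "length P \<le> w' 0" using pseg_halted[OF w'] by simp
qed

text \<open>While the loop repeats, no component falls below \<open>L\<close>, so limits of returns
  to \<open>L\<close> are again \<open>L\<close>, and the run returns to \<open>L\<close> after
  every time. In particular it does so after halting, where the state no longer changes.\<close>

lemma loop_final:
  assumes loop: "pseg P x L L L"
  shows "final P x L"
  unfolding final_def
proof (intro allI impI)
  fix m u assume u: "pseg P x L m u" "length P \<le> u 0"
  let ?r = "run (\<lambda>v. v) (stp P x) L"
  have again: "\<exists>b\<ge>a. ?r b = L \<and> (\<forall>c<b. \<forall>j. L j \<le> ?r c j)" for a
  proof (induction a rule: less_induct)
    case (less a)
    show ?case
    proof (cases rule: om1_cases[of a])
      case 1
      then show ?thesis using not_less_om0 by (intro exI[of _ om0]) auto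
    next
      case (2 s)
      then obtain b where b: "b \<ge> s" "?r b = L" "\<forall>c<b. \<forall>j. L j \<le> ?r c j" using less[of s] by auto
      obtain d where d: "b < d" "?r d = L" "ismin ?r {b..<d} L" using gseg_sound[OF loop b(2)] by blast
      have "L j \<le> ?r c j" if "c < d" for c j
        using b(3) d(3) that unfolding ismin_def by (cases "c < b") auto
      moreover have "a \<le> d" using 2 b(1) d(1) by (simp add: osuc_le_iff)
      ultimately show ?thesis using d(2) by blast
    next
      case 3
      \<comment> \<open>Either a return found for an earlier time already lies at \<open>a\<close>
        or later, or the returns are cofinal in \<open>a\<close> and determine the limit
        state.\<close>
      show ?thesis
      proof (cases "\<exists>s<a. \<exists>b\<ge>a. ?r b = L \<and> (\<forall>c<b. \<forall>j. L j \<le> ?r c j)")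
        case True
        then show ?thesis by blast
      next
        case False
        have hit: "\<exists>b. s \<le> b \<and> b < a \<and> ?r b = L \<and> (\<forall>c<b. \<forall>j. L j \<le> ?r c j)" if "s < a" for s
          using less[OF that] False that by (meson not_le)
        have low: "L j \<le> ?r c j" if "c < a" for c j
          using hit[OF 3(2)[OF that]] by (metis osuc_le_iff)
        have "(\<exists>s<a. \<forall>t. s \<le> t \<and> t < a \<longrightarrow> M \<le> ?r t j) \<longleftrightarrow> M \<le> L j" for M j
        proof
          assume "\<exists>s<a. \<forall>t. s \<le> t \<and> t < a \<longrightarrow> M \<le> ?r t j"
          then obtain s where s: "s < a" "\<forall>t. s \<le> t \<and> t < a \<longrightarrow> M \<le> ?r t j" by blast
          from hit[OF s(1)] s(2) show "M \<le> L j" by auto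
        next
          assume "M \<le> L j"
          then show "\<exists>s<a. \<forall>t. s \<le> t \<and> t < a \<longrightarrow> M \<le> ?r t j" using low 3(1) le_trans by blast
        qed
        then have "?r a = L" by (simp add: run_limit[OF 3])
        then show ?thesis using low by blast
      qed
    qed
  qed
  obtain h where h: "om0 < h" "?r h = u" using gseg_sound[OF u(1) run_om0] by blast
  obtain b where b: "b \<ge> h" "?r b = L" using again by blast
  show "length P \<le> L 0"
  proof (cases "b = h")
    case False
    then have "h < b" using b(1) by simp
    then show ?thesis using gseg_run[of h b "\<lambda>v. v" "stp P x" L] h(2) b(2) pseg_halted[of P x u _ L] u(2) by metis
  qed (use h b u in auto)
qed

primrec level :: "program \<Rightarrow> nat set \<Rightarrow> nat \<Rightarrow> (vec \<Rightarrow> vec) \<times> (vec \<Rightarrow> vec)" where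
  "level P x 0 = (\<lambda>v. v, stp P x)"
| "level P x (Suc k) = (bm' (fst (level P x k)) (snd (level P x k)), bs' (fst (level P x k)) (snd (level P x k)))"

lemma gseg_flatten:
  assumes "gseg bm bs v m w" "supp N v"
    and "\<And>v. supp N v \<Longrightarrow> gseg bm0 bs0 v (bm v) (bs v)"
    and "gmachine bm bs N"
  shows "gseg bm0 bs0 v m w"
  using assms(1,2)
proof (induction rule: gseg.induct)
  case (step v)
  then show ?case using assms(3) by blast
next
  case (trans v m w m' u)
  then show ?case using gmachine.gseg_supp[OF assms(4)] gseg.trans by blast
next
  case (lim s m m')
  have "supp N (s i)" for i
    by (induction i) (use lim gmachine.gseg_supp[OF assms(4)] in blast)+
  then show ?case using lim gseg.lim by blast
qed

context
  fixes P :: program and x :: "nat set" and N :: nat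
  assumes P: "\<forall>i\<in>set P. regs_le N i"
begin

text \<open>A move of the next level ends in a loop, which is final, or at an overflow. In the
  latter case it has passed a final state, and finality persists, or all moves below the overflow
  end with at least \<open>k\<close> zeros, and the overflow adds one.\<close>

lemma level_props:
  "gmachine (fst (level P x k)) (snd (level P x k)) N \<and>
   (\<forall>v. supp N v \<longrightarrow> pseg P x v (fst (level P x k) v) (snd (level P x k) v)) \<and>
   (\<forall>v. supp N v \<longrightarrow> k \<le> card {j. j \<le> N \<and> snd (level P x k) v j = 0} \<or> final P x (snd (level P x k) v))"
proof (induction k)
  case 0
  show ?case using stp_supp[OF P] gseg.step by (auto simp: gmachine_def)
next
  case (Suc k)
  define bm bs where "bm = fst (level P x k)" and "bs = snd (level P x k)"
  have gm: "gmachine bm bs N" and seg: "\<And>v. supp N v \<Longrightarrow> pseg P x v (bm v) (bs v)"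
    and z: "\<And>v. supp N v \<Longrightarrow> k \<le> card {j. j \<le> N \<and> bs v j = 0} \<or> final P x (bs v)"
    using Suc unfolding bm_def bs_def by blast+
  interpret gmachine bm bs N by (rule gm)
  have flat: "pseg P x v m w" if "gseg bm bs v m w" "supp N v" for v m w
    using gseg_flatten[OF that seg gm] .
  have seg': "gseg bm bs v (bm' bm bs v) (bs' bm bs v)" if "supp N v" for v
    using no_overflow(1)[OF that] overflow[OF that] by metis
  have "bm' bm bs v j \<le> v j" for v j
  proof -
    have "bm' bm bs v j \<le> bm v j"
      unfolding bm'_def by (rule Least_le) (use vreach_vchain.base in blast)
    then show ?thesis using bm_le le_trans by blast
  qed
  moreover have "supp N (bs' bm bs v)" if "supp N v" for v
    using gseg_supp[OF seg'[OF that] that] by blast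
  ultimately have "gmachine (bm' bm bs) (bs' bm bs) N" by (simp add: gmachine_def)
  moreover have "pseg P x v (bm' bm bs v) (bs' bm bs v)" if "supp N v" for v
    using flat seg' that by blast
  moreover have "Suc k \<le> card {j. j \<le> N \<and> bs' bm bs v j = 0} \<or> final P x (bs' bm bs v)" if v: "supp N v" for v
  proof (cases "\<forall>j. finite {M. Lge bm bs v j M}")
    case True
    then have "gseg bm bs (bs' bm bs v) (bs' bm bs v) (bs' bm bs v)" using no_overflow(2)[OF v] by blast
    then have "pseg P x (bs' bm bs v) (bs' bm bs v) (bs' bm bs v)"
      using flat gseg_supp[OF seg'[OF v] v] by blast
    then show ?thesis using loop_final by blast
  next
    case False
    then obtain j0 where inf: "infinite {M. Lge bm bs v j0 M}" by blast
    obtain \<kappa> where \<kappa>: "om0 < \<kappa>" "\<And>b. b < \<kappa> \<Longrightarrow> osuc b < \<kappa>" "run bm bs v \<kappa> = bs' bm bs v" "T v = {..<\<kappa>}"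
      using overflow[OF v inf] by metis
    show ?thesis
    proof (cases "\<exists>b<\<kappa>. final P x (bs (run bm bs v b))")
      case True
      then obtain b where b: "b < \<kappa>" "final P x (run bm bs v (osuc b))" by auto
      obtain m where "gseg bm bs (run bm bs v (osuc b)) m (run bm bs v \<kappa>)"
        using gseg_run[OF \<kappa>(2)[OF b(1)]] by blast
      then have "pseg P x (run bm bs v (osuc b)) m (bs' bm bs v)"
        using flat run_supp(1)[OF v] \<kappa>(3) by metis
      then show ?thesis using final_pseg[OF b(2)] by blast
    next
      case False
      then have "k \<le> card (zeros (bs (run bm bs v b)))" if "b \<in> T v" for b
        using z[OF run_supp(1)[OF v], of b] that \<kappa>(4) by (auto simp: zeros_def)
      from overflow_zeros[OF v inf this] show ?thesis by (simp add: zeros_def)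
    qed
  qed
  ultimately show ?case by (simp add: bm_def bs_def)
qed

text \<open>Among the \<open>N + 1\<close> components there cannot be \<open>N + 2\<close> zeros, so
  the move of level \<open>N + 2\<close> from the initial state ends in a final state
  \<open>w\<close>. A halted state before \<open>w\<close> persists up to \<open>w\<close>; one
  after \<open>w\<close> can only occur if \<open>w\<close> is halted.\<close>

lemma halts_with_iff_level:
  "halts_with P x k \<longleftrightarrow> length P \<le> snd (level P x (N + 2)) (\<lambda>_. 0) 0 \<and> snd (level P x (N + 2)) (\<lambda>_. 0) 1 = k"
proof -
  define w where "w = snd (level P x (N + 2)) (\<lambda>_. 0)"
  have s: "supp N (\<lambda>_. 0)" by (simp add: supp_def)
  have "card {j. j \<le> N \<and> w j = 0} \<le> card {..N}" by (rule card_mono) auto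
  then have fin: "final P x w" and seg: "pseg P x (\<lambda>_. 0) (fst (level P x (N + 2)) (\<lambda>_. 0)) w"
    using level_props[of "N + 2"] s unfolding w_def by fastforce+
  let ?r = "run (\<lambda>v. v) (stp P x) (\<lambda>_. 0)"
  obtain b where b: "?r b = w" using gseg_sound[OF seg run_om0] by blast
  have "halts_with P x k \<longleftrightarrow> length P \<le> w 0 \<and> w 1 = k"
  proof
    assume "halts_with P x k"
    then obtain m u where u: "pseg P x (\<lambda>_. 0) m u" "length P \<le> u 0" "u 1 = k"
      unfolding halts_with_iff_pseg by blast
    obtain a where a: "?r a = u" using gseg_sound[OF u(1) run_om0] by blast
    consider "a = b" | "a < b" | "b < a" by force
    then have "w = u"
    proof cases
      case 2
      then show ?thesis using gseg_run[of a b "\<lambda>v. v" "stp P x" "\<lambda>_. 0"] a b pseg_halted[of P x u _ w] u(2) by metis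
    next
      case 3
      then obtain m' where m': "pseg P x w m' u" using gseg_run[of b a "\<lambda>v. v" "stp P x" "\<lambda>_. 0"] a b by metis
      then have "length P \<le> w 0" using fin u(2) unfolding final_def by blast
      then show ?thesis using pseg_halted[OF m'] by blast
    qed (use a b in simp)
    then show "length P \<le> w 0 \<and> w 1 = k" using u by simp
  next
    assume "length P \<le> w 0 \<and> w 1 = k"
    then show "halts_with P x k" unfolding halts_with_iff_pseg using seg by blast
  qed
  then show ?thesis by (simp add: w_def)
qed

end

section \<open>Halting is tame\<close>

definition comp :: "nat \<Rightarrow> nat \<Rightarrow> nat" where
  "comp c j = pfst ((psnd ^^ j) c)"

text \<open>Every number is a code, and only its first \<open>N + 1\<close> components count. A
  vector has many codes, so equality of vectors is expressed by \<open>vc N\<close> instead of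
  equality of codes.\<close>

definition vc :: "nat \<Rightarrow> nat \<Rightarrow> vec" where
  "vc N c = (\<lambda>j. if j \<le> N then comp c j else 0)"

lemma itrm_comp_fn: "itrm_fn (\<lambda>x. A) \<Longrightarrow> itrm_fn (\<lambda>x. B) \<Longrightarrow> itrm_fn (\<lambda>x n. comp (A n) (B n))"
  unfolding comp_def by (intro itrm_pfst itrm_iterate itrm_psnd itrm_id)

lemma vc_supp [simp]: "supp N (vc N c)"
  by (simp add: supp_def vc_def)

lemma comp_push [simp]: "comp (prod_encode (a, c)) 0 = a" "comp (prod_encode (a, c)) (Suc j) = comp c j"
  by (simp_all add: comp_def funpow_swap1)

lemma vc_surj:
  assumes "supp N v"
  obtains c where "vc N c = v"
proof -
  have "\<exists>c. \<forall>j\<le>n. comp c j = v j" for n and v :: vec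
  proof (induction n arbitrary: v)
    case 0
    show ?case by (rule exI[of _ "prod_encode (v 0, 0)"]) simp
  next
    case (Suc n)
    obtain c where c: "\<forall>j\<le>n. comp c j = v (Suc j)" using Suc[of "\<lambda>j. v (Suc j)"] by blast
    have "comp (prod_encode (v 0, c)) j = v j" if "j \<le> Suc n" for j using that c by (cases j) auto
    then show ?case by blast
  qed
  then obtain c where "\<forall>j\<le>N. comp c j = v j" by blast
  then have "vc N c = v" using assms by (auto simp: vc_def supp_def)
  then show ?thesis using that by blast
qed

lemma vc_0: "vc N 0 = (\<lambda>_. 0)"
proof -
  have "psnd 0 = 0" "pfst 0 = 0" using pair_simps(2)[of 0 0] by (simp_all add: prod_encode_def)
  then have "(psnd ^^ j) 0 = 0" for j by (induction j) auto
  then show ?thesis by (simp add: vc_def comp_def \<open>pfst 0 = 0\<close> fun_eq_iff)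
qed

lemma vc_eq_iff: "vc N c = vc N d \<longleftrightarrow> (\<forall>j. j \<le> N \<longrightarrow> comp c j = comp d j)"
  by (auto simp: vc_def fun_eq_iff)

lemma vc_eq_supp: "supp N v \<Longrightarrow> vc N c = v \<longleftrightarrow> (\<forall>j. j \<le> N \<longrightarrow> comp c j = v j)"
  by (auto simp: vc_def supp_def fun_eq_iff)

lemmas tame_intros = tame.K_intros tame.K_le tame.K_eq itrm_intros itrm_comp_fn

lemma tame_query_comp: "itrm_fn (\<lambda>x. A) \<Longrightarrow> tame (\<lambda>x n. A n \<in> x)"
  by (rule tame_comp[OF tame_query])

lemma tame_vc_eq: "itrm_fn (\<lambda>x. A) \<Longrightarrow> itrm_fn (\<lambda>x. B) \<Longrightarrow> tame (\<lambda>x n. vc N (A n) = vc N (B n))"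
  unfolding vc_eq_iff
  by (rule tame.K_comp2[of "\<lambda>x a b. \<forall>j. j \<le> N \<longrightarrow> comp a j = comp b j"], intro tame_intros)

lemma tame_finite_ex:
  assumes "\<And>l. l \<in> set ls \<Longrightarrow> tame (\<lambda>x n. R l x n)"
  shows "tame (\<lambda>x n. \<exists>l\<in>set ls. R l x n)"
  using assms
proof (induction ls)
  case Nil
  have "tame (\<lambda>x n. (0::nat) = 1)" by (intro tame_intros)
  then show ?case by simp
next
  case (Cons l ls)
  have "tame (\<lambda>x n. R l x n \<or> (\<exists>l\<in>set ls. R l x n))"
    using Cons by (intro tame.K_disj) auto
  then show ?case by simp
qed

subsection \<open>Single steps\<close>

lemma vc_upd_iff:
  assumes "Suc r \<le> N"
  shows "vc N w = case_nat l ((\<lambda>n. vc N c (Suc n))(r := y)) \<longleftrightarrow>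
    comp w 0 = l \<and> comp w (Suc r) = y \<and>
    (\<forall>j. j \<le> N \<longrightarrow> j \<noteq> 0 \<longrightarrow> j \<noteq> Suc r \<longrightarrow> comp w j = comp c j)"
proof -
  have "supp N (case_nat l ((\<lambda>n. vc N c (Suc n))(r := y)))"
    using assms by (auto simp: supp_def vc_def split: nat.split)
  then have "vc N w = case_nat l ((\<lambda>n. vc N c (Suc n))(r := y)) \<longleftrightarrow>
      (\<forall>j. j \<le> N \<longrightarrow> comp w j = case_nat l ((\<lambda>n. vc N c (Suc n))(r := y)) j)"
    by (rule vc_eq_supp)
  also have "\<dots> \<longleftrightarrow> comp w 0 = l \<and> comp w (Suc r) = y \<and>
    (\<forall>j. j \<le> N \<longrightarrow> j \<noteq> 0 \<longrightarrow> j \<noteq> Suc r \<longrightarrow> comp w j = comp c j)"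
    using assms by (auto simp: vc_def split: nat.split) (metis gr0_conv_Suc)
  finally show ?thesis .
qed

lemma vc_jump_iff:
  "vc N w = case_nat l (\<lambda>n. vc N c (Suc n)) \<longleftrightarrow>
    comp w 0 = l \<and> (\<forall>j. j \<le> N \<longrightarrow> j \<noteq> 0 \<longrightarrow> comp w j = comp c j)"
proof -
  have "supp N (case_nat l (\<lambda>n. vc N c (Suc n)))"
    by (auto simp: supp_def vc_def split: nat.split)
  then have "vc N w = case_nat l (\<lambda>n. vc N c (Suc n)) \<longleftrightarrow>
      (\<forall>j. j \<le> N \<longrightarrow> comp w j = case_nat l (\<lambda>n. vc N c (Suc n)) j)"
    by (rule vc_eq_supp)
  also have "\<dots> \<longleftrightarrow> comp w 0 = l \<and> (\<forall>j. j \<le> N \<longrightarrow> j \<noteq> 0 \<longrightarrow> comp w j = comp c j)"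
    by (auto simp: vc_def split: nat.split) (metis gr0_conv_Suc)
  finally show ?thesis .
qed

lemma tame_exec:
  assumes "regs_le N i"
  shows "tame (\<lambda>g n. vc N (psnd n) = vec_of (exec g i (vc N (pfst n) 0, \<lambda>r. vc N (pfst n) (Suc r))))"
proof (cases i)
  case (Zero r)
  have le: "Suc r \<le> N" using assms Zero by simp
  have "vc N w = vec_of (exec g i (vc N c 0, \<lambda>r. vc N c (Suc r))) \<longleftrightarrow>
     comp w 0 = Suc (comp c 0) \<and> comp w (Suc r) = 0 \<and>
     (\<forall>j. j \<le> N \<longrightarrow> j \<noteq> 0 \<longrightarrow> j \<noteq> Suc r \<longrightarrow> comp w j = comp c j)" for w c g
    unfolding Zero exec.simps vec_of_simps vc_upd_iff[OF le] using le by (auto simp: vc_def)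
  then show ?thesis by (simp only:) (intro tame_intros)
next
  case (Succ r)
  have le: "Suc r \<le> N" using assms Succ by simp
  have "vc N w = vec_of (exec g i (vc N c 0, \<lambda>r. vc N c (Suc r))) \<longleftrightarrow>
     comp w 0 = Suc (comp c 0) \<and> comp w (Suc r) = Suc (comp c (Suc r)) \<and>
     (\<forall>j. j \<le> N \<longrightarrow> j \<noteq> 0 \<longrightarrow> j \<noteq> Suc r \<longrightarrow> comp w j = comp c j)" for w c g
    unfolding Succ exec.simps vec_of_simps vc_upd_iff[OF le] using le by (auto simp: vc_def)
  then show ?thesis by (simp only:) (intro tame_intros)
next
  case (Transfer q r)
  have le: "Suc q \<le> N" "Suc r \<le> N" using assms Transfer by simp_all
  have "vc N w = vec_of (exec g i (vc N c 0, \<lambda>r. vc N c (Suc r))) \<longleftrightarrow>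
     comp w 0 = Suc (comp c 0) \<and> comp w (Suc r) = comp c (Suc q) \<and>
     (\<forall>j. j \<le> N \<longrightarrow> j \<noteq> 0 \<longrightarrow> j \<noteq> Suc r \<longrightarrow> comp w j = comp c j)" for w c g
    unfolding Transfer exec.simps vec_of_simps vc_upd_iff[OF le(2)] using le by (auto simp: vc_def)
  then show ?thesis by (simp only:) (intro tame_intros)
next
  case (Jump q r l)
  have le: "Suc q \<le> N" "Suc r \<le> N" using assms Jump by simp_all
  have "vc N w = vec_of (exec g i (vc N c 0, \<lambda>r. vc N c (Suc r))) \<longleftrightarrow>
     ((comp c (Suc q) = comp c (Suc r) \<longrightarrow> comp w 0 = l) \<and>
      (comp c (Suc q) \<noteq> comp c (Suc r) \<longrightarrow> comp w 0 = Suc (comp c 0))) \<and>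
      (\<forall>j. j \<le> N \<longrightarrow> j \<noteq> 0 \<longrightarrow> comp w j = comp c j)" for w c g
    unfolding Jump exec.simps vec_of_simps vc_jump_iff using le by (auto simp: vc_def)
  then show ?thesis by (simp only:) (intro tame_intros)
next
  case (Query r)
  have le: "Suc r \<le> N" using assms Query by simp
  have "vc N w = vec_of (exec g i (vc N c 0, \<lambda>r. vc N c (Suc r))) \<longleftrightarrow>
     comp w 0 = Suc (comp c 0) \<and> (comp c (Suc r) \<in> g \<longrightarrow> comp w (Suc r) = 1) \<and>
     (comp c (Suc r) \<notin> g \<longrightarrow> comp w (Suc r) = 0) \<and>
     (\<forall>j. j \<le> N \<longrightarrow> j \<noteq> 0 \<longrightarrow> j \<noteq> Suc r \<longrightarrow> comp w j = comp c j)" for w c g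
    unfolding Query exec.simps vec_of_simps vc_upd_iff[OF le] using le by (auto simp: vc_def)
  then show ?thesis by (simp only:) (intro tame_intros tame_query_comp)
qed

lemma tame_stp:
  assumes "\<forall>i\<in>set P. regs_le N i"
  shows "tame (\<lambda>g n. vc N (psnd n) = stp P g (vc N (pfst n)))"
proof -
  have "vc N w = stp P g (vc N c) \<longleftrightarrow> (length P \<le> comp c 0 \<and> vc N w = vc N c) \<or>
     (\<exists>l\<in>set [0..<length P]. comp c 0 = l \<and>
        vc N w = vec_of (exec g (P ! l) (vc N c 0, \<lambda>r. vc N c (Suc r))))" for w g c
  proof -
    have "vc N c 0 = comp c 0" by (simp add: vc_def)
    then show ?thesis
      by (cases "length P \<le> comp c 0") (auto simp: stp_halted, auto simp: stp_def step_def halted_def)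
  qed
  moreover have "tame (\<lambda>g n. (length P \<le> comp (pfst n) 0 \<and> vc N (psnd n) = vc N (pfst n)) \<or>
     (\<exists>l\<in>set [0..<length P]. comp (pfst n) 0 = l \<and>
        vc N (psnd n) = vec_of (exec g (P ! l) (vc N (pfst n) 0, \<lambda>r. vc N (pfst n) (Suc r)))))"
  proof (intro tame.K_disj tame_finite_ex tame.K_conj)
    fix l assume "l \<in> set [0..<length P]"
    then show "tame (\<lambda>g n. vc N (psnd n) = vec_of (exec g (P ! l) (vc N (pfst n) 0, \<lambda>r. vc N (pfst n) (Suc r))))"
      using assms by (intro tame_exec) auto
  qed (intro tame_intros tame_vc_eq)+
  ultimately show ?thesis by simp
qed

subsection \<open>Levels\<close>

definition minrel :: "nat \<Rightarrow> nat \<Rightarrow> nat \<Rightarrow> nat \<Rightarrow> bool" where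
  "minrel N m m1 m2 \<longleftrightarrow> (\<forall>j. j \<le> N \<longrightarrow> (comp m1 j \<le> comp m2 j \<longrightarrow> comp m j = comp m1 j) \<and>
     (\<not> comp m1 j \<le> comp m2 j \<longrightarrow> comp m j = comp m2 j))"

lemma minrel_iff: "minrel N m m1 m2 \<longleftrightarrow> vc N m = (\<lambda>j. min (vc N m1 j) (vc N m2 j))"
  by (auto simp: minrel_def vc_def fun_eq_iff min_def)

lemma tame_minrel:
  "itrm_fn (\<lambda>x. A) \<Longrightarrow> itrm_fn (\<lambda>x. B) \<Longrightarrow> itrm_fn (\<lambda>x. C) \<Longrightarrow> tame (\<lambda>x n. minrel N (A n) (B n) (C n))"
  by (rule tame.K_comp3[of "\<lambda>x. minrel N"]; (unfold minrel_def, intro tame_intros)?)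

text \<open>
  Segments \<open>(0, (c, (m, w)))\<close> and chains \<open>(1, (L, (c, i)))\<close> on codes of vectors, where \<open>B c m w\<close> is
  the move relation.
\<close>

definition segN :: "nat \<Rightarrow> (nat \<Rightarrow> nat \<Rightarrow> nat \<Rightarrow> bool) \<Rightarrow> nat \<Rightarrow> nat \<Rightarrow> nat \<Rightarrow> bool" where
  "segN N B z a i \<longleftrightarrow>
     (pfst z = 0 \<and> pfst a = 0 \<and> B (pfst (psnd z)) (pfst (psnd (psnd z))) (psnd (psnd (psnd z)))) \<or>
     (pfst z = 1 \<and> psnd (psnd (psnd z)) = 0)"

definition segG :: "nat \<Rightarrow> nat \<Rightarrow> nat \<Rightarrow> nat \<Rightarrow> nat \<Rightarrow> bool" where
  "segG N z a i b \<longleftrightarrow>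
     (pfst z = 0 \<and> pfst a = 1 \<and>
        minrel N (pfst (psnd (psnd z))) (pfst (psnd a)) (psnd (psnd (psnd a))) \<and>
        ((i = 0 \<and> b = prod_encode (0, prod_encode (pfst (psnd z),
             prod_encode (pfst (psnd a), pfst (psnd (psnd a)))))) \<or>
         (i \<noteq> 0 \<and> b = prod_encode (0, prod_encode (pfst (psnd (psnd a)),
             prod_encode (psnd (psnd (psnd a)), psnd (psnd (psnd z)))))))) \<or>
     (pfst z = 0 \<and> pfst a = 2 \<and> vc N (pfst (psnd (psnd z))) = vc N (psnd (psnd (psnd z))) \<and>
        b = prod_encode (1, prod_encode (pfst (psnd (psnd z)), prod_encode (pfst (psnd z), i)))) \<or>
     (pfst z = 1 \<and> Suc (psnd a) = psnd (psnd (psnd z)) \<and>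
        ((i = 0 \<and> b = prod_encode (0, prod_encode (pfst (psnd (psnd z)),
             prod_encode (pfst (psnd z), pfst a)))) \<or>
         (i \<noteq> 0 \<and> b = prod_encode (1, prod_encode (pfst (psnd z), prod_encode (pfst a, psnd a))))))"

lemma seg_sound:
  assumes B: "\<And>c m w. B c m w \<longleftrightarrow> vc N m = bm (vc N c) \<and> vc N w = bs (vc N c)"
  shows "ind (segN N B) (segG N) z \<Longrightarrow>
    (pfst z = 0 \<longrightarrow> vreach bm bs (vc N (pfst (psnd z))) (vc N (pfst (psnd (psnd z)))) (vc N (psnd (psnd (psnd z))))) \<and>
    (pfst z = 1 \<longrightarrow> vchain bm bs (vc N (pfst (psnd z))) (vc N (pfst (psnd (psnd z)))) (psnd (psnd (psnd z))))"
proof (induction rule: ind.induct)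
  case (rule z a)
  show ?case
  proof (intro conjI impI)
    assume z: "pfst z = 0"
    let ?c = "pfst (psnd z)" and ?m = "pfst (psnd (psnd z))" and ?w = "psnd (psnd (psnd z))"
    consider "pfst a = 0" | "pfst a = 1" | "pfst a = 2" | "pfst a \<notin> {0, 1, 2}" by auto
    then show "vreach bm bs (vc N ?c) (vc N ?m) (vc N ?w)"
    proof cases
      case 1
      then have "B ?c ?m ?w" using rule[of 0] z by (auto simp: segN_def segG_def)
      then show ?thesis using vreach_vchain.base[of bm bs "vc N ?c"] by (simp add: B)
    next
      case 2
      let ?m1 = "pfst (psnd a)" and ?c1 = "pfst (psnd (psnd a))" and ?m2 = "psnd (psnd (psnd a))"
      have 1: "minrel N ?m ?m1 ?m2" "vreach bm bs (vc N ?c) (vc N ?m1) (vc N ?c1)"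
        using rule[of 0] z 2 by (auto simp: segN_def segG_def)
      have 2: "vreach bm bs (vc N ?c1) (vc N ?m2) (vc N ?w)"
        using rule[of 1] z 2 by (auto simp: segN_def segG_def)
      from vreach_vchain.trans[OF 1(2) 2] show ?thesis using 1(1) unfolding minrel_iff by simp
    next
      case 3
      have eq: "vc N ?m = vc N ?w" using rule[of 0] z 3 by (auto simp: segN_def segG_def)
      have "vchain bm bs (vc N ?m) (vc N ?c) i" for i
      proof -
        obtain b where b: "segG N z a i b" and v: "pfst b = 1 \<longrightarrow> vchain bm bs (vc N (pfst (psnd b)))
            (vc N (pfst (psnd (psnd b)))) (psnd (psnd (psnd b)))"
          using rule[of i] z 3 by (auto simp: segN_def)
        have "b = prod_encode (1, prod_encode (?m, prod_encode (?c, i)))"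
          using b z 3 by (simp add: segG_def)
        then show ?thesis using v by simp
      qed
      from vreach_vchain.lim[OF this] show ?thesis using eq by simp
    next
      case 4
      then show ?thesis using rule[of 0] z by (auto simp: segN_def segG_def)
    qed
  next
    assume z: "pfst z = 1"
    let ?L = "pfst (psnd z)" and ?c = "pfst (psnd (psnd z))" and ?i = "psnd (psnd (psnd z))"
    show "vchain bm bs (vc N ?L) (vc N ?c) ?i"
    proof (cases "?i = 0")
      case True
      then show ?thesis by (simp add: vreach_vchain.nil)
    next
      case False
      have 1: "Suc (psnd a) = ?i" "vreach bm bs (vc N ?c) (vc N ?L) (vc N (pfst a))"
        using rule[of 0] z False by (auto simp: segN_def segG_def)
      have 2: "vchain bm bs (vc N ?L) (vc N (pfst a)) (psnd a)"
        using rule[of 1] z False by (auto simp: segN_def segG_def)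
      from vreach_vchain.cons[OF 1(2) 2] show ?thesis using 1(1) by simp
    qed
  qed
qed

text \<open>All states and minima on the way are supported on the components up to \<open>N\<close>,
  hence have codes that can serve as parameters of the rules. The claim is made for all codes of the
  vectors, since a premise may present a vector by any of its codes.\<close>

lemma seg_complete:
  assumes B: "\<And>c m w. B c m w \<longleftrightarrow> vc N m = bm (vc N c) \<and> vc N w = bs (vc N c)"
    and gm: "gmachine bm bs N"
  shows "vreach bm bs v m w \<Longrightarrow> (\<forall>c cm cw. vc N c = v \<longrightarrow> vc N cm = m \<longrightarrow> vc N cw = w \<longrightarrow>
      ind (segN N B) (segG N) (prod_encode (0, prod_encode (c, prod_encode (cm, cw)))))"
    "vchain bm bs L v i \<Longrightarrow> (\<forall>cL c. vc N cL = L \<longrightarrow> vc N c = v \<longrightarrow>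
      ind (segN N B) (segG N) (prod_encode (1, prod_encode (cL, prod_encode (c, i)))))"
proof (induction rule: vreach_vchain.inducts)
  case (base v)
  show ?case
    by (intro allI impI ind.rule[where a = "prod_encode (0, 0)"]) (simp add: segN_def B)
next
  case (trans v m w m' u)
  show ?case
  proof (intro allI impI)
    fix c cm cw assume c: "vc N c = v" "vc N cm = (\<lambda>j. min (m j) (m' j))" "vc N cw = u"
    have s: "supp N v" using c(1) vc_supp by metis
    have s1: "supp N m \<and> supp N w" using gmachine.gseg_supp[OF gm] vreach_imp_gseg trans s by blast
    have s2: "supp N m'" using gmachine.gseg_supp[OF gm] vreach_imp_gseg trans s1 by blast
    obtain m1 where m1: "vc N m1 = m" using vc_surj s1 by blast
    obtain c1 where c1: "vc N c1 = w" using vc_surj s1 by blast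
    obtain m2 where m2: "vc N m2 = m'" using vc_surj s2 by blast
    have mr: "minrel N cm m1 m2" by (simp add: minrel_iff c m1 m2)
    have i1: "ind (segN N B) (segG N) (prod_encode (0, prod_encode (c, prod_encode (m1, c1))))"
      and i2: "ind (segN N B) (segG N) (prod_encode (0, prod_encode (c1, prod_encode (m2, cw))))"
      using trans c m1 c1 m2 by blast+
    show "ind (segN N B) (segG N) (prod_encode (0, prod_encode (c, prod_encode (cm, cw))))"
    proof (rule ind.rule[where a = "prod_encode (1, prod_encode (m1, prod_encode (c1, m2)))"])
      fix i
      show "segN N B (prod_encode (0, prod_encode (c, prod_encode (cm, cw))))
          (prod_encode (1, prod_encode (m1, prod_encode (c1, m2)))) i \<or>
        (\<exists>b. segG N (prod_encode (0, prod_encode (c, prod_encode (cm, cw))))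
          (prod_encode (1, prod_encode (m1, prod_encode (c1, m2)))) i b \<and> ind (segN N B) (segG N) b)"
        using i1 i2 mr by (cases "i = 0") (auto simp: segG_def)
    qed
  qed
next
  case (nil L v)
  show ?case by (intro allI impI ind.rule[where a = 0]) (simp add: segN_def)
next
  case (cons v L w i)
  show ?case
  proof (intro allI impI)
    fix cL c assume c: "vc N cL = L" "vc N c = v"
    have s: "supp N v" using c(2) vc_supp by metis
    have "supp N w" using gmachine.gseg_supp[OF gm] vreach_imp_gseg cons s by blast
    then obtain c1 where c1: "vc N c1 = w" using vc_surj by blast
    have i1: "ind (segN N B) (segG N) (prod_encode (0, prod_encode (c, prod_encode (cL, c1))))"
      and i2: "ind (segN N B) (segG N) (prod_encode (1, prod_encode (cL, prod_encode (c1, i))))"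
      using cons c c1 by blast+
    show "ind (segN N B) (segG N) (prod_encode (1, prod_encode (cL, prod_encode (c, Suc i))))"
    proof (rule ind.rule[where a = "prod_encode (c1, i)"])
      fix k
      show "segN N B (prod_encode (1, prod_encode (cL, prod_encode (c, Suc i)))) (prod_encode (c1, i)) k \<or>
        (\<exists>b. segG N (prod_encode (1, prod_encode (cL, prod_encode (c, Suc i)))) (prod_encode (c1, i)) k b \<and>
          ind (segN N B) (segG N) b)"
        using i1 i2 by (cases "k = 0") (auto simp: segG_def)
    qed
  qed
next
  case (lim L v)
  show ?case
  proof (intro allI impI)
    fix c cm cw assume c: "vc N c = v" "vc N cm = L" "vc N cw = L"
    have i: "ind (segN N B) (segG N) (prod_encode (1, prod_encode (cm, prod_encode (c, i))))" for i
      using lim c by blast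
    show "ind (segN N B) (segG N) (prod_encode (0, prod_encode (c, prod_encode (cm, cw))))"
    proof (rule ind.rule[where a = "prod_encode (2, 0)"])
      fix k
      show "segN N B (prod_encode (0, prod_encode (c, prod_encode (cm, cw)))) (prod_encode (2, 0)) k \<or>
        (\<exists>b. segG N (prod_encode (0, prod_encode (c, prod_encode (cm, cw)))) (prod_encode (2, 0)) k b \<and>
          ind (segN N B) (segG N) b)"
        using i[of k] c by (auto simp: segG_def)
    qed
  qed
qed

text \<open>Replaces the finiteness test and the maximum in \<open>lv\<close> by number quantifiers,
  under which tame relations are closed. The first alternative is overflow.\<close>

lemma lv_eq_iff:
  assumes "\<And>M M'. Q M \<Longrightarrow> M' \<le> M \<Longrightarrow> Q M'" "Q 0"
  shows "lv {M. Q M} = y \<longleftrightarrow> ((\<forall>M. Q M) \<and> y = 0) \<or> (Q y \<and> \<not> Q (Suc y))"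
proof (cases "\<forall>M. Q M")
  case True
  then show ?thesis by (auto simp: lv_def)
next
  case False
  then obtain M where "\<not> Q M" by blast
  then have "{M. Q M} \<subseteq> {..M}" using assms(1) by (auto simp: not_le) (meson nat_le_linear)
  then have fin: "finite {M. Q M}" using finite_subset by blast
  have m: "Q (Max {M. Q M})" "\<And>K. Q K \<Longrightarrow> K \<le> Max {M. Q M}"
    using Max_in[OF fin] Max_ge[OF fin] assms(2) by auto
  have "Max {M. Q M} = y \<longleftrightarrow> Q y \<and> \<not> Q (Suc y)"
  proof
    assume "Max {M. Q M} = y"
    then show "Q y \<and> \<not> Q (Suc y)" using m by (metis Suc_n_not_le_n)
  next
    assume "Q y \<and> \<not> Q (Suc y)"
    then show "Max {M. Q M} = y" using m assms(1) by (metis le_antisym not_less_eq_eq)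
  qed
  moreover have "lv {M. Q M} = Max {M. Q M}" using fin by (simp add: lv_def)
  ultimately show ?thesis using False by metis
qed


text \<open>If the moves of a level are tame, so is the inductive relation \<open>V\<close> that
  codes \<open>vreach\<close>. The next moves \<open>bm'\<close> and \<open>bs'\<close> arise from
  \<open>V\<close> by number quantifiers and negation, once quantifiers over vectors are replaced by
  quantifiers over codes.\<close>

lemma tame_level:
  assumes P: "\<forall>i\<in>set P. regs_le N i"
  defines "B \<equiv> \<lambda>k g c m w. vc N m = fst (level P g k) (vc N c) \<and> vc N w = snd (level P g k) (vc N c)"
  shows "tame (\<lambda>g n. B k g (pfst n) (pfst (psnd n)) (psnd (psnd n)))"
proof (induction k)
  case 0
  have "tame (\<lambda>g n. vc N (psnd (psnd n)) = stp P g (vc N (pfst n)))"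
    by (rule tame.K_comp2[OF tame_stp[OF P]]; intro itrm_intros)
  then show ?case
    unfolding B_def level.simps fst_conv snd_conv by (intro tame.K_conj tame_vc_eq itrm_intros)
next
  case (Suc k)
  note IH = tame.K_comp3[of "B k", OF Suc]
  have gm: "gmachine (fst (level P g k)) (snd (level P g k)) N" for g using level_props[OF P] by blast
  define V where "V g c m w \<longleftrightarrow> vreach (fst (level P g k)) (snd (level P g k)) (vc N c) (vc N m) (vc N w)" for g c m w
  have V_ind: "V g c m w \<longleftrightarrow> ind (segN N (B k g)) (segG N) (prod_encode (0, prod_encode (c, prod_encode (m, w))))" for g c m w
    using seg_sound[of "B k g" N "fst (level P g k)" "snd (level P g k)" "prod_encode (0, prod_encode (c, prod_encode (m, w)))"]
      seg_complete(1)[of "B k g" N "fst (level P g k)" "snd (level P g k)", OF _ gm]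
    unfolding V_def by (auto simp: B_def)
  have NK: "tame (\<lambda>g n. segN N (B k g) (pfst n) (pfst (psnd n)) (psnd (psnd n)))"
    unfolding segN_def by (intro tame_intros IH)
  have GK: "tame (\<lambda>g n. segG N (pfst n) (pfst (psnd n)) (pfst (psnd (psnd n))) (psnd (psnd (psnd n))))"
    unfolding segG_def by (intro tame_intros tame_minrel tame_vc_eq)
  have VK: "tame (\<lambda>g n. V g (A n) (C n) (E n))"
    if "itrm_fn (\<lambda>x. A)" "itrm_fn (\<lambda>x. C)" "itrm_fn (\<lambda>x. E)" for A C E
    unfolding V_ind by (intro tame.K_comp[OF tame.K_ind[OF NK GK]] itrm_intros that)
  have V_codes: "(\<exists>m w. vreach (fst (level P g k)) (snd (level P g k)) (vc N c) m w \<and> Q m w) \<longleftrightarrow>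
      (\<exists>m w. V g c m w \<and> Q (vc N m) (vc N w))" for g c Q
  proof
    assume "\<exists>m w. vreach (fst (level P g k)) (snd (level P g k)) (vc N c) m w \<and> Q m w"
    then obtain m w where mw: "vreach (fst (level P g k)) (snd (level P g k)) (vc N c) m w" "Q m w" by blast
    have "supp N m \<and> supp N w" using gmachine.gseg_supp[OF gm vreach_imp_gseg[OF mw(1)] vc_supp] .
    then show "\<exists>m w. V g c m w \<and> Q (vc N m) (vc N w)" using mw unfolding V_def by (metis vc_surj)
  qed (unfold V_def, blast)
  define Rc where "Rc g v c \<longleftrightarrow> vc N c = vc N v \<or> (\<exists>m. V g v m c)" for g v c
  define Lc where "Lc g v j M \<longleftrightarrow> (\<exists>c. Rc g v c \<and> (\<forall>m w. V g c m w \<longrightarrow> M \<le> comp m j))" for g v j M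
  have Lc: "Lge (fst (level P g k)) (snd (level P g k)) (vc N v) j M \<longleftrightarrow> Lc g v j M" if j: "j \<le> N" for g v j M
  proof -
    let ?bm = "fst (level P g k)" and ?bs = "snd (level P g k)"
    have reach: "reach0 ?bm ?bs (vc N v) (vc N c) \<longleftrightarrow> Rc g v c" for c
    proof
      assume "reach0 ?bm ?bs (vc N v) (vc N c)"
      then consider "vc N c = vc N v" | m where "vreach ?bm ?bs (vc N v) m (vc N c)"
        unfolding reach0_def by blast
      then show "Rc g v c"
      proof cases
        case 2
        then obtain cm where "vc N cm = m"
          using gmachine.gseg_supp[OF gm vreach_imp_gseg[OF 2] vc_supp] vc_surj by blast
        then show ?thesis using 2 unfolding Rc_def V_def by blast
      qed (simp add: Rc_def)
    qed (auto simp: Rc_def reach0_def V_def)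
    have rsupp: "\<exists>c'. vc N c' = c" if "reach0 ?bm ?bs (vc N v) c" for c
    proof -
      have "supp N c"
        using that gmachine.gseg_supp[OF gm] vreach_imp_gseg vc_supp unfolding reach0_def by blast
      then show ?thesis using vc_surj by blast
    qed
    have all: "(\<forall>m w. vreach ?bm ?bs (vc N c) m w \<longrightarrow> M \<le> m j) \<longleftrightarrow> (\<forall>m w. V g c m w \<longrightarrow> M \<le> comp m j)" for c
      using V_codes[of g c "\<lambda>m w. \<not> M \<le> m j"] j by (auto simp: vc_def)
    show ?thesis
    proof
      assume "Lge ?bm ?bs (vc N v) j M"
      then obtain c where c: "reach0 ?bm ?bs (vc N v) c" "\<forall>m w. vreach ?bm ?bs c m w \<longrightarrow> M \<le> m j"
        unfolding Lge_def by blast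
      obtain c' where "vc N c' = c" using rsupp[OF c(1)] by blast
      then have "Rc g v c'" "\<forall>m w. V g c' m w \<longrightarrow> M \<le> comp m j"
        using c reach[of c'] all[of c'] by simp_all
      then show "Lc g v j M" unfolding Lc_def by blast
    next
      assume "Lc g v j M"
      then obtain c where "Rc g v c" "\<forall>m w. V g c m w \<longrightarrow> M \<le> comp m j" unfolding Lc_def by blast
      then have "reach0 ?bm ?bs (vc N v) (vc N c)" "\<forall>m w. vreach ?bm ?bs (vc N c) m w \<longrightarrow> M \<le> m j"
        using reach[of c] all[of c] by simp_all
      then show "Lge ?bm ?bs (vc N v) j M" unfolding Lge_def by blast
    qed
  qed
  have LcK: "tame (\<lambda>g n. Lc g (A n) (C n) (E n))"
    if "itrm_fn (\<lambda>x. A)" "itrm_fn (\<lambda>x. C)" "itrm_fn (\<lambda>x. E)" for A C E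
    by (rule tame.K_comp3[of Lc, OF _ that]; unfold Lc_def Rc_def;
        intro tame_intros VK tame_vc_eq)
  have bs: "vc N w = bs' (fst (level P g k)) (snd (level P g k)) (vc N v) \<longleftrightarrow>
     (\<forall>j. j \<le> N \<longrightarrow> ((\<forall>M. Lc g v j M) \<and> comp w j = 0) \<or> (Lc g v j (comp w j) \<and> \<not> Lc g v j (Suc (comp w j))))" for g v w
  proof -
    let ?bm = "fst (level P g k)" and ?bs = "snd (level P g k)"
    have "supp N (bs' ?bm ?bs (vc N v))"
      using gmachine.bs_supp[OF conjunct1[OF level_props[OF P, of g "Suc k"]], of "vc N v"] by simp
    then have "vc N w = bs' ?bm ?bs (vc N v) \<longleftrightarrow> (\<forall>j. j \<le> N \<longrightarrow> comp w j = bs' ?bm ?bs (vc N v) j)"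
      by (rule vc_eq_supp)
    also have "\<dots> \<longleftrightarrow> (\<forall>j. j \<le> N \<longrightarrow> ((\<forall>M. Lge ?bm ?bs (vc N v) j M) \<and> comp w j = 0) \<or>
        (Lge ?bm ?bs (vc N v) j (comp w j) \<and> \<not> Lge ?bm ?bs (vc N v) j (Suc (comp w j))))"
    proof -
      have "comp w j = bs' ?bm ?bs (vc N v) j \<longleftrightarrow> ((\<forall>M. Lge ?bm ?bs (vc N v) j M) \<and> comp w j = 0) \<or>
        (Lge ?bm ?bs (vc N v) j (comp w j) \<and> \<not> Lge ?bm ?bs (vc N v) j (Suc (comp w j)))" for j
        unfolding bs'_def
        by (subst eq_commute, rule lv_eq_iff)
          (use gmachine.Lge_mono[OF gm vc_supp] gmachine.Lge_0[OF gm vc_supp] in blast)+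
      then show ?thesis by simp
    qed
    finally show ?thesis using Lc by simp
  qed
  have bm: "vc N m = bm' (fst (level P g k)) (snd (level P g k)) (vc N v) \<longleftrightarrow>
     (\<forall>j. j \<le> N \<longrightarrow> (\<exists>m' w. V g v m' w \<and> comp m' j = comp m j) \<and> (\<forall>m' w. V g v m' w \<longrightarrow> comp m j \<le> comp m' j))" for g v m
  proof -
    let ?bm = "fst (level P g k)" and ?bs = "snd (level P g k)"
    have gm': "gmachine (bm' ?bm ?bs) (bs' ?bm ?bs) N" using level_props[OF P, of g "Suc k"] by simp
    have "supp N (bm' ?bm ?bs (vc N v))" by (rule gmachine.bm_supp[OF gm' vc_supp])
    then have *: "vc N m = bm' ?bm ?bs (vc N v) \<longleftrightarrow> (\<forall>j. j \<le> N \<longrightarrow> comp m j = bm' ?bm ?bs (vc N v) j)"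
      by (rule vc_eq_supp)
    have "comp m j = bm' ?bm ?bs (vc N v) j \<longleftrightarrow>
      (\<exists>m' w. V g v m' w \<and> comp m' j = comp m j) \<and> (\<forall>m' w. V g v m' w \<longrightarrow> comp m j \<le> comp m' j)" if j: "j \<le> N" for j
    proof -
      let ?Q = "\<lambda>y. \<exists>m w. V g v m w \<and> comp m j = y"
      have "(\<lambda>y. \<exists>m w. vreach ?bm ?bs (vc N v) m w \<and> m j = y) = ?Q"
        using V_codes[of g v "\<lambda>m w. m j = y" for y] j by (simp add: vc_def)
      then have bmQ: "bm' ?bm ?bs (vc N v) j = (LEAST y. ?Q y)" unfolding bm'_def by simp
      have "\<exists>y. ?Q y"
        using V_codes[of g v "\<lambda>m w. True"] vreach_vchain.base[of ?bm ?bs "vc N v"] by blast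
      from LeastI_ex[OF this] Least_le[of ?Q]
      have Q: "?Q (LEAST y. ?Q y)" "\<And>y. ?Q y \<Longrightarrow> (LEAST y. ?Q y) \<le> y" by blast+
      show ?thesis
        unfolding bmQ
      proof
        assume "comp m j = (LEAST y. ?Q y)"
        then show "(\<exists>m' w. V g v m' w \<and> comp m' j = comp m j) \<and> (\<forall>m' w. V g v m' w \<longrightarrow> comp m j \<le> comp m' j)"
          using Q by auto
      next
        assume "(\<exists>m' w. V g v m' w \<and> comp m' j = comp m j) \<and> (\<forall>m' w. V g v m' w \<longrightarrow> comp m j \<le> comp m' j)"
        then show "comp m j = (LEAST y. ?Q y)"
          by (intro Least_equality[symmetric]) auto
      qed
    qed
    then show ?thesis using * by auto
  qed
  show ?case
    unfolding B_def level.simps fst_conv snd_conv bs bm by (intro tame_intros VK LcK)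
qed

theorem tame_halts: "tame (\<lambda>g n. halts_with P g 1)"
proof -
  obtain N where N: "N \<ge> 1" "\<forall>i\<in>set P. regs_le N i" using regs_le_ex by blast
  let ?l = "\<lambda>g. level P g (N + 2)"
  have "halts_with P g 1 \<longleftrightarrow> (\<exists>m w. (vc N m = fst (?l g) (vc N 0) \<and> vc N w = snd (?l g) (vc N 0)) \<and>
      length P \<le> comp w 0 \<and> comp w 1 = 1)" for g
  proof -
    have gm: "gmachine (fst (?l g)) (snd (?l g)) N" using level_props[OF N(2)] by blast
    have "supp N (snd (?l g) (vc N 0))" "supp N (fst (?l g) (vc N 0))"
      using gmachine.bs_supp[OF gm vc_supp] gmachine.bm_supp[OF gm vc_supp] by blast+
    then obtain m w where mw: "vc N m = fst (?l g) (vc N 0)" "vc N w = snd (?l g) (vc N 0)"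
      using vc_surj by metis
    have c: "comp w' 0 = vc N w' 0" "comp w' 1 = vc N w' 1" for w' using N(1) by (simp_all add: vc_def)
    show ?thesis
      unfolding halts_with_iff_level[OF N(2)] c using mw unfolding vc_0
      by (intro iffI exI[of _ m] exI[of _ w]) auto
  qed
  moreover have "tame (\<lambda>g n. \<exists>m w. (vc N m = fst (?l g) (vc N 0) \<and> vc N w = snd (?l g) (vc N 0)) \<and>
      length P \<le> comp w 0 \<and> comp w 1 = 1)"
    by (intro tame_intros tame.K_comp3[OF tame_level[OF N(2)], of "\<lambda>_. 0"])
  ultimately show ?thesis by simp
qed

section \<open>Meager sets and conditions\<close>

lemma mem_code_ex: "finite {e. Q e} \<Longrightarrow> \<exists>p. \<forall>e. mem e p \<longleftrightarrow> Q e"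
  by (erule mem_code) auto

definition chi :: "nat set \<Rightarrow> nat \<Rightarrow> bool" where
  "chi x = (\<lambda>n. n \<in> x)"

lemma chi_Collect [simp]: "chi {i. f i} = f"
  by (simp add: chi_def)

lemma meager_reals_chi: "meager_reals X \<longleftrightarrow> meager (chi ` X)"
proof -
  have "(\<lambda>x n. n \<in> x) = chi" by (simp add: chi_def fun_eq_iff)
  then show ?thesis by (simp only: meager_reals_def)
qed

lemma open_sat: "open {f. sat q {i. f i}}"
proof -
  have c: "open {f :: nat \<Rightarrow> bool. f i = b}" for i b
  proof -
    have "open ((\<lambda>f :: nat \<Rightarrow> bool. f i) -` {b})"
      by (intro open_vimage) (auto intro: continuous_on_product_coordinates open_discrete)
    then show ?thesis by (simp add: vimage_def)
  qed
  let ?A = "\<lambda>e. {f :: nat \<Rightarrow> bool. (psnd e = 1 \<longrightarrow> f (pfst e)) \<and> (psnd e = 0 \<longrightarrow> \<not> f (pfst e))}"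
  have "open (?A e)" for e
    using c[of "pfst e" True] c[of "pfst e" False] by (cases "psnd e = 1"; cases "psnd e = 0") auto
  then have "open (\<Inter>e\<in>{e. mem e q}. ?A e)" using finite_mem by blast
  moreover have "(\<Inter>e\<in>{e. mem e q}. ?A e) = {f. sat q {i. f i}}"
  proof (intro set_eqI)
    fix f
    show "f \<in> (\<Inter>e\<in>{e. mem e q}. ?A e) \<longleftrightarrow> f \<in> {f. sat q {i. f i}}"
    proof
      assume f: "f \<in> (\<Inter>e\<in>{e. mem e q}. ?A e)"
      have "f i" if "mem (prod_encode (i, 1)) q" for i
        using f that INT_D[OF f, of "prod_encode (i, 1)"] by simp
      moreover have "\<not> f i" if "mem (prod_encode (i, 0)) q" for i
        using f that INT_D[OF f, of "prod_encode (i, 0)"] by simp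
      ultimately show "f \<in> {f. sat q {i. f i}}" by (simp add: sat_def)
    next
      assume "f \<in> {f. sat q {i. f i}}"
      then have "f \<in> ?A e" if "mem e q" for e
        using that unfolding sat_def by simp (metis One_nat_def pair_simps(3))
      then show "f \<in> (\<Inter>e\<in>{e. mem e q}. ?A e)" by blast
    qed
  qed
  ultimately show ?thesis by simp
qed

lemma sat_ex: "con q \<Longrightarrow> sat q {i. mem (prod_encode (i, 1)) q}"
  by (auto simp: sat_def con_def)

lemma cylinder_in_open:
  assumes "open W" "f \<in> W"
  obtains p where "sat p {i. f i}" "\<And>f'. sat p {i. f' i} \<Longrightarrow> f' \<in> W"
proof -
  have "openin (product_topology (\<lambda>i. euclidean) UNIV) W" using assms(1) by (simp add: open_fun_def)
  from product_topology_open_contains_basis[OF this assms(2)] obtain X where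
    X: "f \<in> (\<Pi>\<^sub>E i\<in>UNIV. X i)" "finite {i. X i \<noteq> UNIV}" "(\<Pi>\<^sub>E i\<in>UNIV. X i) \<subseteq> W"
    by auto
  have "finite {e. e \<in> (\<lambda>i. prod_encode (i, if f i then 1 else 0)) ` {i. X i \<noteq> UNIV}}" using X(2) by simp
  from mem_code_ex[OF this] obtain p where
    p: "\<And>e. mem e p \<longleftrightarrow> e \<in> (\<lambda>i. prod_encode (i, if f i then 1 else 0)) ` {i. X i \<noteq> UNIV}"
    by blast
  have "sat p {i. f i}" unfolding sat_def p by (auto split: if_splits)
  moreover have "f' \<in> W" if f': "sat p {i. f' i}" for f'
  proof -
    have "f' i \<in> X i" for i
    proof (cases "X i = UNIV")
      case False
      then have "mem (prod_encode (i, if f i then 1 else 0)) p" unfolding p by blast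
      then have "f' i = f i" using f' unfolding sat_def by (cases "f i") auto
      then show ?thesis using X(1) by auto
    qed simp
    then show ?thesis using X(3) by auto
  qed
  ultimately show ?thesis using that by blast
qed

lemma nowhere_dense_iff:
  "nowhere_dense S \<longleftrightarrow> (\<forall>p. con p \<longrightarrow> (\<exists>q. ext q p \<and> con q \<and> (\<forall>g. sat q g \<longrightarrow> chi g \<notin> S)))"
proof
  assume nd: "nowhere_dense S"
  show "\<forall>p. con p \<longrightarrow> (\<exists>q. ext q p \<and> con q \<and> (\<forall>g. sat q g \<longrightarrow> chi g \<notin> S))"
  proof (intro allI impI)
    fix p assume p: "con p"
    let ?C = "{f. sat p {i. f i}}"
    have "chi {i. mem (prod_encode (i, 1)) p} \<in> ?C" using sat_ex[OF p] by simp
    then have "\<not> ?C \<subseteq> closure S"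
      using nd interior_maximal[OF _ open_sat, of p "closure S"] unfolding nowhere_dense_def by blast
    then obtain f where f: "f \<in> ?C - closure S" by blast
    have "open (?C - closure S)" using open_sat by (intro open_Diff) auto
    from cylinder_in_open[OF this f] obtain q where
      q: "sat q {i. f i}" "\<And>f'. sat q {i. f' i} \<Longrightarrow> f' \<in> ?C - closure S" by blast
    obtain r where r: "sat r {i. f i}" "ext r q" "ext r p" using sat_common q(1) f by blast
    have "chi g \<notin> S" if "sat r g" for g
    proof -
      have "sat q {i. chi g i}" using sat_ext[OF that r(2)] by (simp add: chi_def)
      then show ?thesis using q(2) closure_subset by blast
    qed
    then show "\<exists>q. ext q p \<and> con q \<and> (\<forall>g. sat q g \<longrightarrow> chi g \<notin> S)" using r sat_con by blast
  qed
next
  assume crit: "\<forall>p. con p \<longrightarrow> (\<exists>q. ext q p \<and> con q \<and> (\<forall>g. sat q g \<longrightarrow> chi g \<notin> S))"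
  show "nowhere_dense S"
    unfolding nowhere_dense_def
  proof (rule ccontr)
    assume "interior (closure S) \<noteq> {}"
    then obtain f where f: "f \<in> interior (closure S)" by blast
    from cylinder_in_open[OF open_interior f] obtain p where
      p: "sat p {i. f i}" "\<And>f'. sat p {i. f' i} \<Longrightarrow> f' \<in> interior (closure S)" by blast
    obtain q where q: "ext q p" "con q" "\<And>g. sat q g \<Longrightarrow> chi g \<notin> S" using crit sat_con[OF p(1)] by blast
    let ?C = "{f. sat q {i. f i}}"
    have "?C \<inter> S = {}" using q(3) by (metis (mono_tags, lifting) chi_Collect disjoint_iff mem_Collect_eq)
    then have "?C \<inter> closure S = {}" using open_sat open_Int_closure_eq_empty by blast
    moreover have "chi {i. mem (prod_encode (i, 1)) q} \<in> ?C" using sat_ex[OF q(2)] by simp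
    moreover have "?C \<subseteq> closure S" using p(2) sat_ext[OF _ q(1)] interior_subset by blast
    ultimately show False by blast
  qed
qed

lemma meager_realsI:
  assumes "\<And>n p. con p \<Longrightarrow> \<exists>q. ext q p \<and> con q \<and> (\<forall>g. sat q g \<longrightarrow> g \<notin> X n)"
  shows "meager_reals (\<Union>n :: nat. X n)"
  unfolding meager_reals_chi meager_def
proof (intro exI conjI allI)
  have "inj chi" by (auto simp: inj_def chi_def fun_eq_iff)
  then show "nowhere_dense (chi ` X n)" for n
    using assms unfolding nowhere_dense_iff by (simp add: inj_image_mem_iff)
  show "chi ` (\<Union>n. X n) = (\<Union>n. chi ` X n)" by blast
qed

lemma meager_reals_subset:
  assumes "meager_reals X" "Y \<subseteq> X"
  shows "meager_reals Y"
proof -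
  obtain N where N: "\<And>n. nowhere_dense (N n)" "chi ` X = (\<Union>n :: nat. N n)"
    using assms(1) unfolding meager_reals_chi meager_def by blast
  have "nowhere_dense (N n \<inter> chi ` Y)" for n
    using N(1)[of n] unfolding nowhere_dense_iff by blast
  moreover have "chi ` Y = (\<Union>n. N n \<inter> chi ` Y)" using N(2) assms(2) by blast
  ultimately show ?thesis unfolding meager_reals_chi meager_def by (intro exI[of _ "\<lambda>n. N n \<inter> chi ` Y"]) auto
qed

text \<open>The Baire category theorem below a condition, for two meager sets at once, so that a
  real can be generic and avoid a given meager set.\<close>

lemma baire:
  assumes "con p" "meager_reals X" "meager_reals Y"
  shows "\<exists>g. sat p g \<and> g \<notin> X \<and> g \<notin> Y"
proof -
  obtain M N where M: "\<And>n. nowhere_dense (M n)" "chi ` X = (\<Union>n :: nat. M n)"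
    and N: "\<And>n. nowhere_dense (N n)" "chi ` Y = (\<Union>n :: nat. N n)"
    using assms(2,3) unfolding meager_reals_chi meager_def by metis
  define good where "good n q r \<longleftrightarrow> ext r q \<and> (\<forall>g. sat r g \<longrightarrow> chi g \<notin> M n \<and> chi g \<notin> N n)" for n q r :: nat
  have "\<exists>q. \<forall>n. (con (q n) \<and> (n = 0 \<longrightarrow> q n = p)) \<and> good n (q n) (q (Suc n))"
  proof (rule dependent_nat_choice)
    show "\<exists>q. con q \<and> ((0::nat) = 0 \<longrightarrow> q = p)" using assms(1) by auto
  next
    fix q and n :: nat assume "con q \<and> (n = 0 \<longrightarrow> q = p)"
    then obtain r where r: "ext r q" "con r" "\<forall>g. sat r g \<longrightarrow> chi g \<notin> M n"
      using M(1)[of n] unfolding nowhere_dense_iff by blast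
    obtain s where s: "ext s r" "con s" "\<forall>g. sat s g \<longrightarrow> chi g \<notin> N n"
      using N(1)[of n] r(2) unfolding nowhere_dense_iff by blast
    have "good n q s" using r s ext_trans sat_ext unfolding good_def by blast
    then show "\<exists>r. (con r \<and> (Suc n = 0 \<longrightarrow> r = p)) \<and> good n q r" using s by auto
  qed
  then obtain q where q: "q 0 = p" "\<And>n. con (q n)" "\<And>n. good n (q n) (q (Suc n))" by blast
  have mono: "ext (q n) (q k)" if "k \<le> n" for n k
    using that
  proof (induction n)
    case (Suc n)
    then show ?case using q(3)[of n] ext_trans by (cases "k = Suc n") (auto simp: good_def)
  qed simp
  \<comment> \<open>Positions that no condition of the sequence decides are kept out of
    \<open>g\<close>.\<close>
  define g where "g = {i. \<exists>n. mem (prod_encode (i, 1)) (q n)}"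
  have sat: "sat (q n) g" for n
  proof -
    have False if "mem (prod_encode (i, 0)) (q n)" "mem (prod_encode (i, 1)) (q k)" for i k
    proof -
      have "mem (prod_encode (i, 0)) (q (max n k))" "mem (prod_encode (i, 1)) (q (max n k))"
        using that mono[of n "max n k"] mono[of k "max n k"] unfolding ext_def by auto
      then show False using q(2) unfolding con_def by blast
    qed
    then show ?thesis unfolding sat_def g_def by blast
  qed
  have "chi g \<notin> M n" "chi g \<notin> N n" for n using q(3)[of n] sat[of "Suc n"] unfolding good_def by blast+
  then have "g \<notin> X" "g \<notin> Y" using M(2) N(2) by blast+
  then show ?thesis using sat[of 0] q(1) by auto
qed

section \<open>Genericity of random reals\<close>

lemma dec_program:
  assumes "dec (\<lambda>x n. R x)"
  shows "\<exists>P. \<forall>x. halts_with P x (if R x then 1 else 0)"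
proof -
  obtain Q where Q: "\<And>x S. \<exists>S'. calls 0 Q x S S' \<and> S' 0 = (if R x then 1 else 0)"
    using assms unfolding dec_def by (rule itrm_fnE) blast
  have "halts_with Q x (if R x then 1 else 0)" for x
  proof -
    obtain S' \<mu> where S': "ecall Q x (\<lambda>_. 0) \<mu> S'" "S' 0 = (if R x then 1 else 0)"
      using Q[of x "\<lambda>_. 0"] unfolding calls_def by blast
    have "placed Q 0 Q" by (simp add: placed_at_def)
    then have "pseg Q x (case_nat 0 (\<lambda>_. 0)) (case_nat 0 \<mu>) (case_nat (0 + length Q) S')"
      using S'(1) unfolding ecall_def by blast
    moreover have "case_nat 0 (\<lambda>_. 0) = (\<lambda>_. 0 :: nat)" by (auto split: nat.split)
    ultimately show ?thesis
      unfolding halts_with_iff_pseg using S'(2)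
      by (intro exI[of _ "case_nat 0 \<mu>"] exI[of _ "case_nat (0 + length Q) S'"]) auto
  qed
  then show ?thesis by blast
qed

lemma dec_ITRM_decidable:
  assumes "dec (\<lambda>x n. R x)"
  shows "ITRM_decidable {x. R x}"
proof -
  obtain P where P: "\<And>x. halts_with P x (if R x then 1 else 0)" using dec_program[OF assms] by blast
  show ?thesis
    unfolding ITRM_decidable_def
  proof (intro exI allI conjI impI)
    fix x
    show "x \<in> {x. R x} \<Longrightarrow> halts_with P x 1" "x \<notin> {x. R x} \<Longrightarrow> halts_with P x 0"
      using P[of x] by simp_all
  qed
qed

lemma dec_ITRM_decidable_in:
  assumes "dec (\<lambda>x n. R x)"
  shows "ITRM_decidable_in {b. R (b \<oplus> y)} y"
proof -
  obtain P where P: "\<And>x. halts_with P x (if R x then 1 else 0)" using dec_program[OF assms] by blast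
  show ?thesis
    unfolding ITRM_decidable_in_def
  proof (intro exI allI conjI impI)
    fix b
    show "b \<in> {b. R (b \<oplus> y)} \<Longrightarrow> halts_with P (b \<oplus> y) 1" "b \<notin> {b. R (b \<oplus> y)} \<Longrightarrow> halts_with P (b \<oplus> y) 0"
      using P[of "b \<oplus> y"] by simp_all
  qed
qed

text \<open>\<open>halts_with\<close> permits any well-order as time, but the state at level
  \<open>N + 2\<close> that determines the output depends on none.\<close>

lemma halts_with_unique: "halts_with P x k \<Longrightarrow> halts_with P x k' \<Longrightarrow> k = k'"
  using regs_le_ex[of P] halts_with_iff_level by metis

lemma itrm_double: "itrm_fn (\<lambda>x. A) \<Longrightarrow> itrm_fn (\<lambda>x n. 2 * A n)"
proof -
  assume A: "itrm_fn (\<lambda>x. A)"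
  have "itrm_fn (\<lambda>x n. (Suc ^^ A n) (A n))" by (intro itrm_iterate itrm_Suc itrm_id A)
  then show ?thesis by (simp add: mult_2)
qed

lemma dec_not_gen:
  assumes "dec2 D"
  shows "dec (\<lambda>x n. \<not> gen D x)"
  unfolding gen_def sat_def
  by (intro dec.K_cond dec_query dec2_comp[OF assms] itrm_intros)

lemma meager_not_gen:
  assumes "dense D"
  shows "meager_reals {g. \<not> gen D g}"
proof -
  have "{g. \<not> gen D g} = (\<Union>n. {g. \<forall>p. sat p g \<longrightarrow> \<not> D n p})" by (auto simp: gen_def)
  moreover have "meager_reals (\<Union>n. {g. \<forall>p. sat p g \<longrightarrow> \<not> D n p})"
    by (rule meager_realsI) (use assms in \<open>unfold dense_def, blast\<close>)
  ultimately show ?thesis by simp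
qed

lemma random_gen: "ITRM_random g \<Longrightarrow> dec2 D \<Longrightarrow> dense D \<Longrightarrow> gen D g"
  using dec_ITRM_decidable[OF dec_not_gen] meager_not_gen unfolding ITRM_random_def by blast

text \<open>If a generic real belonged to \<open>X\<close>, one of its conditions would force
  acceptance, and all generic reals satisfying this condition would be accepted. Since
  \<open>X\<close> is meager, some of them lie outside \<open>X\<close>.\<close>

lemma decidable_meager_not_gen:
  assumes "ITRM_decidable X" "meager_reals X"
  shows "\<exists>D. dec2 D \<and> dense D \<and> (\<forall>g. gen D g \<longrightarrow> g \<notin> X)"
proof -
  obtain P where P: "\<And>x. x \<in> X \<Longrightarrow> halts_with P x 1" "\<And>x. x \<notin> X \<Longrightarrow> halts_with P x 0"
    using assms(1) unfolding ITRM_decidable_def by blast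
  obtain U D where U: "forced_by (\<lambda>g n. halts_with P g 1) U D"
    using tame_halts unfolding tame_def by blast
  have "g \<notin> X" if g: "gen D g" for g
  proof
    assume "g \<in> X"
    then obtain p where p: "sat p g" "U 0 p" using P(1) U g unfolding forced_by_def by blast
    have "meager_reals {g. \<not> gen D g}" using U meager_not_gen unfolding forced_by_def by blast
    then obtain h where h: "sat p h" "h \<notin> X" "gen D h"
      using baire[OF sat_con[OF p(1)] assms(2)] by blast
    then have "halts_with P h 1" using p(2) U unfolding forced_by_def by blast
    then show False using P(2)[OF h(2)] halts_with_unique by fastforce
  qed
  then show ?thesis using U unfolding forced_by_def by blast
qed

text \<open>Genericity is transferred along a computable injection of positions: doubling extracts
  the left half of a join, and \<open>sw\<close> exchanges the halves. For density, the part of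
  \<open>p\<close> on the range of \<open>h\<close> is pulled back, extended into \<open>D n\<close>
  and mapped forward again; the other entries of \<open>p\<close> do not interfere.\<close>

lemma dense_pullback:
  assumes D: "dec2 D" "dense D" and h: "inj h" "dec2 (\<lambda>i k. h i = k)"
  shows "\<exists>E. dec2 E \<and> dense E \<and> (\<forall>g. gen E g \<longrightarrow> gen D {i. h i \<in> g})"
proof -
  \<comment> \<open>The bound on \<open>v\<close> selects the entries that restrict a real.\<close>
  define E where "E n t \<longleftrightarrow> (\<exists>r. D n r \<and> (\<forall>i k v. h i = k \<and> v \<le> 1 \<and> mem (prod_encode (i, v)) r \<longrightarrow>
     mem (prod_encode (k, v)) t))" for n t
  have "dec2 E"
    unfolding dec2_def E_def
    by (intro dec.K_cond dec.K_le dec2_comp[OF D(1)] dec2_comp[OF h(2)] itrm_intros)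
  moreover have "dense E"
    unfolding dense_def
  proof (intro allI impI)
    fix n p assume p: "con p"
    let ?f = "\<lambda>e. prod_encode (h (pfst e), psnd e)"
    have "inj ?f" by (rule injI) (metis h(1) injD pair_simps)
    then have "finite {e. mem (?f e) p}"
      using finite_vimageI[OF finite_mem[of p], of ?f] by (simp add: vimage_def)
    from mem_code_ex[OF this] obtain p' where p': "\<And>e. mem e p' \<longleftrightarrow> mem (?f e) p" by blast
    have "con p'" using p unfolding con_def p' by simp
    then obtain r where r: "ext r p'" "con r" "D n r" using D(2) unfolding dense_def by blast
    have "finite {e. mem e p \<or> (\<exists>e'. mem e' r \<and> e = ?f e')}"
      using finite_mem[of p] finite_imageI[OF finite_mem[of r], of ?f] by (simp add: image_def Collect_disj_eq)
    from mem_code_ex[OF this] obtain q where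
      q: "\<And>e. mem e q \<longleftrightarrow> mem e p \<or> (\<exists>e'. mem e' r \<and> e = ?f e')" by blast
    have "con q"
      unfolding con_def
    proof
      assume "\<exists>i. mem (prod_encode (i, 0)) q \<and> mem (prod_encode (i, 1)) q"
      then obtain i where i: "mem (prod_encode (i, 0)) q" "mem (prod_encode (i, 1)) q" by blast
      have *: "mem (prod_encode (i, v)) p \<or> (\<exists>j. i = h j \<and> mem (prod_encode (j, v)) r)"
        if "mem (prod_encode (i, v)) q" for v
        using that unfolding q by (metis pair_simps)
      have **: "mem (prod_encode (j, v)) r" if "mem (prod_encode (h j, v)) p" for j v
        using r(1) p'[of "prod_encode (j, v)"] that unfolding ext_def by simp
      show False
      proof (cases "\<exists>j. i = h j")
        case True
        then obtain j where "i = h j" by blast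
        then have "mem (prod_encode (j, v)) r" if "mem (prod_encode (i, v)) q" for v
          using *[OF that] ** h(1) by (metis injD)
        then show False using i r(2) unfolding con_def by blast
      next
        case False
        then show False using *[OF i(1)] *[OF i(2)] p unfolding con_def by blast
      qed
    qed
    moreover have "ext q p" unfolding ext_def q by blast
    moreover have "mem (prod_encode (h i, v)) q" if "mem (prod_encode (i, v)) r" for i v
    proof -
      have "prod_encode (h i, v) = ?f (prod_encode (i, v))" by simp
      then show ?thesis unfolding q using that by blast
    qed
    then have "E n q" unfolding E_def using r(3) by blast
    ultimately show "\<exists>q. ext q p \<and> con q \<and> E n q" by blast
  qed
  moreover have "gen D {i. h i \<in> g}" if genE: "gen E g" for g
    unfolding gen_def
  proof
    fix n
    obtain t r where t: "sat t g" "D n r"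
      "\<And>i v. v \<le> 1 \<Longrightarrow> mem (prod_encode (i, v)) r \<Longrightarrow> mem (prod_encode (h i, v)) t"
      using genE unfolding gen_def E_def by blast
    have "sat r {i. h i \<in> g}" using t(1) t(3)[of 0] t(3)[of 1] unfolding sat_def by auto
    then show "\<exists>p. sat p {i. h i \<in> g} \<and> D n p" using t(2) by blast
  qed
  ultimately show ?thesis by blast
qed

lemma join_iff [simp]: "2 * j \<in> a \<oplus> b \<longleftrightarrow> j \<in> a" "Suc (2 * j) \<in> a \<oplus> b \<longleftrightarrow> j \<in> b"
  unfolding join_def by (auto, presburger+)

definition fits :: "nat set \<Rightarrow> nat \<Rightarrow> nat \<Rightarrow> bool" where
  "fits a q r \<longleftrightarrow> (\<forall>j. (mem (prod_encode (2 * j, 1)) r \<longrightarrow> j \<in> a) \<and> (mem (prod_encode (2 * j, 0)) r \<longrightarrow> j \<notin> a) \<and>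
     (mem (prod_encode (Suc (2 * j), 1)) r \<longrightarrow> mem (prod_encode (j, 1)) q) \<and>
     (mem (prod_encode (Suc (2 * j), 0)) r \<longrightarrow> mem (prod_encode (j, 0)) q))"

lemma even_odd_cases:
  fixes i :: nat
  obtains j where "i = 2 * j" | j where "i = Suc (2 * j)"
  by (cases "even i") (auto elim!: evenE oddE)

lemma all_even_odd: "(\<forall>i :: nat. Q i) \<longleftrightarrow> (\<forall>j. Q (2 * j) \<and> Q (Suc (2 * j)))"
  by (metis even_odd_cases)

lemma sat_join_iff:
  "sat r (a \<oplus> b) \<longleftrightarrow> (\<forall>j. (mem (prod_encode (2 * j, 1)) r \<longrightarrow> j \<in> a) \<and> (mem (prod_encode (2 * j, 0)) r \<longrightarrow> j \<notin> a) \<and>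
     (mem (prod_encode (Suc (2 * j), 1)) r \<longrightarrow> j \<in> b) \<and> (mem (prod_encode (Suc (2 * j), 0)) r \<longrightarrow> j \<notin> b))"
  unfolding sat_def by (subst all_even_odd) (auto simp: join_iff)

lemma fits_sat: "fits a q r \<Longrightarrow> sat q b \<Longrightarrow> sat r (a \<oplus> b)"
  unfolding sat_join_iff fits_def sat_def[of q] by blast

lemma half_condition:
  assumes "inj h"
  shows "\<exists>q. \<forall>i v. mem (prod_encode (i, v)) q \<longleftrightarrow> mem (prod_encode (h i, v)) r"
proof -
  let ?f = "\<lambda>e. prod_encode (h (pfst e), psnd e)"
  have "inj ?f" by (rule injI) (metis assms injD pair_simps)
  then have "finite {e. mem (?f e) r}"
    using finite_vimageI[OF finite_mem[of r], of ?f] by (simp add: vimage_def)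
  from mem_code_ex[OF this] obtain q where "\<And>e. mem e q \<longleftrightarrow> mem (?f e) r" by blast
  then show ?thesis by (intro exI[of _ q]) simp
qed

lemma join_condition:
  "\<exists>t. (\<forall>j v. mem (prod_encode (2 * j, v)) t \<longleftrightarrow> mem (prod_encode (j, v)) s) \<and>
    (\<forall>j v. mem (prod_encode (Suc (2 * j), v)) t \<longleftrightarrow> mem (prod_encode (j, v)) p)"
proof -
  let ?f = "\<lambda>e. prod_encode (2 * pfst e, psnd e)" and ?g = "\<lambda>e. prod_encode (Suc (2 * pfst e), psnd e)"
  have "finite {e. e \<in> ?f ` {e. mem e s} \<union> ?g ` {e. mem e p}}" using finite_mem by simp
  from mem_code_ex[OF this] obtain t where
    t: "\<And>e. mem e t \<longleftrightarrow> e \<in> ?f ` {e. mem e s} \<union> ?g ` {e. mem e p}" by blast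
  have odd: "2 * a \<noteq> Suc (2 * b)" "Suc (2 * b) \<noteq> 2 * a" for a b :: nat by presburger+
  have "mem (prod_encode (2 * j, v)) t \<longleftrightarrow> mem (prod_encode (j, v)) s"
    "mem (prod_encode (Suc (2 * j), v)) t \<longleftrightarrow> mem (prod_encode (j, v)) p" for j v
    unfolding t by (auto simp: image_iff odd, (metis pair_simps)?)
  then show ?thesis by blast
qed

text \<open>The effective Kuratowski-Ulam argument. A real \<open>a\<close> is bad if for some
  \<open>n\<close> a consistent \<open>p\<close> on the right half has no consistent extension that,
  together with \<open>a\<close>, enters \<open>D n\<close>. Badness is decidable because
  \<open>D\<close> is computable. For fixed \<open>n\<close> and \<open>p\<close> the bad reals are
  nowhere dense: a condition on the left is joined with \<open>p\<close>, extended into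
  \<open>D n\<close> and split again. So a random \<open>x\<close> is not bad, which is the density
  needed for its section.\<close>

lemma random_section:
  assumes x: "ITRM_random x" and D: "dec2 D" "dense D"
  shows "meager_reals {b. \<not> gen D (x \<oplus> b)}"
proof -
  define bad where "bad a n p \<longleftrightarrow> con p \<and> \<not> (\<exists>q r. ext q p \<and> con q \<and> D n r \<and> fits a q r)" for a n p
  have "dec (\<lambda>a k. \<exists>n p. bad a n p)"
    unfolding bad_def fits_def
    by (intro dec.K_cond dec_query dec2_comp[OF D(1)] itrm_intros itrm_double)
  then have "ITRM_decidable {a. \<exists>n p. bad a n p}" by (rule dec_ITRM_decidable)
  moreover have "meager_reals {a. \<exists>n p. bad a n p}"
  proof -
    have "{a. \<exists>n p. bad a n p} = (\<Union>k. {a. bad a (pfst k) (psnd k)})" by (auto, metis pair_simps(1,2))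
    moreover have "meager_reals (\<Union>k. {a. bad a (pfst k) (psnd k)})"
    proof (rule meager_realsI)
      fix k s assume s: "con s"
      show "\<exists>s'. ext s' s \<and> con s' \<and> (\<forall>a. sat s' a \<longrightarrow> a \<notin> {a. bad a (pfst k) (psnd k)})"
      proof (cases "con (psnd k)")
        case False
        then show ?thesis using s by (intro exI[of _ s]) (simp add: bad_def)
      next
        case True
        obtain t where t: "\<And>j v. mem (prod_encode (2 * j, v)) t \<longleftrightarrow> mem (prod_encode (j, v)) s"
            "\<And>j v. mem (prod_encode (Suc (2 * j), v)) t \<longleftrightarrow> mem (prod_encode (j, v)) (psnd k)"
          using join_condition by blast
        have "con t" unfolding con_def
        proof
          assume "\<exists>i. mem (prod_encode (i, 0)) t \<and> mem (prod_encode (i, 1)) t"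
          then obtain i where i: "mem (prod_encode (i, 0)) t" "mem (prod_encode (i, 1)) t" by blast
          obtain j where "i = 2 * j \<or> i = Suc (2 * j)" using even_odd_cases by metis
          then show False using i t s True unfolding con_def by blast
        qed
        then obtain r where r: "ext r t" "con r" "D (pfst k) r" using D(2) unfolding dense_def by blast
        obtain s' where s': "\<And>j v. mem (prod_encode (j, v)) s' \<longleftrightarrow> mem (prod_encode (2 * j, v)) r"
          using half_condition[of "\<lambda>j. 2 * j" r] unfolding inj_def by auto
        obtain q where q: "\<And>j v. mem (prod_encode (j, v)) q \<longleftrightarrow> mem (prod_encode (Suc (2 * j), v)) r"
          using half_condition[of "\<lambda>j. Suc (2 * j)" r] unfolding inj_def by auto
        have "con s'" "con q" using r(2) unfolding con_def s' q by blast+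
        moreover have "ext s' s" "ext q (psnd k)"
          using r(1) t s' q unfolding ext_def by (metis pair_simps(3))+
        moreover have "fits a q r" if "sat s' a" for a
          using that unfolding fits_def sat_def s' q by blast
        ultimately show ?thesis using r(3) unfolding bad_def by blast
      qed
    qed
    ultimately show ?thesis by simp
  qed
  ultimately have good: "\<not> bad x n p" for n p using x unfolding ITRM_random_def by blast
  have "{b. \<not> gen D (x \<oplus> b)} = (\<Union>n. {b. \<forall>r. sat r (x \<oplus> b) \<longrightarrow> \<not> D n r})" by (auto simp: gen_def)
  moreover have "meager_reals (\<Union>n. {b. \<forall>r. sat r (x \<oplus> b) \<longrightarrow> \<not> D n r})"
  proof (rule meager_realsI)
    fix n p assume "con p"
    then obtain q r where "ext q p" "con q" "D n r" "fits x q r" using good[of n p] unfolding bad_def by blast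
    then show "\<exists>q. ext q p \<and> con q \<and> (\<forall>b. sat q b \<longrightarrow> b \<notin> {b. \<forall>r. sat r (x \<oplus> b) \<longrightarrow> \<not> D n r})"
      using fits_sat by blast
  qed
  ultimately show ?thesis by simp
qed

text \<open>The exchange of halves is needed because decidability in an oracle puts that oracle on
  the right, whereas in the theorem \<open>x\<close> is on the left.\<close>

definition sw :: "nat \<Rightarrow> nat" where
  "sw i = (if even i then Suc i else i - 1)"

lemma sw_simps: "sw (2 * j) = Suc (2 * j)" "sw (Suc (2 * j)) = 2 * j"
  by (simp_all add: sw_def)

lemma sw_iff: "sw i = k \<longleftrightarrow> (\<exists>j. (i = 2 * j \<and> k = Suc (2 * j)) \<or> (i = Suc (2 * j) \<and> k = 2 * j))"
proof (cases "even i")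
  case True
  then obtain j where "i = 2 * j" by (rule evenE)
  then show ?thesis by (auto simp: sw_def) presburger+
next
  case False
  then obtain j where "i = 2 * j + 1" by (rule oddE)
  then show ?thesis by (auto simp: sw_def) presburger+
qed

lemma inj_sw: "inj sw"
  unfolding inj_def by (metis sw_iff sw_simps)

lemma dec2_sw: "dec2 (\<lambda>i k. sw i = k)"
  unfolding dec2_def sw_iff by (intro dec.K_cond itrm_intros itrm_double)

lemma sw_join: "{i. sw i \<in> a \<oplus> b} = b \<oplus> a"
proof (intro set_eqI)
  fix i
  obtain j where "i = 2 * j \<or> i = Suc (2 * j)" using even_odd_cases by metis
  then show "i \<in> {i. sw i \<in> a \<oplus> b} \<longleftrightarrow> i \<in> b \<oplus> a" by (auto simp: sw_simps)
qed

section \<open>Randomness of joins\<close>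

lemma random_join_left:
  assumes "ITRM_random (x \<oplus> y)"
  shows "ITRM_random x"
  unfolding ITRM_random_def
proof
  assume "\<exists>X. ITRM_decidable X \<and> meager_reals X \<and> x \<in> X"
  then obtain X D where "x \<in> X" and D: "dec2 D" "dense D" and X: "\<And>g. gen D g \<Longrightarrow> g \<notin> X"
    using decidable_meager_not_gen by metis
  have h: "inj (\<lambda>i :: nat. 2 * i)" "dec2 (\<lambda>i k. 2 * i = k)"
    by (simp add: inj_def, unfold dec2_def, intro dec.K_cond itrm_intros itrm_double)
  obtain E where E: "dec2 E" "dense E" "\<And>g. gen E g \<Longrightarrow> gen D {i. 2 * i \<in> g}"
    using dense_pullback[OF D h] by blast
  have "gen D x" using E(3)[OF random_gen[OF assms E(1,2)]] by simp
  then show False using X \<open>x \<in> X\<close> by blast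
qed

lemma random_swap:
  assumes "ITRM_random (x \<oplus> y)"
  shows "ITRM_random (y \<oplus> x)"
  unfolding ITRM_random_def
proof
  assume "\<exists>X. ITRM_decidable X \<and> meager_reals X \<and> y \<oplus> x \<in> X"
  then obtain X D where "y \<oplus> x \<in> X" and D: "dec2 D" "dense D" and X: "\<And>g. gen D g \<Longrightarrow> g \<notin> X"
    using decidable_meager_not_gen by metis
  obtain E where E: "dec2 E" "dense E" "\<And>g. gen E g \<Longrightarrow> gen D {i. sw i \<in> g}"
    using dense_pullback[OF D inj_sw dec2_sw] by blast
  have "gen D (y \<oplus> x)" using E(3)[OF random_gen[OF assms E(1,2)]] by (simp add: sw_join)
  then show False using X \<open>y \<oplus> x \<in> X\<close> by blast
qed

text \<open>If a meager set \<open>Y\<close> decided in \<open>x\<close> contained \<open>y\<close>,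
  a condition \<open>p\<close> on \<open>y \<oplus> x\<close> would force acceptance. Its left half
  leaves room for a real \<open>b\<close> outside \<open>Y\<close> for which
  \<open>b \<oplus> x\<close> is still generic, since \<open>x\<close> is random and has a comeager
  section; then \<open>b\<close> would be accepted as well.\<close>

lemma random_join_rel:
  assumes "ITRM_random (x \<oplus> y)"
  shows "ITRM_random_rel y x"
  unfolding ITRM_random_rel_def
proof
  assume "\<exists>Y. ITRM_decidable_in Y x \<and> meager_reals Y \<and> y \<in> Y"
  then obtain Y P where Y: "meager_reals Y" "y \<in> Y" "\<And>b. b \<in> Y \<Longrightarrow> halts_with P (b \<oplus> x) 1"
      "\<And>b. b \<notin> Y \<Longrightarrow> halts_with P (b \<oplus> x) 0"
    unfolding ITRM_decidable_in_def by blast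
  obtain U D where U: "forced_by (\<lambda>g n. halts_with P g 1) U D" using tame_halts unfolding tame_def by blast
  then have D: "dec2 D" "dense D" unfolding forced_by_def by blast+
  obtain E where E: "dec2 E" "dense E" "\<And>g. gen E g \<Longrightarrow> gen D {i. sw i \<in> g}"
    using dense_pullback[OF D inj_sw dec2_sw] by blast
  have ED: "gen D (b \<oplus> x)" if "gen E (x \<oplus> b)" for b using E(3)[OF that] by (simp add: sw_join)
  have "gen D (y \<oplus> x)" using ED random_gen[OF assms E(1,2)] by blast
  then obtain p where p: "sat p (y \<oplus> x)" "U 0 p" using Y(2,3) U unfolding forced_by_def by blast
  obtain q where q: "\<And>j v. mem (prod_encode (j, v)) q \<longleftrightarrow> mem (prod_encode (2 * j, v)) p"
    using half_condition[of "\<lambda>j. 2 * j" p] unfolding inj_def by auto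
  have "con q" using sat_con[OF p(1)] unfolding con_def q by blast
  moreover have "meager_reals {b. \<not> gen E (x \<oplus> b)}"
    using random_section[OF random_join_left[OF assms] E(1,2)] .
  ultimately obtain b where b: "sat q b" "b \<notin> Y" "gen E (x \<oplus> b)" using baire Y(1) by blast
  have "sat p (b \<oplus> x)" using p(1) b(1) unfolding sat_join_iff sat_def[of q] q by blast
  then have "halts_with P (b \<oplus> x) 1" using p(2) U ED[OF b(3)] unfolding forced_by_def by blast
  then show False using Y(4)[OF b(2)] halts_with_unique by fastforce
qed

lemma random_joinI:
  assumes "ITRM_random x" "ITRM_random_rel y x"
  shows "ITRM_random (x \<oplus> y)"
  unfolding ITRM_random_def
proof
  assume "\<exists>X. ITRM_decidable X \<and> meager_reals X \<and> x \<oplus> y \<in> X"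
  then obtain X D where "x \<oplus> y \<in> X" and D: "dec2 D" "dense D" and X: "\<And>g. gen D g \<Longrightarrow> g \<notin> X"
    using decidable_meager_not_gen by metis
  \<comment> \<open>\<open>E\<close> places \<open>y\<close> on the left, as the relative notion
    demands; the second exchange \<open>F\<close> puts \<open>x\<close> back on the left, where
    \<open>random_section\<close> expects it.\<close>
  obtain E where E: "dec2 E" "dense E" "\<And>g. gen E g \<Longrightarrow> gen D {i. sw i \<in> g}"
    using dense_pullback[OF D inj_sw dec2_sw] by blast
  obtain F where F: "dec2 F" "dense F" "\<And>g. gen F g \<Longrightarrow> gen E {i. sw i \<in> g}"
    using dense_pullback[OF E(1,2) inj_sw dec2_sw] by blast
  have "{b. \<not> gen E (b \<oplus> x)} \<subseteq> {b. \<not> gen F (x \<oplus> b)}" using F(3)[of "x \<oplus> _"] by (auto simp: sw_join)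
  then have "meager_reals {b. \<not> gen E (b \<oplus> x)}"
    using meager_reals_subset random_section[OF assms(1) F(1,2)] by blast
  then have "gen E (y \<oplus> x)"
    using assms(2) dec_ITRM_decidable_in[OF dec_not_gen[OF E(1)]] unfolding ITRM_random_rel_def by blast
  then have "gen D (x \<oplus> y)" using E(3)[of "y \<oplus> x"] by (simp add: sw_join)
  then show False using X \<open>x \<oplus> y \<in> X\<close> by blast
qed

text \<open>For random \<open>x\<close> and \<open>y\<close>, each side of the second equivalence
  amounts to randomness of the join in one of its two orders, and these agree by
  \<open>random_swap\<close>.\<close>

theorem theorem19:
  fixes x y :: "nat set"
  shows "(ITRM_random (x \<oplus> y) \<longleftrightarrow> ITRM_random x \<and> ITRM_random_rel y x) \<and>
    (ITRM_random x \<and> ITRM_random y \<longrightarrow> (ITRM_random_rel x y \<longleftrightarrow> ITRM_random_rel y x))"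
  using random_join_left random_join_rel random_joinI random_swap by blast

end
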